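(* Let $(M^n, g, X, \rho)$ be a compact almost Yamabe soliton with $n \ge 3$, and let $R$ be the scalar curvature of $g$. (i) If either $0 \le \rho \le R$ on $M$, or $\langle X, \nabla\rho \rangle \le 0$ on $M$, then $X$ is a Killing vector field. (ii) If ${\rm Ric}(X, X) \le 0$ on $M$, then $X$ is a parallel Killing vector field. (iii) If $\int_M R^2 \, dV= 2 \int_M \rho^2\, dV$, then $X$ is a Killing vector field and $(M, g, X)$ is a Yamabe soliton with $R=\rho=0$.
   Context: An almost Yamabe soliton $(M^n,g,X,\rho)$ is a (smooth) Riemannian $n$-manifold $(M^n,g)$ together with a smooth vector field $X$ and a smooth function $\rho$ on $M$ such that $\frac12 \mathcal{L}_X g = (R-\rho)\, g$, where $\mathcal{L}$ is the Lie derivative and $R$ is the scalar curvature of $g$. If $\rho=\lambda$ is constant, $(M,g,X)$ is called a Yamabe soliton. $X$ is Killing if $\mathcal{L}_X g=0$, i.e. $R-\rho\equiv 0$. $X$ is parallel if $\nabla X = 0$. Compact means compact without boundary. ${\rm Ric}$ is the Ricci tensor of $g$ and $\langle\cdot,\cdot\rangle=g$. *)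

theory Defs
  imports "HOL-Analysis.Analysis"
begin

section \<open>Smooth maps on open subsets of Euclidean space\<close>

definition partial :: "'n \<Rightarrow> (real^'n::finite \<Rightarrow> 'b::real_normed_vector) \<Rightarrow> real^'n \<Rightarrow> 'b" where
  "partial i f x = frechet_derivative f (at x) (axis i 1)"

primrec Ck_on :: "nat \<Rightarrow> (real^'n::finite \<Rightarrow> 'b::real_normed_vector) \<Rightarrow> (real^'n) set \<Rightarrow> bool" where
  "Ck_on 0 f S \<longleftrightarrow> continuous_on S f"
| "Ck_on (Suc k) f S \<longleftrightarrow> (\<forall>x\<in>S. f differentiable (at x)) \<and> (\<forall>i. Ck_on k (partial i f) S)"

text \<open>Only meaningful for open \<open>S\<close>.\<close>

definition smooth_on :: "(real^'n::finite \<Rightarrow> 'b::real_normed_vector) \<Rightarrow> (real^'n) set \<Rightarrow> bool" where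
  "smooth_on f S \<longleftrightarrow> (\<forall>k. Ck_on k f S)"

section \<open>Smooth manifolds\<close>

text \<open>A chart is a pair of its domain and its coordinate map. Charts are open in the whole of
  \<open>real^'n\<close>, so the manifolds below have dimension \<open>CARD('n)\<close> and no boundary. They are not
  assumed to be connected or orientable. The atlas need not be maximal.\<close>

type_synonym ('a, 'n) chart = "'a set \<times> ('a \<Rightarrow> real^'n)"

definition coord_image :: "('a, 'n::finite) chart \<Rightarrow> (real^'n) set" where
  "coord_image c = snd c ` fst c"

definition coord_inv :: "('a, 'n::finite) chart \<Rightarrow> real^'n \<Rightarrow> 'a" where
  "coord_inv c = inv_into (fst c) (snd c)"

definition transition :: "('a, 'n::finite) chart \<Rightarrow> ('a, 'n) chart \<Rightarrow> real^'n \<Rightarrow> real^'n" where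
  "transition c d = snd d \<circ> coord_inv c"

definition is_chart :: "'a topology \<Rightarrow> ('a, 'n::finite) chart \<Rightarrow> bool" where
  "is_chart T c \<longleftrightarrow> openin T (fst c) \<and> open (coord_image c) \<and>
     homeomorphic_map (subtopology T (fst c)) (top_of_set (coord_image c)) (snd c)"

definition smooth_manifold :: "'a topology \<Rightarrow> ('a, 'n::finite) chart set \<Rightarrow> bool" where
  "smooth_manifold T A \<longleftrightarrow>
     Hausdorff_space T \<and> second_countable T \<and>
     (\<forall>c\<in>A. is_chart T c) \<and> (\<Union>c\<in>A. fst c) = topspace T \<and>
     (\<forall>c\<in>A. \<forall>d\<in>A. smooth_on (transition c d) (snd c ` (fst c \<inter> fst d)))"

section \<open>Functions and tensor fields\<close>

definition smooth_function :: "('a, 'n::finite) chart set \<Rightarrow> ('a \<Rightarrow> real) \<Rightarrow> bool" where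
  "smooth_function A f \<longleftrightarrow> (\<forall>c\<in>A. smooth_on (f \<circ> coord_inv c) (coord_image c))"

text \<open>A tensor field is given by its components in each chart of the atlas, as functions of the
  coordinates, subject to the transformation law under changes of charts. For a vector field,
  \<open>X c x $ i\<close> is the component along the \<open>i\<close>-th coordinate vector of the chart \<open>c\<close>.\<close>

definition smooth_vector_field ::
  "('a, 'n::finite) chart set \<Rightarrow> (('a, 'n) chart \<Rightarrow> real^'n \<Rightarrow> real^'n) \<Rightarrow> bool" where
  "smooth_vector_field A X \<longleftrightarrow>
     (\<forall>c\<in>A. smooth_on (X c) (coord_image c)) \<and>
     (\<forall>c\<in>A. \<forall>d\<in>A. \<forall>p\<in>fst c \<inter> fst d.
        X d (snd d p) = jacobian (transition c d) (at (snd c p)) *v X c (snd c p))"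

definition riemannian_metric ::
  "('a, 'n::finite) chart set \<Rightarrow> (('a, 'n) chart \<Rightarrow> real^'n \<Rightarrow> real^'n^'n) \<Rightarrow> bool" where
  "riemannian_metric A g \<longleftrightarrow>
     (\<forall>c\<in>A. smooth_on (g c) (coord_image c)) \<and>
     (\<forall>c\<in>A. \<forall>d\<in>A. \<forall>p\<in>fst c \<inter> fst d.
        g c (snd c p) = transpose (jacobian (transition c d) (at (snd c p))) ** g d (snd d p)
                          ** jacobian (transition c d) (at (snd c p))) \<and>
     (\<forall>c\<in>A. \<forall>x\<in>coord_image c.
        transpose (g c x) = g c x \<and> (\<forall>v. v \<noteq> 0 \<longrightarrow> v \<bullet> (g c x *v v) > 0))"

text \<open>The function on the manifold described by local expressions \<open>F c\<close> in the charts. It is used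
  only for expressions \<open>F\<close> that are invariant under changes of charts, so that the choice of the
  chart is irrelevant.\<close>

definition scalar_of ::
  "('a, 'n::finite) chart set \<Rightarrow> (('a, 'n) chart \<Rightarrow> real^'n \<Rightarrow> real) \<Rightarrow> 'a \<Rightarrow> real" where
  "scalar_of A F p = (let c = (SOME c. c \<in> A \<and> p \<in> fst c) in F c (snd c p))"

section \<open>Riemannian geometry in one chart\<close>

definition christoffel ::
  "(real^'n::finite \<Rightarrow> real^'n^'n) \<Rightarrow> 'n \<Rightarrow> 'n \<Rightarrow> 'n \<Rightarrow> real^'n \<Rightarrow> real" where
  "christoffel h k i j x = (\<Sum>l\<in>UNIV. matrix_inv (h x) $ k $ l *
     (partial i (\<lambda>y. h y $ j $ l) x + partial j (\<lambda>y. h y $ i $ l) x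
        - partial l (\<lambda>y. h y $ i $ j) x)) / 2"

text \<open>\<open>riemann h l i j k\<close> is the component along the \<open>l\<close>-th coordinate vector \<open>e\<^sub>l\<close> of
  \<open>R(e\<^sub>i, e\<^sub>j) e\<^sub>k = (\<nabla>\<^sub>i \<nabla>\<^sub>j - \<nabla>\<^sub>j \<nabla>\<^sub>i) e\<^sub>k\<close>. The Ricci tensor \<open>Ric(Y, Z)\<close> is the trace of
  \<open>V \<mapsto> R(V, Y) Z\<close>, so that round spheres have positive Ricci and scalar curvature.\<close>

definition riemann ::
  "(real^'n::finite \<Rightarrow> real^'n^'n) \<Rightarrow> 'n \<Rightarrow> 'n \<Rightarrow> 'n \<Rightarrow> 'n \<Rightarrow> real^'n \<Rightarrow> real" where
  "riemann h l i j k x =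
     partial i (christoffel h l j k) x - partial j (christoffel h l i k) x
     + (\<Sum>m\<in>UNIV. christoffel h l i m x * christoffel h m j k x
                   - christoffel h l j m x * christoffel h m i k x)"

definition ricci :: "(real^'n::finite \<Rightarrow> real^'n^'n) \<Rightarrow> real^'n \<Rightarrow> real^'n^'n" where
  "ricci h x = (\<chi> j k. \<Sum>i\<in>UNIV. riemann h i i j k x)"

definition scal :: "(real^'n::finite \<Rightarrow> real^'n^'n) \<Rightarrow> real^'n \<Rightarrow> real" where
  "scal h x = (\<Sum>j\<in>UNIV. \<Sum>k\<in>UNIV. matrix_inv (h x) $ j $ k * ricci h x $ j $ k)"

definition gradient :: "(real^'n::finite \<Rightarrow> real^'n^'n) \<Rightarrow> (real^'n \<Rightarrow> real) \<Rightarrow> real^'n \<Rightarrow> real^'n" where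
  "gradient h f x = matrix_inv (h x) *v (\<chi> j. partial j f x)"

definition lie_derivative ::
  "(real^'n::finite \<Rightarrow> real^'n) \<Rightarrow> (real^'n \<Rightarrow> real^'n^'n) \<Rightarrow> real^'n \<Rightarrow> real^'n^'n" where
  "lie_derivative Y h x = (\<chi> i j. \<Sum>k\<in>UNIV.
     Y x $ k * partial k (\<lambda>y. h y $ i $ j) x
     + h x $ k $ j * partial i (\<lambda>y. Y y $ k) x
     + h x $ i $ k * partial j (\<lambda>y. Y y $ k) x)"

text \<open>The entry \<open>$ i $ j\<close> is \<open>\<nabla>\<^sub>j Y\<^sup>i\<close>.\<close>

definition covariant_derivative ::
  "(real^'n::finite \<Rightarrow> real^'n^'n) \<Rightarrow> (real^'n \<Rightarrow> real^'n) \<Rightarrow> real^'n \<Rightarrow> real^'n^'n" where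
  "covariant_derivative h Y x = (\<chi> i j.
     partial j (\<lambda>y. Y y $ i) x + (\<Sum>k\<in>UNIV. christoffel h i j k x * Y x $ k))"

section \<open>Global notions\<close>

definition scalar_curvature ::
  "('a, 'n::finite) chart set \<Rightarrow> (('a, 'n) chart \<Rightarrow> real^'n \<Rightarrow> real^'n^'n) \<Rightarrow> 'a \<Rightarrow> real" where
  "scalar_curvature A g = scalar_of A (\<lambda>c. scal (g c))"

definition metric_inner ::
  "('a, 'n::finite) chart set \<Rightarrow> (('a, 'n) chart \<Rightarrow> real^'n \<Rightarrow> real^'n^'n) \<Rightarrow>
   (('a, 'n) chart \<Rightarrow> real^'n \<Rightarrow> real^'n) \<Rightarrow> (('a, 'n) chart \<Rightarrow> real^'n \<Rightarrow> real^'n) \<Rightarrow> 'a \<Rightarrow> real" where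
  "metric_inner A g X Y = scalar_of A (\<lambda>c x. X c x \<bullet> (g c x *v Y c x))"

definition grad ::
  "(('a, 'n::finite) chart \<Rightarrow> real^'n \<Rightarrow> real^'n^'n) \<Rightarrow> ('a \<Rightarrow> real) \<Rightarrow>
   ('a, 'n) chart \<Rightarrow> real^'n \<Rightarrow> real^'n" where
  "grad g f c = gradient (g c) (f \<circ> coord_inv c)"

definition Ric ::
  "('a, 'n::finite) chart set \<Rightarrow> (('a, 'n) chart \<Rightarrow> real^'n \<Rightarrow> real^'n^'n) \<Rightarrow>
   (('a, 'n) chart \<Rightarrow> real^'n \<Rightarrow> real^'n) \<Rightarrow> (('a, 'n) chart \<Rightarrow> real^'n \<Rightarrow> real^'n) \<Rightarrow> 'a \<Rightarrow> real" where
  "Ric A g X Y = scalar_of A (\<lambda>c x. X c x \<bullet> (ricci (g c) x *v Y c x))"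

text \<open>The Riemannian measure \<open>dV\<close>: the unique Borel measure that is \<open>sqrt (det g) dx\<close> in every
  chart. It does not need an orientation.\<close>

definition riemannian_measure ::
  "'a topology \<Rightarrow> ('a, 'n::finite) chart set \<Rightarrow> (('a, 'n) chart \<Rightarrow> real^'n \<Rightarrow> real^'n^'n) \<Rightarrow>
   'a measure" where
  "riemannian_measure T A g = (THE \<mu>.
     space \<mu> = topspace T \<and> sets \<mu> = sigma_sets (topspace T) {U. openin T U} \<and>
     (\<forall>c\<in>A. \<forall>B\<in>sets \<mu>. B \<subseteq> fst c \<longrightarrow>
        emeasure \<mu> B = (\<integral>\<^sup>+x\<in>snd c ` B. ennreal (sqrt (det (g c x))) \<partial>lborel)))"

definition killing_field ::
  "('a, 'n::finite) chart set \<Rightarrow> (('a, 'n) chart \<Rightarrow> real^'n \<Rightarrow> real^'n^'n) \<Rightarrow>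
   (('a, 'n) chart \<Rightarrow> real^'n \<Rightarrow> real^'n) \<Rightarrow> bool" where
  "killing_field A g X \<longleftrightarrow> (\<forall>c\<in>A. \<forall>x\<in>coord_image c. lie_derivative (X c) (g c) x = 0)"

definition parallel_field ::
  "('a, 'n::finite) chart set \<Rightarrow> (('a, 'n) chart \<Rightarrow> real^'n \<Rightarrow> real^'n^'n) \<Rightarrow>
   (('a, 'n) chart \<Rightarrow> real^'n \<Rightarrow> real^'n) \<Rightarrow> bool" where
  "parallel_field A g X \<longleftrightarrow> (\<forall>c\<in>A. \<forall>x\<in>coord_image c. covariant_derivative (g c) (X c) x = 0)"

definition almost_yamabe_soliton ::
  "'a topology \<Rightarrow> ('a, 'n::finite) chart set \<Rightarrow> (('a, 'n) chart \<Rightarrow> real^'n \<Rightarrow> real^'n^'n) \<Rightarrow>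
   (('a, 'n) chart \<Rightarrow> real^'n \<Rightarrow> real^'n) \<Rightarrow> ('a \<Rightarrow> real) \<Rightarrow> bool" where
  "almost_yamabe_soliton T A g X \<rho> \<longleftrightarrow>
     smooth_manifold T A \<and> riemannian_metric A g \<and> smooth_vector_field A X \<and>
     smooth_function A \<rho> \<and>
     (\<forall>c\<in>A. \<forall>p\<in>fst c. (1/2) *\<^sub>R lie_derivative (X c) (g c) (snd c p)
                          = (scalar_curvature A g p - \<rho> p) *\<^sub>R g c (snd c p))"

definition yamabe_soliton ::
  "'a topology \<Rightarrow> ('a, 'n::finite) chart set \<Rightarrow> (('a, 'n) chart \<Rightarrow> real^'n \<Rightarrow> real^'n^'n) \<Rightarrow>
   (('a, 'n) chart \<Rightarrow> real^'n \<Rightarrow> real^'n) \<Rightarrow> bool" where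
  "yamabe_soliton T A g X \<longleftrightarrow> (\<exists>a. almost_yamabe_soliton T A g X (\<lambda>_. a))"

end

theory Submission
  imports Defs
begin

text \<open>
  Put \<open>\<phi> = R - \<rho>\<close>. The soliton equation says that \<open>\<nabla>X = \<phi> I + N\<close> with \<open>N\<close> skew with respect to the metric,
  so \<open>div X = n \<phi>\<close>. Everything follows from the divergence theorem applied to four vector fields:
  \<open>X\<close> gives \<open>\<integral> \<phi> = 0\<close>; by the contracted second Bianchi identity \<open>2 Ric(X) - R X\<close> has divergence
  \<open>(2 - n) \<phi> R\<close>, whence \<open>\<integral> \<phi> R = 0\<close>; the field \<open>\<rho> X\<close> has divergence \<open>\<langle>X, \<nabla>\<rho>\<rangle> + n \<rho> \<phi>\<close>; and by the
  Ricci identity \<open>\<nabla>\<^sub>X X - (div X) X\<close> has divergence \<open>Ric(X, X) - n (n - 1) \<phi>\<^sup>2 + tr N\<^sup>2\<close>, where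
  \<open>tr N\<^sup>2 = - |N|\<^sup>2\<close>.

  The curvature identities are matrix identities for the connection matrices in one chart, and the
  transformation law of the Christoffel symbols comes from the uniqueness of the torsion-free metric
  connection. The divergence theorem reduces, by \<open>C\<^sup>1\<close> bump functions, to compactly supported
  functions on Euclidean space, where it is the translation invariance of Lebesgue measure.
\<close>

section \<open>Differential calculus in coordinates\<close>

text \<open>Once the four divergences are known, only algebra under the integral is left. If <X,
  grad \<rho>> is nonpositive, then \<rho> \<phi> has nonnegative integral, and \<phi>^2 = \<phi> R
  - \<rho> \<phi> integrates to something nonpositive. If the integrals of R^2 and \<rho>^2 are in
  ratio 2, then \<phi>^2 = 2 \<phi> R - R^2 + \<rho>^2 integrates to minus the integral of \<rho>^2.
  The dimension bound is what permits division by 2 - n in the identity for \<phi> R.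

  The shape of the rest comes from the encoding. A tensor field is a family of component functions,
  so a divergence is a function on the manifold only after connection, curvature and covariant
  derivative have been transported between charts. The Riemannian measure is given by
  \<open>THE\<close>, so nothing can be integrated before its existence and uniqueness are known.
  Compactness enters through finite covers: finitely many charts cut the manifold into Borel pieces,
  the total volume is finite, and finitely many bump functions suffice. Since these are only of
  class C^1, the calculus is set up for every finite order \<open>k\<close> and the divergence
  theorem is stated for C^1 fields.\<close>

lemma partial_eq:
  assumes "(f has_derivative f') (at x)"
  shows "partial i f x = f' (axis i 1)"
  by (simp add: partial_def frechet_derivative_at[OF assms, symmetric])

lemma has_derivative_partial:
  fixes f :: "real^'n::finite \<Rightarrow> 'b::real_normed_vector"
  assumes "f differentiable (at x)"
  shows "(f has_derivative (\<lambda>v. \<Sum>i\<in>UNIV. (v $ i) *\<^sub>R partial i f x)) (at x)"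
proof -
  have d: "(f has_derivative frechet_derivative f (at x)) (at x)"
    using assms frechet_derivative_works by blast
  interpret bounded_linear "frechet_derivative f (at x)"
    using d by (rule has_derivative_bounded_linear)
  have "frechet_derivative f (at x) v = (\<Sum>i\<in>UNIV. (v $ i) *\<^sub>R partial i f x)" for v
  proof -
    have "(\<Sum>i\<in>UNIV. (v $ i) *\<^sub>R axis i 1) = v"
      using basis_expansion[of v] by (simp add: scalar_mult_eq_scaleR)
    from arg_cong[OF this[symmetric], of "frechet_derivative f (at x)"]
    show ?thesis by (simp add: sum scaleR partial_def)
  qed
  then show ?thesis using d by presburger
qed

text \<open>The two functions have the same derivatives at \<open>x\<close>, so the choice operator
  in \<open>frechet_derivative\<close> picks the same one. The equality therefore holds for merely
  locally equal functions, differentiable or not.\<close>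

lemma partial_cong:
  assumes "open S" "x \<in> S" "\<And>y. y \<in> S \<Longrightarrow> f y = g y"
  shows "partial i f x = partial i g x"
proof -
  have "(f has_derivative f') (at x) \<longleftrightarrow> (g has_derivative f') (at x)" for f'
    using has_derivative_transform_within_open[OF _ assms(1,2)] assms(3) by metis
  then show ?thesis by (simp add: partial_def frechet_derivative_def)
qed

lemma differentiable_cong_open:
  assumes "open S" "x \<in> S" "\<And>y. y \<in> S \<Longrightarrow> f y = g y"
  shows "f differentiable (at x) \<longleftrightarrow> g differentiable (at x)"
  using has_derivative_transform_within_open[OF _ assms(1,2)] assms(3)
  unfolding differentiable_def by metis

lemma Ck_on_cong:
  fixes f g :: "real^'n::finite \<Rightarrow> 'b::real_normed_vector"
  assumes "open S" "\<And>y. y \<in> S \<Longrightarrow> f y = g y"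
  shows "Ck_on k f S \<longleftrightarrow> Ck_on k g S"
  using assms(2)
proof (induction k arbitrary: f g)
  case 0
  then show ?case by (simp cong: continuous_on_cong)
next
  case (Suc k)
  have "Ck_on k (partial i f) S \<longleftrightarrow> Ck_on k (partial i g) S" for i
    using partial_cong[OF \<open>open S\<close>] Suc by blast
  moreover have "f differentiable (at x) \<longleftrightarrow> g differentiable (at x)" if "x \<in> S" for x
    using differentiable_cong_open[OF \<open>open S\<close> that] Suc by blast
  ultimately show ?case by simp
qed

lemma Ck_on_subset: "Ck_on k f S \<Longrightarrow> T \<subseteq> S \<Longrightarrow> Ck_on k f T"
  by (induction k arbitrary: f) (auto intro: continuous_on_subset)

lemma Ck_on_SucD: "Ck_on (Suc k) f S \<Longrightarrow> Ck_on k f S"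
  by (induction k arbitrary: f)
     (auto intro!: continuous_at_imp_continuous_on differentiable_imp_continuous_within)

lemma Ck_on_mono:
  assumes "Ck_on k f S" "j \<le> k" shows "Ck_on j f S"
  using assms(2,1) by (induction k rule: dec_induct) (auto dest: Ck_on_SucD simp del: Ck_on.simps)

lemma smooth_on_imp_Ck_on: "smooth_on f S \<Longrightarrow> Ck_on k f S"
  by (simp add: smooth_on_def)

lemma Ck_on_differentiable: "Ck_on (Suc k) f S \<Longrightarrow> x \<in> S \<Longrightarrow> f differentiable (at x)"
  by simp

lemma Ck_on_partial: "Ck_on (Suc k) f S \<Longrightarrow> Ck_on k (partial i f) S"
  by simp

lemma Ck_on_continuous: "Ck_on k f S \<Longrightarrow> continuous_on S f"
  using Ck_on_mono[of k f S 0] by simp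

text \<open>Serves to glue: a function given by one formula on a chart and by zero near every other
  point is of class C^k on the union.\<close>

lemma Ck_on_local:
  assumes "open S" "\<And>x. x \<in> S \<Longrightarrow> \<exists>U. open U \<and> x \<in> U \<and> Ck_on k f U"
  shows "Ck_on k f S"
  using assms(2)
proof (induction k arbitrary: f)
  case 0
  show ?case unfolding Ck_on.simps
  proof (rule continuous_at_imp_continuous_on, intro ballI)
    fix x assume "x \<in> S"
    then obtain U where "open U" "x \<in> U" "Ck_on 0 f U" using 0 by blast
    then show "isCont f x" by (auto simp: continuous_on_eq_continuous_at)
  qed
next
  case (Suc k)
  have "Ck_on k (partial i f) S" for i
    by (rule Suc.IH) (use Suc.prems in fastforce)
  moreover have "f differentiable (at x)" if "x \<in> S" for x
    using Suc.prems[OF that] by auto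
  ultimately show ?case by simp
qed

lemma partial_bounded_linear:
  assumes "bounded_linear L" "f differentiable (at x)"
  shows "partial i (\<lambda>y. L (f y)) x = L (partial i f x)"
proof -
  have "(f has_derivative frechet_derivative f (at x)) (at x)"
    using assms(2) frechet_derivative_works by blast
  from partial_eq[OF bounded_linear.has_derivative[OF assms(1) this]] show ?thesis
    by (simp add: partial_def)
qed

lemma Ck_on_bounded_linear:
  assumes "bounded_linear L" "open S" "Ck_on k f S"
  shows "Ck_on k (\<lambda>x. L (f x)) S"
  using assms(3)
proof (induction k arbitrary: f)
  case 0
  then show ?case using assms(1) by (auto intro: bounded_linear.continuous_on)
next
  case (Suc k)
  have "Ck_on k (partial i (\<lambda>x. L (f x))) S" for i
    using Ck_on_cong[OF \<open>open S\<close>, of "partial i (\<lambda>x. L (f x))" "\<lambda>x. L (partial i f x)" k]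
      partial_bounded_linear[OF assms(1) Ck_on_differentiable[OF Suc.prems]]
      Suc.IH[OF Ck_on_partial[OF Suc.prems]] by simp
  moreover have "(\<lambda>x. L (f x)) differentiable at x" if "x \<in> S" for x
    using Suc.prems that assms(1) bounded_linear.has_derivative
    unfolding Ck_on.simps differentiable_def by blast
  ultimately show ?case by simp
qed

lemma partial_const [simp]: "partial i (\<lambda>x. c) x = 0"
  using partial_eq[OF has_derivative_const, of i c x] by simp

lemma Ck_on_const [simp]: "Ck_on k (\<lambda>x::real^'n::finite. c) S"
proof (induction k arbitrary: c)
  case (Suc k)
  have "partial i (\<lambda>x::real^'n. c) = (\<lambda>x. 0)" for i by auto
  then show ?case using Suc by simp
qed simp

lemma partial_add:
  assumes "f differentiable (at x)" "g differentiable (at x)"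
  shows "partial i (\<lambda>y. f y + g y) x = partial i f x + partial i g x"
proof -
  note d = assms[THEN frechet_derivative_works[THEN iffD1]]
  from partial_eq[OF has_derivative_add[OF d]] show ?thesis by (simp add: partial_def)
qed

lemma Ck_on_add:
  assumes "open S" "Ck_on k f S" "Ck_on k g S"
  shows "Ck_on k (\<lambda>x. f x + g x) S"
  using assms(2,3)
proof (induction k arbitrary: f g)
  case 0
  then show ?case by (auto intro: continuous_intros)
next
  case (Suc k)
  have "Ck_on k (partial i (\<lambda>x. f x + g x)) S" for i
    using Ck_on_cong[OF \<open>open S\<close>, of "partial i (\<lambda>x. f x + g x)" "\<lambda>x. partial i f x + partial i g x" k]
      partial_add[OF Suc.prems[THEN Ck_on_differentiable]]
      Suc.IH[OF Suc.prems[THEN Ck_on_partial]] by simp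
  then show ?case using Suc.prems by auto
qed

lemma Ck_on_sum:
  assumes "open S" "\<And>a. a \<in> I \<Longrightarrow> Ck_on k (f a) S"
  shows "Ck_on k (\<lambda>x. \<Sum>a\<in>I. f a x) S"
  using assms(2) by (induction I rule: infinite_finite_induct) (auto intro: Ck_on_add[OF assms(1)])

lemma partial_sum:
  assumes "\<And>a. a \<in> I \<Longrightarrow> f a differentiable (at x)"
  shows "partial i (\<lambda>y. \<Sum>a\<in>I. f a y) x = (\<Sum>a\<in>I. partial i (f a) x)"
  using assms
proof (induction I rule: infinite_finite_induct)
  case (insert a I)
  then have "(\<lambda>y. \<Sum>a\<in>I. f a y) differentiable (at x)" by (intro differentiable_sum) auto
  with insert show ?case by (simp add: partial_add)
qed auto

text \<open>One product rule for an arbitrary bounded bilinear map; products of reals, scalings,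
  inner products, matrix products and matrix-vector products are instances.\<close>

lemma partial_bounded_bilinear:
  assumes "bounded_bilinear b" "f differentiable (at x)" "g differentiable (at x)"
  shows "partial i (\<lambda>y. b (f y) (g y)) x = b (f x) (partial i g x) + b (partial i f x) (g x)"
proof -
  note d = assms(2,3)[THEN frechet_derivative_works[THEN iffD1]]
  from partial_eq[OF bounded_bilinear.FDERIV[OF assms(1) d]] show ?thesis by (simp add: partial_def)
qed

lemma differentiable_bounded_bilinear:
  assumes "bounded_bilinear b" "f differentiable (at x)" "g differentiable (at x)"
  shows "(\<lambda>y. b (f y) (g y)) differentiable (at x)"
  using assms bounded_bilinear.FDERIV unfolding differentiable_def by blast

lemma Ck_on_bounded_bilinear:
  assumes "bounded_bilinear b" "open S" "Ck_on k f S" "Ck_on k g S"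
  shows "Ck_on k (\<lambda>x. b (f x) (g x)) S"
  using assms(3,4)
proof (induction k arbitrary: f g)
  case 0
  then show ?case using bounded_bilinear.continuous_on[OF assms(1)] by simp
next
  case (Suc k)
  have "Ck_on k (\<lambda>x. b (f x) (partial i g x) + b (partial i f x) (g x)) S" for i
    by (intro Ck_on_add[OF \<open>open S\<close>] Suc.IH) (use Suc.prems in \<open>auto dest: Ck_on_SucD simp del: Ck_on.simps intro: Ck_on_partial\<close>)
  then have "Ck_on k (partial i (\<lambda>x. b (f x) (g x))) S" for i
    using Ck_on_cong[OF \<open>open S\<close>, of "partial i (\<lambda>x. b (f x) (g x))"
        "\<lambda>x. b (f x) (partial i g x) + b (partial i f x) (g x)" k]
      partial_bounded_bilinear[OF assms(1) Suc.prems[THEN Ck_on_differentiable]] by simp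
  then show ?case
    using differentiable_bounded_bilinear[OF assms(1) Suc.prems[THEN Ck_on_differentiable]] by simp
qed

lemmas Ck_on_mult = Ck_on_bounded_bilinear[OF bounded_bilinear_mult]
lemmas Ck_on_scaleR = Ck_on_bounded_bilinear[OF bounded_bilinear_scaleR]
lemmas Ck_on_inner = Ck_on_bounded_bilinear[OF bounded_bilinear_inner]
lemmas Ck_on_uminus = Ck_on_bounded_linear[OF bounded_linear_minus[OF bounded_linear_ident]]

lemma Ck_on_diff:
  "open S \<Longrightarrow> Ck_on k f S \<Longrightarrow> Ck_on k g S \<Longrightarrow> Ck_on k (\<lambda>x. f x - g x) S"
  using Ck_on_add[of S k f "\<lambda>x. - g x"] Ck_on_uminus[of S k g] by simp

lemmas Ck_on_nth = Ck_on_bounded_linear[OF bounded_linear_vec_nth]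

lemma partial_nth:
  "f differentiable (at x) \<Longrightarrow> partial i (\<lambda>y. f y $ j) x = partial i f x $ j"
  by (rule partial_bounded_linear[OF bounded_linear_vec_nth])

lemmas bounded_linear_vec_nth2 = bounded_linear_compose[OF bounded_linear_vec_nth bounded_linear_vec_nth]

lemma partial_nth2:
  assumes "f differentiable (at x)"
  shows "partial i (\<lambda>y. f y $ j $ k) x = partial i f x $ j $ k"
  by (rule partial_bounded_linear[OF bounded_linear_vec_nth2 assms])

lemma differentiable_vec:
  fixes f :: "'a::real_normed_vector \<Rightarrow> 'b::real_normed_vector^'m::finite"
  assumes "\<And>j. (\<lambda>y. f y $ j) differentiable (at x)"
  shows "f differentiable (at x)"
proof -
  have L: "bounded_linear (axis j :: 'b \<Rightarrow> 'b^'m)" for j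
    by (rule bounded_linear_intro[where K=1])
      (auto simp: vec_eq_iff axis_def norm_vec_def L2_set_def if_distrib[of norm] power2_eq_square
        if_distrib[of "\<lambda>x. x * y" for y] cong: if_cong)
  have f: "f = (\<lambda>y. \<Sum>j\<in>UNIV. axis j (f y $ j))"
    by (auto simp: fun_eq_iff vec_eq_iff axis_def)
  have "(\<lambda>y. axis j (f y $ j)) differentiable (at x)" for j
    using assms[of j] bounded_linear.has_derivative[OF L] unfolding differentiable_def by blast
  then show ?thesis by (subst f) (intro differentiable_sum, auto)
qed

lemma Ck_on_vec:
  fixes f :: "real^'n::finite \<Rightarrow> 'b::real_normed_vector^'m::finite"
  assumes "open S" "\<And>j. Ck_on k (\<lambda>x. f x $ j) S"
  shows "Ck_on k f S"
  using assms(2)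
proof (induction k arbitrary: f)
  case 0
  then have "continuous_on S (\<lambda>x. \<chi> j. f x $ j)" by (intro continuous_on_vec_lambda) simp
  then show ?case by simp
next
  case (Suc k)
  have d: "f differentiable (at x)" if "x \<in> S" for x
    using that by (intro differentiable_vec Ck_on_differentiable[OF Suc.prems])
  have "Ck_on k (\<lambda>x. partial i f x $ j) S" for i j
    using Ck_on_cong[OF \<open>open S\<close>, of "partial i (\<lambda>x. f x $ j)" "\<lambda>x. partial i f x $ j"]
      Ck_on_partial[OF Suc.prems] partial_nth[OF d] by auto
  then have "Ck_on k (partial i f) S" for i using Suc.IH by blast
  then show ?case using d by simp
qed

lemma partial_compose:
  fixes f :: "real^'m::finite \<Rightarrow> 'b::real_normed_vector" and \<psi> :: "real^'n::finite \<Rightarrow> real^'m"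
  assumes "\<psi> differentiable (at x)" "f differentiable (at (\<psi> x))"
  shows "partial i (\<lambda>y. f (\<psi> y)) x = (\<Sum>a\<in>UNIV. (partial i \<psi> x $ a) *\<^sub>R partial a f (\<psi> x))"
proof -
  have d: "(\<psi> has_derivative frechet_derivative \<psi> (at x)) (at x)"
    using assms(1) frechet_derivative_works by blast
  show ?thesis
    using partial_eq[OF has_derivative_compose[OF d has_derivative_partial[OF assms(2)]], of i]
    by (simp add: partial_def)
qed

lemma differentiable_compose_at:
  assumes "\<psi> differentiable (at x)" "f differentiable (at (\<psi> x))"
  shows "(\<lambda>y. f (\<psi> y)) differentiable (at x)"
  using assms has_derivative_compose unfolding differentiable_def by blast

lemma Ck_on_compose:
  fixes f :: "real^'m::finite \<Rightarrow> 'b::real_normed_vector" and \<psi> :: "real^'n::finite \<Rightarrow> real^'m"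
  assumes "open S" "\<psi> ` S \<subseteq> S'" "Ck_on k \<psi> S" "Ck_on k f S'"
  shows "Ck_on k (\<lambda>x. f (\<psi> x)) S"
  using assms(3,4)
proof (induction k arbitrary: f)
  case 0
  then show ?case using assms(2) by (auto intro: continuous_on_compose2)
next
  case (Suc k)
  have "Ck_on k (\<lambda>x. \<Sum>a\<in>UNIV. (partial i \<psi> x $ a) *\<^sub>R partial a f (\<psi> x)) S" for i
    by (intro Ck_on_sum[OF assms(1)] Ck_on_scaleR[OF assms(1)] Ck_on_nth[OF assms(1)]
        Ck_on_partial[OF Suc.prems(1)] Suc.IH Ck_on_SucD[OF Suc.prems(1)] Ck_on_partial[OF Suc.prems(2)])
  moreover have d: "\<psi> differentiable at x" "f differentiable at (\<psi> x)" if "x \<in> S" for x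
    using that assms(2) Ck_on_differentiable[OF Suc.prems(1)] Ck_on_differentiable[OF Suc.prems(2)]
    by blast+
  ultimately have "Ck_on k (partial i (\<lambda>x. f (\<psi> x))) S" for i
    using Ck_on_cong[OF assms(1), of "partial i (\<lambda>x. f (\<psi> x))"
        "\<lambda>x. \<Sum>a\<in>UNIV. (partial i \<psi> x $ a) *\<^sub>R partial a f (\<psi> x)" k]
      partial_compose[OF d] by simp
  then show ?case using differentiable_compose_at[OF d] by simp
qed

lemma partial_compose_real:
  fixes f :: "real^'n::finite \<Rightarrow> real"
  assumes "f differentiable (at x)" "(\<theta> has_real_derivative D) (at (f x))"
  shows "partial i (\<lambda>y. \<theta> (f y)) x = D * partial i f x"
    and "(\<lambda>y. \<theta> (f y)) differentiable (at x)"
proof -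
  have d: "(f has_derivative frechet_derivative f (at x)) (at x)"
    using assms(1) frechet_derivative_works by blast
  note * = has_derivative_compose[OF d assms(2)[unfolded has_field_derivative_def]]
  show "partial i (\<lambda>y. \<theta> (f y)) x = D * partial i f x"
    using partial_eq[OF *] by (simp add: partial_def)
  show "(\<lambda>y. \<theta> (f y)) differentiable (at x)" using * by (auto simp: differentiable_def)
qed

text \<open>The derivative of 1/f is a product of 1/f, 1/f and the derivative of f, so the induction
  on the order feeds itself. The square root below works in the same way.\<close>

lemma Ck_on_inverse:
  fixes f :: "real^'n::finite \<Rightarrow> real"
  assumes "open S" "\<And>x. x \<in> S \<Longrightarrow> f x \<noteq> 0" "Ck_on k f S"
  shows "Ck_on k (\<lambda>x. inverse (f x)) S"
  using assms(3)
proof (induction k)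
  case 0
  then show ?case using assms by (auto intro: continuous_intros)
next
  case (Suc k)
  have *: "partial i (\<lambda>x. inverse (f x)) x = - (inverse (f x) * inverse (f x)) * partial i f x"
    "(\<lambda>y. inverse (f y)) differentiable (at x)" if "x \<in> S" for x i
    using partial_compose_real[of f x inverse "- (inverse (f x) * inverse (f x))"]
      DERIV_inverse[of "f x"] Ck_on_differentiable[OF Suc.prems that] assms(2)[OF that]
    by (auto simp: numeral_2_eq_2)
  have "Ck_on k (\<lambda>x. - (inverse (f x) * inverse (f x)) * partial i f x) S" for i
    by (intro Ck_on_mult Ck_on_uminus assms(1) Suc.IH Ck_on_SucD[OF Suc.prems] Ck_on_partial[OF Suc.prems])
  then have "Ck_on k (partial i (\<lambda>x. inverse (f x))) S" for i
    using Ck_on_cong[OF assms(1)] *(1) by (metis (no_types, lifting))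
  then show ?case using * by simp
qed

lemma Ck_on_sqrt:
  fixes f :: "real^'n::finite \<Rightarrow> real"
  assumes "open S" "\<And>x. x \<in> S \<Longrightarrow> f x > 0" "Ck_on k f S"
  shows "Ck_on k (\<lambda>x. sqrt (f x)) S"
  using assms(3)
proof (induction k)
  case 0
  then show ?case using assms by (auto intro: continuous_intros)
next
  case (Suc k)
  have *: "partial i (\<lambda>x. sqrt (f x)) x = inverse (sqrt (f x)) / 2 * partial i f x"
    "(\<lambda>y. sqrt (f y)) differentiable (at x)" if "x \<in> S" for x i
    using partial_compose_real[of f x sqrt "inverse (sqrt (f x)) / 2"]
      DERIV_real_sqrt[of "f x"] Ck_on_differentiable[OF Suc.prems that] assms(2)[OF that]
    by auto
  have "Ck_on k (\<lambda>x. (inverse (sqrt (f x)) * (1/2)) * partial i f x) S" for i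
    by (intro Ck_on_mult Ck_on_inverse assms(1) Suc.IH Ck_on_SucD[OF Suc.prems] Ck_on_partial[OF Suc.prems]
        Ck_on_const) (use assms(2) in force)
  then have "Ck_on k (partial i (\<lambda>x. sqrt (f x))) S" for i
    using Ck_on_cong[OF assms(1), of "partial i (\<lambda>x. sqrt (f x))" "\<lambda>x. (inverse (sqrt (f x)) * (1/2)) * partial i f x"] *(1) by simp
  then show ?case using * by simp
qed

section \<open>Symmetry of second partial derivatives\<close>

lemma has_vector_derivative_line:
  fixes f :: "real^'n::finite \<Rightarrow> 'b::real_normed_vector"
  assumes "f differentiable (at (z + t *\<^sub>R axis i 1))"
  shows "((\<lambda>t. f (z + t *\<^sub>R axis i 1)) has_vector_derivative partial i f (z + t *\<^sub>R axis i 1)) (at t)"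
proof -
  have d: "(f has_derivative frechet_derivative f (at (z + t *\<^sub>R axis i 1))) (at (z + t *\<^sub>R axis i 1))"
    using assms frechet_derivative_works by blast
  have "((\<lambda>t. z + t *\<^sub>R (axis i 1::real^'n)) has_derivative (\<lambda>s. s *\<^sub>R axis i 1)) (at t)"
    by (auto intro!: derivative_eq_intros)
  from has_derivative_compose[OF this d] show ?thesis
    using linear_cmul[OF has_derivative_linear[OF d]] by (simp add: has_vector_derivative_def partial_def)
qed

text \<open>The left side is the second difference over a small parallelogram and is symmetric in
  \<open>i\<close> and \<open>j\<close>. The mean value theorem, applied along \<open>i\<close> and
  then along \<open>j\<close>, turns it into a mixed derivative at a nearby point; the bound on
  \<open>s\<close> keeps the parallelogram inside the ball.\<close>

lemma Schwarz_mean_value: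
  fixes f :: "real^'n::finite \<Rightarrow> real"
  assumes "Ck_on 2 f (ball x r)" "0 < s" "2 * s < r"
  shows "\<exists>y\<in>cball x (2 * s). f (x + s *\<^sub>R axis i 1 + s *\<^sub>R axis j 1) - f (x + s *\<^sub>R axis i 1)
      - f (x + s *\<^sub>R axis j 1) + f x = s * s * partial j (partial i f) y"
proof -
  let ?p = "\<lambda>a b. x + a *\<^sub>R axis i 1 + b *\<^sub>R axis j 1 :: real^'n"
  have c: "?p a b \<in> cball x (2 * s)" if "0 \<le> a" "a \<le> s" "0 \<le> b" "b \<le> s" for a b
  proof -
    have "norm (a *\<^sub>R axis i 1 + b *\<^sub>R axis j 1 :: real^'n) \<le> \<bar>a\<bar> + \<bar>b\<bar>"
      by (rule order_trans[OF norm_triangle_ineq]) (simp add: norm_axis_1)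
    moreover have "dist x (?p a b) = norm (a *\<^sub>R axis i 1 + b *\<^sub>R axis j 1 :: real^'n)"
      unfolding dist_commute[of x] by (simp add: dist_norm)
    ultimately show ?thesis using that by simp
  qed
  then have b: "?p a b \<in> ball x r" if "0 \<le> a" "a \<le> s" "0 \<le> b" "b \<le> s" for a b
    using that assms(3) by fastforce
  have df: "f differentiable (at y)" "partial i f differentiable (at y)" if "y \<in> ball x r" for y
    using assms(1) that by (auto simp: numeral_2_eq_2)
  \<comment> \<open>The second difference is \<open>?F s - ?F 0\<close>, an increment along
    \<open>i\<close> of increments along \<open>j\<close>.\<close>
  let ?F = "\<lambda>a. f (?p a s) - f (?p a 0)"
  have "(?F has_real_derivative (partial i f (?p a s) - partial i f (?p a 0))) (at a)" if "0 \<le> a" "a \<le> s" for a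
  proof -
    have swap: "?p a b = (x + b *\<^sub>R axis j 1) + a *\<^sub>R axis i 1" for a b by simp
    have "((\<lambda>a. f (?p a b)) has_real_derivative partial i f (?p a b)) (at a)" if "0 \<le> b" "b \<le> s" for b
      unfolding has_real_derivative_iff_has_vector_derivative swap
      by (rule has_vector_derivative_line) (use df(1) b[of a b] that \<open>0 \<le> a\<close> \<open>a \<le> s\<close> in \<open>simp only: swap\<close>)
    from DERIV_diff[OF this[of s] this[of 0]] show ?thesis using assms(2) by simp
  qed
  from MVT2[OF assms(2) this] obtain \<xi> where \<xi>: "0 < \<xi>" "\<xi> < s"
    "?F s - ?F 0 = (s - 0) * (partial i f (?p \<xi> s) - partial i f (?p \<xi> 0))" by blast
  have "((\<lambda>b. partial i f (?p \<xi> b)) has_real_derivative partial j (partial i f) (?p \<xi> b)) (at b)"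
    if "0 \<le> b" "b \<le> s" for b
    unfolding has_real_derivative_iff_has_vector_derivative
    by (rule has_vector_derivative_line) (use df(2) b[of \<xi> b] that \<xi> in auto)
  from MVT2[OF assms(2) this] obtain \<eta> where \<eta>: "0 < \<eta>" "\<eta> < s"
    "partial i f (?p \<xi> s) - partial i f (?p \<xi> 0) = (s - 0) * partial j (partial i f) (?p \<xi> \<eta>)" by blast
  have "?F s - ?F 0 = s * s * partial j (partial i f) (?p \<xi> \<eta>)"
    using \<xi>(3) \<eta>(3) by simp
  then show ?thesis
    by (intro bexI[of _ "?p \<xi> \<eta>"] c) (use \<xi> \<eta> in auto)
qed

lemma partial_commute_real:
  fixes f :: "real^'n::finite \<Rightarrow> real"
  assumes "open S" "x \<in> S" "Ck_on 2 f S"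
  shows "partial i (partial j f) x = partial j (partial i f) x"
proof (rule ccontr)
  assume ne: "\<not> ?thesis"
  \<comment> \<open>Half the distance of the two mixed derivatives: both will lie closer than this
    to one common value, which is absurd.\<close>
  let ?e = "dist (partial i (partial j f) x) (partial j (partial i f) x) / 2"
  have e: "?e > 0" using ne by simp
  have "isCont (partial i (partial j f)) x" "isCont (partial j (partial i f)) x"
    using assms by (auto simp: numeral_2_eq_2 continuous_on_eq_continuous_at)
  then obtain d1 d2 where d: "d1 > 0" "d2 > 0"
    "\<And>y. dist y x < d1 \<Longrightarrow> dist (partial i (partial j f) y) (partial i (partial j f) x) < ?e"
    "\<And>y. dist y x < d2 \<Longrightarrow> dist (partial j (partial i f) y) (partial j (partial i f) x) < ?e"
    using e unfolding continuous_at_eps_delta by metis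
  obtain r where r: "r > 0" "ball x r \<subseteq> S" using assms(1,2) openE by blast
  \<comment> \<open>Division by 4 makes \<open>2 * s\<close>, the radius in
    \<open>Schwarz_mean_value\<close>, strictly smaller than all three radii.\<close>
  define s where "s = min r (min d1 d2) / 4"
  have s: "0 < s" "2 * s < r" "2 * s < d1" "2 * s < d2" using d r by (auto simp: s_def)
  have C: "Ck_on 2 f (ball x r)" using Ck_on_subset[OF assms(3) r(2)] .
  obtain y z where y: "y \<in> cball x (2 * s)" and z: "z \<in> cball x (2 * s)" and
     "s * s * partial j (partial i f) y = s * s * partial i (partial j f) z"
    using Schwarz_mean_value[OF C s(1,2), of i j] Schwarz_mean_value[OF C s(1,2), of j i]
    by (auto simp: algebra_simps)
  then have eq: "partial j (partial i f) y = partial i (partial j f) z" using s(1) by simp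
  have "dist (partial i (partial j f) z) (partial i (partial j f) x) < ?e"
    "dist (partial j (partial i f) y) (partial j (partial i f) x) < ?e"
    using d(3)[of z] d(4)[of y] y z s by (auto simp: dist_commute)
  then show False unfolding eq dist_real_def by (auto simp: abs_real_def split: if_splits)
qed

text \<open>A matrix is a vector of vectors, so this reduction is applied twice: from vectors to
  reals and from matrices to vectors.\<close>

lemma partial_commute_componentwise:
  fixes f :: "real^'n::finite \<Rightarrow> 'b::real_normed_vector^'m::finite"
  assumes S: "open S" "x \<in> S" and f: "Ck_on 2 f S"
    and c: "\<And>a. partial i (partial j (\<lambda>y. f y $ a)) x = partial j (partial i (\<lambda>y. f y $ a)) x"
  shows "partial i (partial j f) x = partial j (partial i f) x"
proof -
  have *: "partial i (partial j f) x $ a = partial i (partial j (\<lambda>y. f y $ a)) x" for i j a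
  proof -
    have d: "partial j f differentiable (at x)" "\<And>y. y \<in> S \<Longrightarrow> f differentiable (at y)"
      using S f by (auto simp: numeral_2_eq_2)
    show ?thesis unfolding partial_nth[OF d(1), symmetric]
      by (rule partial_cong[OF S]) (simp add: partial_nth d(2))
  qed
  show ?thesis unfolding vec_eq_iff[where 'b='m] * using c by blast
qed

lemma partial_commute_vec:
  fixes f :: "real^'n::finite \<Rightarrow> real^'m::finite"
  assumes "open S" "x \<in> S" "Ck_on 2 f S"
  shows "partial i (partial j f) x = partial j (partial i f) x"
  by (rule partial_commute_componentwise[OF assms partial_commute_real[OF assms(1,2) Ck_on_nth[OF assms(1,3)]]])

lemma partial_commute_matrix:
  fixes f :: "real^'n::finite \<Rightarrow> real^'m::finite^'k::finite"
  assumes "open S" "x \<in> S" "Ck_on 2 f S"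
  shows "partial i (partial j f) x = partial j (partial i f) x"
  by (rule partial_commute_componentwise[OF assms partial_commute_vec[OF assms(1,2) Ck_on_nth[OF assms(1,3)]]])

section \<open>Riemannian geometry in one chart\<close>

lemma bounded_bilinear_matrix_mult:
  "bounded_bilinear ((**) :: real^'n::finite^'m::finite \<Rightarrow> real^'p::finite^'n \<Rightarrow> real^'p^'m)"
proof -
  have "bilinear ((**) :: real^'n::finite^'m::finite \<Rightarrow> real^'p::finite^'n \<Rightarrow> real^'p^'m)"
    by (auto simp: bilinear_def intro!: linearI
        simp: matrix_matrix_mult_def vec_eq_iff sum.distrib sum_distrib_left algebra_simps)
  then show ?thesis by (simp add: bilinear_conv_bounded_bilinear)
qed

interpretation matrix_mult: bounded_bilinear "(**) :: real^'n::finite^'m::finite \<Rightarrow> real^'p::finite^'n \<Rightarrow> real^'p^'m"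
  by (rule bounded_bilinear_matrix_mult)

lemmas matrix_ring = matrix_mult.add_left matrix_mult.add_right matrix_mult.diff_left
  matrix_mult.diff_right matrix_mult.minus_left matrix_mult.minus_right matrix_mul_assoc

lemma bounded_bilinear_matrix_vector_mult:
  "bounded_bilinear ((*v) :: real^'n::finite^'m::finite \<Rightarrow> real^'n \<Rightarrow> real^'m)"
proof -
  have "bilinear ((*v) :: real^'n::finite^'m::finite \<Rightarrow> real^'n \<Rightarrow> real^'m)"
    by (auto simp: bilinear_def intro!: linearI
        simp: matrix_vector_mult_def vec_eq_iff sum.distrib sum_distrib_left algebra_simps)
  then show ?thesis by (simp add: bilinear_conv_bounded_bilinear)
qed

lemma bounded_linear_transpose: "bounded_linear (transpose :: real^'n::finite^'m::finite \<Rightarrow> real^'m^'n)"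
  by (intro linear_conv_bounded_linear[THEN iffD1] linearI) (auto simp: transpose_def vec_eq_iff)

lemma bounded_linear_trace: "bounded_linear (trace :: real^'n::finite^'n \<Rightarrow> real)"
  by (intro linear_conv_bounded_linear[THEN iffD1] linearI)
    (auto simp: trace_def sum.distrib sum_distrib_left)

lemmas differentiable_matrix_mult = differentiable_bounded_bilinear[OF bounded_bilinear_matrix_mult]
lemmas partial_matrix_mult = partial_bounded_bilinear[OF bounded_bilinear_matrix_mult]
lemmas Ck_on_matrix_mult = Ck_on_bounded_bilinear[OF bounded_bilinear_matrix_mult]
lemmas Ck_on_matrix_vector_mult = Ck_on_bounded_bilinear[OF bounded_bilinear_matrix_vector_mult]
lemmas partial_matrix_vector_mult = partial_bounded_bilinear[OF bounded_bilinear_matrix_vector_mult]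
lemmas partial_mult = partial_bounded_bilinear[OF bounded_bilinear_mult]
lemmas partial_scaleR = partial_bounded_bilinear[OF bounded_bilinear_scaleR]
lemmas partial_uminus = partial_bounded_linear[OF bounded_linear_minus[OF bounded_linear_ident]]

lemma transpose_add: "transpose (A + B) = transpose A + transpose (B :: real^'n::finite^'m::finite)"
  and transpose_diff: "transpose (A - B) = transpose A - transpose B"
  by (simp_all add: transpose_def vec_eq_iff)

lemma differentiable_bounded_linear:
  assumes "bounded_linear L" "f differentiable (at x)"
  shows "(\<lambda>y. L (f y)) differentiable (at x)"
proof -
  obtain D where "(f has_derivative D) (at x)" using assms(2) by (auto simp: differentiable_def)
  from bounded_linear.has_derivative[OF assms(1) this] show ?thesis by (auto simp: differentiable_def)
qed

lemma partial_diff: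
  fixes f g :: "real^'n::finite \<Rightarrow> 'b::real_normed_vector"
  assumes "f differentiable (at x)" "g differentiable (at x)"
  shows "partial i (\<lambda>y. f y - g y) x = partial i f x - partial i g x"
proof -
  have "(\<lambda>y. - g y) differentiable (at x)" using assms by simp
  from partial_add[OF assms(1) this] show ?thesis by (simp add: partial_uminus[OF assms(2)])
qed

lemma partial_prod:
  fixes f :: "'a \<Rightarrow> real^'n::finite \<Rightarrow> real"
  assumes "finite I" "\<And>a. a \<in> I \<Longrightarrow> f a differentiable (at x)"
  shows "partial i (\<lambda>y. \<Prod>a\<in>I. f a y) x = (\<Sum>a\<in>I. partial i (f a) x * (\<Prod>b\<in>I - {a}. f b x))"
proof -
  have "(f a has_derivative frechet_derivative (f a) (at x)) (at x)" if "a \<in> I" for a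
    using assms(2)[OF that] frechet_derivative_works by blast
  from partial_eq[OF has_derivative_prod[OF this]] show ?thesis by (simp add: partial_def)
qed

lemma Ck_on_prod:
  fixes f :: "'a \<Rightarrow> real^'n::finite \<Rightarrow> real"
  assumes "open S" "\<And>a. a \<in> I \<Longrightarrow> Ck_on k (f a) S"
  shows "Ck_on k (\<lambda>x. \<Prod>a\<in>I. f a x) S"
  using assms(2) by (induction I rule: infinite_finite_induct) (auto intro: Ck_on_mult[OF assms(1)])

lemma Ck_on_det:
  fixes M :: "real^'n::finite \<Rightarrow> real^'m::finite^'m"
  assumes "open S" "\<And>a b. Ck_on k (\<lambda>x. M x $ a $ b) S"
  shows "Ck_on k (\<lambda>x. det (M x)) S"
  unfolding det_def
  by (intro Ck_on_sum Ck_on_mult Ck_on_prod Ck_on_const assms)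

text \<open>In the Leibniz expansion only the identity permutation survives: any other one moves at
  least two indices, so after differentiating one factor an off-diagonal entry of the identity
  matrix remains.\<close>

lemma partial_det_mat1:
  fixes M :: "real^'n::finite \<Rightarrow> real^'m::finite^'m"
  assumes "M x = mat 1" "M differentiable (at x)"
  shows "partial i (\<lambda>y. det (M y)) x = trace (partial i M x)"
proof -
  let ?U = "UNIV :: 'm set"
  have d: "(\<lambda>y. M y $ a $ b) differentiable (at x)" for a b
    by (rule differentiable_bounded_linear[OF bounded_linear_vec_nth2 assms(2)])
  have dp: "(\<lambda>y. \<Prod>a\<in>?U. M y $ a $ p a) differentiable (at x)" for p
  proof -
    have "((\<lambda>y. M y $ a $ p a) has_derivative frechet_derivative (\<lambda>y. M y $ a $ p a) (at x)) (at x)" for a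
      using d frechet_derivative_works by blast
    from has_derivative_prod[of UNIV "\<lambda>a y. M y $ a $ p a", OF this] show ?thesis
      by (rule differentiableI)
  qed
  have "partial i (\<lambda>y. \<Sum>p | p permutes ?U. of_int (sign p) * (\<Prod>a\<in>?U. M y $ a $ p a)) x
    = (\<Sum>p | p permutes ?U. of_int (sign p) * partial i (\<lambda>y. \<Prod>a\<in>?U. M y $ a $ p a) x)"
    by (subst partial_sum)
      (auto simp: partial_mult[OF differentiable_const dp] intro!: differentiable_mult dp differentiable_const)
  also have "\<dots> = (\<Sum>p | p permutes ?U. if p = id then trace (partial i M x) else 0)"
  proof (rule sum.cong[OF refl])
    fix p :: "'m \<Rightarrow> 'm" assume "p \<in> {p. p permutes ?U}"
    then have p: "p permutes ?U" by simp
    have e: "partial i (\<lambda>y. \<Prod>a\<in>?U. M y $ a $ p a) x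
      = (\<Sum>a\<in>?U. partial i M x $ a $ p a * (\<Prod>b\<in>?U - {a}. if b = p b then 1 else 0))"
      by (subst partial_prod) (auto simp: d partial_nth2[OF assms(2)] assms(1) mat_def)
    show "of_int (sign p) * partial i (\<lambda>y. \<Prod>a\<in>?U. M y $ a $ p a) x
      = (if p = id then trace (partial i M x) else 0)"
    proof (cases "p = id")
      case True
      then show ?thesis using e by (simp add: trace_def sign_id)
    next
      case False
      have z: "(\<Prod>b\<in>?U - {a}. if b = p b then 1 else 0 :: real) = 0" for a
      proof -
        obtain c where c: "p c \<noteq> c" using False by (auto simp: fun_eq_iff)
        \<comment> \<open>With \<open>c\<close> its image \<open>p c\<close> is moved too, so
          deleting the single index \<open>a\<close> still leaves a moved index.\<close>
        have "p (p c) \<noteq> p c" using c permutes_inj[OF p] by (auto dest: injD)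
        then obtain b where b: "b \<in> ?U - {a}" "p b \<noteq> b" using c by (metis Diff_iff UNIV_I singletonD)
        then have "b \<noteq> p b" by simp
        then show ?thesis by (intro prod_zero bexI[OF _ b(1)]) simp_all
      qed
      show ?thesis unfolding e z using False by simp
    qed
  qed
  also have "\<dots> = trace (partial i M x)" by (simp add: permutes_id finite_permutations)
  finally show ?thesis by (simp add: det_def)
qed

text \<open>Packs the Christoffel symbols for a fixed direction \<open>i\<close> into a matrix, so
  that the covariant derivative of Y along the \<open>i\<close>-th coordinate is
  \<open>partial i Y x + connection h i x *v Y x\<close> and index sums become matrix
  products.\<close>

definition connection :: "(real^'n::finite \<Rightarrow> real^'n^'n) \<Rightarrow> 'n \<Rightarrow> real^'n \<Rightarrow> real^'n^'n" where
  "connection h i x = (\<chi> k j. christoffel h k i j x)"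

definition curvature :: "(real^'n::finite \<Rightarrow> real^'n^'n) \<Rightarrow> 'n \<Rightarrow> 'n \<Rightarrow> real^'n \<Rightarrow> real^'n^'n" where
  "curvature h i j x = (\<chi> l k. riemann h l i j k x)"

definition divergence :: "(real^'n::finite \<Rightarrow> real^'n^'n) \<Rightarrow> (real^'n \<Rightarrow> real^'n) \<Rightarrow> real^'n \<Rightarrow> real" where
  "divergence h Y x = trace (covariant_derivative h Y x)"

text \<open>In the second Bianchi identity, \<open>D\<close> and \<open>DD\<close> stand for the first and second partial derivatives
  of the connection matrices.\<close>

lemma bianchi_algebra:
  fixes D :: "'i \<Rightarrow> 'i \<Rightarrow> real^'n::finite^'n" and \<Gamma> :: "'i \<Rightarrow> real^'n^'n"
  assumes "\<And>m i j. DD m i j = DD i m j"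
  shows "(DD m i j - DD m j i + (D m i ** \<Gamma> j + \<Gamma> i ** D m j) - (D m j ** \<Gamma> i + \<Gamma> j ** D m i))
     + \<Gamma> m ** (D i j - D j i + \<Gamma> i ** \<Gamma> j - \<Gamma> j ** \<Gamma> i) - (D i j - D j i + \<Gamma> i ** \<Gamma> j - \<Gamma> j ** \<Gamma> i) ** \<Gamma> m
    + ((DD i j m - DD i m j + (D i j ** \<Gamma> m + \<Gamma> j ** D i m) - (D i m ** \<Gamma> j + \<Gamma> m ** D i j))
     + \<Gamma> i ** (D j m - D m j + \<Gamma> j ** \<Gamma> m - \<Gamma> m ** \<Gamma> j) - (D j m - D m j + \<Gamma> j ** \<Gamma> m - \<Gamma> m ** \<Gamma> j) ** \<Gamma> i)
    + ((DD j m i - DD j i m + (D j m ** \<Gamma> i + \<Gamma> m ** D j i) - (D j i ** \<Gamma> m + \<Gamma> i ** D j m))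
     + \<Gamma> j ** (D m i - D i m + \<Gamma> m ** \<Gamma> i - \<Gamma> i ** \<Gamma> m) - (D m i - D i m + \<Gamma> m ** \<Gamma> i - \<Gamma> i ** \<Gamma> m) ** \<Gamma> j) = 0"
  unfolding assms[of m i j] assms[of i j m] assms[of j m i] matrix_ring by simp

text \<open>A metric on an open coordinate patch. All pointwise identities are proved here and are
  later used both on whole chart images and on overlaps.\<close>

locale local_metric =
  fixes S :: "(real^'n::finite) set" and h :: "real^'n \<Rightarrow> real^'n^'n"
  assumes open_S: "open S" and smooth: "\<And>k. Ck_on k h S"
    and symmetric: "x \<in> S \<Longrightarrow> transpose (h x) = h x"
    and positive: "x \<in> S \<Longrightarrow> v \<noteq> 0 \<Longrightarrow> v \<bullet> (h x *v v) > 0"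
begin

abbreviation G where "G x \<equiv> matrix_inv (h x)"
abbreviation \<Gamma> where "\<Gamma> \<equiv> connection h"
abbreviation F where "F \<equiv> curvature h"

lemma invertible: assumes "x \<in> S" shows "invertible (h x)"
proof -
  have "v = 0" if "h x *v v = 0" for v
    using positive[OF assms, of v] that by force
  then show ?thesis by (simp add: invertible_left_inverse matrix_left_invertible_ker)
qed

lemma h_G [simp]: "x \<in> S \<Longrightarrow> h x ** G x = mat 1" and G_h [simp]: "x \<in> S \<Longrightarrow> G x ** h x = mat 1"
  using invertible[of x] someI_ex[of "\<lambda>B. h x ** B = mat 1 \<and> B ** h x = mat 1"]
  unfolding invertible_def matrix_inv_def by blast+

lemma G_symmetric: assumes "x \<in> S" shows "transpose (G x) = G x"
proof -
  have "h x ** transpose (G x) = mat 1"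
    using arg_cong[OF G_h[OF assms], of transpose] by (simp add: matrix_transpose_mul symmetric[OF assms])
  then have "G x ** (h x ** transpose (G x)) = G x" by simp
  then show ?thesis by (simp add: matrix_mul_assoc assms)
qed

lemma det_nonzero: "x \<in> S \<Longrightarrow> det (h x) \<noteq> 0"
  using invertible by (simp add: invertible_det_nz)

lemma differentiable_h [intro]: "x \<in> S \<Longrightarrow> h differentiable (at x)"
  using Ck_on_differentiable[OF smooth] .

text \<open>By Cramer's rule each entry of the inverse is a determinant in the entries of
  \<open>h\<close>, divided by the nonvanishing \<open>det (h x)\<close>.\<close>

lemma Ck_G: "Ck_on k G S"
proof (intro Ck_on_vec open_S)
  fix a b
  let ?N = "\<lambda>x. (\<chi> i j. if j = a then axis b 1 $ i else h x $ i $ j) :: real^'n^'n"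
  have "G x $ a $ b = det (?N x) * inverse (det (h x))" if "x \<in> S" for x
  proof -
    have "h x *v (G x *v axis b 1) = axis b 1"
      using that by (simp add: matrix_vector_mul_assoc)
    then have "G x *v axis b 1 = (\<chi> k. det (\<chi> i j. if j = k then axis b 1 $ i else h x $ i $ j) / det (h x))"
      using cramer[OF det_nonzero[OF that]] by blast
    from arg_cong[OF this, of "\<lambda>v. v $ a"] show ?thesis
      by (simp add: matrix_vector_mult_basis column_def divide_inverse)
  qed
  moreover have "Ck_on k (\<lambda>x. det (?N x) * inverse (det (h x))) S"
  proof (intro Ck_on_mult Ck_on_inverse Ck_on_det open_S det_nonzero)
    show "Ck_on k (\<lambda>x. h x $ a $ b) S" for a b by (intro Ck_on_nth open_S smooth)
    then show "Ck_on k (\<lambda>x. ?N x $ a' $ b') S" for a' b' by (cases "b' = a") auto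
  qed
  ultimately show "Ck_on k (\<lambda>x. G x $ a $ b) S" using Ck_on_cong[OF open_S] by (metis (no_types, lifting))
qed

lemma partial_h_symmetric: assumes "x \<in> S" shows "transpose (partial i h x) = partial i h x"
  unfolding partial_bounded_linear[OF bounded_linear_transpose differentiable_h[OF assms], symmetric]
  by (rule partial_cong[OF open_S assms symmetric])

lemma partial_h_swap: "x \<in> S \<Longrightarrow> partial i h x $ a $ b = partial i h x $ b $ a"
  using arg_cong[OF partial_h_symmetric, of x "\<lambda>M. M $ a $ b" i] by (simp add: transpose_def)

text \<open>These are the Christoffel symbols of the first kind: multiplication by \<open>h\<close>
  cancels the inverse metric in \<open>christoffel\<close>.\<close>

lemma connection_lower:
  assumes "x \<in> S"
  shows "(h x ** \<Gamma> i x) $ l $ j = (partial i h x $ j $ l + partial j h x $ i $ l - partial l h x $ i $ j) / 2"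
proof -
  let ?T = "(\<chi> l j. (partial i h x $ j $ l + partial j h x $ i $ l - partial l h x $ i $ j) / 2) :: real^'n^'n"
  have "\<Gamma> i x = G x ** ?T"
    by (simp add: connection_def christoffel_def vec_eq_iff matrix_matrix_mult_def sum_divide_distrib
        partial_nth2[OF differentiable_h[OF assms]])
  then have "h x ** \<Gamma> i x = ?T" by (simp add: matrix_mul_assoc assms)
  then show ?thesis by simp
qed

text \<open>Metric compatibility of the connection. When the lowered symbols are added to their
  transpose, two of the three derivatives of the metric cancel.\<close>

lemma compatible:
  assumes "x \<in> S"
  shows "partial i h x = h x ** \<Gamma> i x + transpose (\<Gamma> i x) ** h x"
proof -
  have "transpose (\<Gamma> i x) ** h x = transpose (h x ** \<Gamma> i x)"
    by (simp add: matrix_transpose_mul symmetric assms)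
  moreover have "partial i h x $ a $ b = (h x ** \<Gamma> i x) $ a $ b + (h x ** \<Gamma> i x) $ b $ a" for a b
    unfolding connection_lower[OF assms] using partial_h_swap[OF assms, of i a b] by (simp add: field_simps)
  ultimately show ?thesis by (simp add: vec_eq_iff transpose_def)
qed

lemma torsion_free: assumes "x \<in> S" shows "\<Gamma> i x $ k $ j = \<Gamma> j x $ k $ i"
  unfolding connection_def christoffel_def
  by (simp add: partial_nth2[OF differentiable_h[OF assms]] partial_h_swap[OF assms, of _ i j] algebra_simps)

text \<open>The lowered difference \<open>C\<close> of two such connections is skew in its last two
  indices and symmetric in the first and the last. Alternating the two rules leads around the
  indices back to minus the start.\<close>

lemma connection_unique:
  assumes x: "x \<in> S" and c: "\<And>i. partial i h x = h x ** B i + transpose (B i) ** h x"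
    and t: "\<And>i k j. B i $ k $ j = B j $ k $ i"
  shows "B i = \<Gamma> i x"
proof -
  define C where "C i a b = (h x ** (B i - \<Gamma> i x)) $ a $ b" for i a b
  have anti: "C i a b = - C i b a" for i a b
  proof -
    have "h x ** B i + transpose (h x ** B i) = h x ** \<Gamma> i x + transpose (h x ** \<Gamma> i x)"
      using c[of i] compatible[OF x, of i] by (simp add: matrix_transpose_mul symmetric x)
    then have "h x ** (B i - \<Gamma> i x) = - transpose (h x ** (B i - \<Gamma> i x))"
      by (simp add: matrix_ring transpose_diff algebra_simps)
    from arg_cong[OF this, of "\<lambda>M. M $ a $ b"] show ?thesis unfolding C_def by (simp add: transpose_def)
  qed
  have sym: "C i a b = C b a i" for i a b
    unfolding C_def by (simp add: matrix_matrix_mult_def t[of i _ b] torsion_free[OF x, of i _ b])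
  have "C i a b = 0" for a b
  proof -
    have "C i a b = C b a i" by (rule sym)
    also have "\<dots> = - C b i a" by (rule anti)
    also have "\<dots> = - C a i b" by (simp add: sym[of b i a])
    also have "\<dots> = C a b i" by (simp add: anti[of a i b])
    also have "\<dots> = C i b a" by (rule sym)
    also have "\<dots> = - C i a b" by (rule anti)
    finally show ?thesis by simp
  qed
  then have "h x ** (B i - \<Gamma> i x) = 0" by (simp add: vec_eq_iff C_def)
  then have "G x ** (h x ** (B i - \<Gamma> i x)) = 0" by (simp add: matrix_mult.zero_right)
  then show ?thesis by (simp add: matrix_mul_assoc x)
qed

lemma Ck_christoffel: "Ck_on k (christoffel h a i j) S"
proof -
  have "Ck_on k (partial i (\<lambda>y. h y $ a $ b)) S" for i a b
    by (intro Ck_on_partial Ck_on_nth open_S smooth)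
  then have "Ck_on k (\<lambda>x. (\<Sum>l\<in>UNIV. G x $ a $ l *
     (partial i (\<lambda>y. h y $ j $ l) x + partial j (\<lambda>y. h y $ i $ l) x
        - partial l (\<lambda>y. h y $ i $ j) x)) * (1 / 2)) S"
    by (intro Ck_on_sum Ck_on_mult Ck_on_add Ck_on_diff Ck_on_nth Ck_G open_S Ck_on_const)
  then show ?thesis unfolding christoffel_def by simp
qed

lemma Ck_connection: "Ck_on k (\<Gamma> i) S"
  unfolding connection_def by (intro Ck_on_vec open_S) (simp add: Ck_christoffel)

lemma differentiable_connection [intro]: "x \<in> S \<Longrightarrow> \<Gamma> i differentiable (at x)"
  using Ck_on_differentiable[OF Ck_connection] .

text \<open>The structure equation. From here on curvature is a commutator expression in the
  matrices \<Gamma>, and its identities are computations in a noncommutative ring plus commuting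
  partial derivatives.\<close>

lemma curvature_eq:
  assumes "x \<in> S"
  shows "F i j x = partial i (\<Gamma> j) x - partial j (\<Gamma> i) x + \<Gamma> i x ** \<Gamma> j x - \<Gamma> j x ** \<Gamma> i x"
proof -
  have "partial i (christoffel h l j k) x = partial i (\<Gamma> j) x $ l $ k" for i j k l
    using partial_nth2[OF differentiable_connection[OF assms], of i j l k] by (simp add: connection_def)
  then show ?thesis
    by (simp add: curvature_def riemann_def vec_eq_iff matrix_matrix_mult_def connection_def sum_subtractf)
qed

lemma Ck_curvature: "Ck_on k (F i j) S"
proof -
  have "Ck_on k (\<lambda>x. partial i (\<Gamma> j) x - partial j (\<Gamma> i) x + \<Gamma> i x ** \<Gamma> j x - \<Gamma> j x ** \<Gamma> i x) S"
    by (intro Ck_on_diff Ck_on_add Ck_on_matrix_mult Ck_connection open_S Ck_on_partial)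
  then show ?thesis using Ck_on_cong[OF open_S, of "F i j"] curvature_eq by simp
qed

lemma curvature_antisymmetric: "x \<in> S \<Longrightarrow> F j i x = - F i j x"
  by (simp add: curvature_eq)

lemma partial_commute_h: "x \<in> S \<Longrightarrow> partial i (partial j h) x = partial j (partial i h) x"
  by (rule partial_commute_matrix[OF open_S _ smooth])

text \<open>Differentiating \<open>compatible\<close> once more shows that
  \<open>h x ** F i j x\<close> plus its transpose is the commutator of two partial derivatives of
  the metric, hence zero.\<close>

lemma lower_curvature_skew:
  assumes x: "x \<in> S"
  shows "transpose (h x ** F i j x) = - (h x ** F i j x)"
proof -
  have dd: "partial i (partial j h) x = partial i h x ** \<Gamma> j x + h x ** partial i (\<Gamma> j) x
     + transpose (\<Gamma> j x) ** partial i h x + transpose (partial i (\<Gamma> j) x) ** h x" for i j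
  proof -
    have t: "(\<lambda>y. transpose (\<Gamma> j y)) differentiable (at x)"
      using Ck_on_differentiable[OF Ck_on_bounded_linear[OF bounded_linear_transpose open_S Ck_connection] x] .
    have "partial i (partial j h) x = partial i (\<lambda>y. h y ** \<Gamma> j y + transpose (\<Gamma> j y) ** h y) x"
      by (rule partial_cong[OF open_S x compatible])
    also have "\<dots> = partial i (\<lambda>y. h y ** \<Gamma> j y) x + partial i (\<lambda>y. transpose (\<Gamma> j y) ** h y) x"
      by (intro partial_add differentiable_matrix_mult t) (use x in auto)
    finally show ?thesis
      using x by (simp add: partial_matrix_mult t differentiable_h differentiable_connection
          partial_bounded_linear[OF bounded_linear_transpose])
  qed
  have eq: "partial i (partial j h) x = partial j (partial i h) x" by (rule partial_commute_h[OF x])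
  have "transpose (h x ** F i j x) + h x ** F i j x = partial i (partial j h) x - partial j (partial i h) x"
    unfolding dd unfolding compatible[OF x] curvature_eq[OF x]
    by (simp add: matrix_ring matrix_transpose_mul transpose_add transpose_diff symmetric[OF x])
  then show ?thesis unfolding eq by (simp add: eq_neg_iff_add_eq_0)
qed

text \<open>The curvature with the last index raised. Being skew in its two upper indices, it can be traced
  in the Bianchi identity without lowering any index.\<close>

definition K :: "'n \<Rightarrow> 'n \<Rightarrow> real^'n \<Rightarrow> real^'n^'n" where "K i j x = F i j x ** G x"

lemma K_antisymmetric: "x \<in> S \<Longrightarrow> K j i x = - K i j x"
  by (simp add: K_def curvature_antisymmetric[of x i j] matrix_ring)

lemma K_skew: assumes x: "x \<in> S" shows "K i j x $ a $ b = - K i j x $ b $ a"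
proof -
  have "K i j x = G x ** (h x ** F i j x) ** G x" by (simp add: K_def matrix_mul_assoc x)
  then have "transpose (K i j x) = G x ** transpose (h x ** F i j x) ** G x"
    by (simp add: matrix_transpose_mul G_symmetric[OF x] matrix_mul_assoc)
  then have "transpose (K i j x) = - K i j x"
    unfolding lower_curvature_skew[OF x] by (simp add: K_def matrix_ring x)
  from arg_cong[OF this, of "\<lambda>M. M $ b $ a"] show ?thesis by (simp add: transpose_def)
qed

lemma Ck_K: "Ck_on k (K i j) S"
  unfolding K_def by (intro Ck_on_matrix_mult open_S Ck_curvature Ck_G)

text \<open>Differentiate \<open>h y ** G y = mat 1\<close> and insert \<open>compatible\<close>;
  the result says that the inverse metric is parallel.\<close>

lemma partial_G:
  assumes x: "x \<in> S"
  shows "partial m G x = - (\<Gamma> m x ** G x) - G x ** transpose (\<Gamma> m x)"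
proof -
  have d: "G differentiable (at x)" using Ck_on_differentiable[OF Ck_G x] .
  have "partial m (\<lambda>y. h y ** G y) x = partial m (\<lambda>y. mat 1) x"
    by (rule partial_cong[OF open_S x]) simp
  then have "h x ** partial m G x + partial m h x ** G x = 0"
    using partial_matrix_mult[OF differentiable_h[OF x] d] by simp
  then have "G x ** (h x ** partial m G x + partial m h x ** G x) = 0" by (simp add: matrix_mult.zero_right)
  moreover have "G x ** (h x ** partial m G x) = partial m G x"
    "G x ** ((h x ** \<Gamma> m x) ** G x) = \<Gamma> m x ** G x"
    by (simp_all add: matrix_mul_assoc x)
  moreover have "G x ** ((transpose (\<Gamma> m x) ** h x) ** G x) = G x ** transpose (\<Gamma> m x)"
    by (simp add: matrix_mul_assoc[symmetric] x)
  ultimately have "partial m G x + (\<Gamma> m x ** G x + G x ** transpose (\<Gamma> m x)) = 0"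
    unfolding compatible[OF x] matrix_mult.add_left matrix_mult.add_right by simp
  then show ?thesis by (simp add: eq_neg_iff_add_eq_0 algebra_simps)
qed

text \<open>Both the derivative terms and the product terms of the curvature are symmetric in the
  inner direction and the last index, by \<open>torsion_free\<close>, so the cyclic sum cancels in
  pairs.\<close>

lemma bianchi_first:
  assumes x: "x \<in> S"
  shows "F i j x $ l $ k + F j k x $ l $ i + F k i x $ l $ j = 0"
proof -
  have d: "partial i (\<Gamma> j) x $ l $ k = partial i (\<Gamma> k) x $ l $ j" for i j k l
    unfolding partial_nth2[OF differentiable_connection[OF x], symmetric]
    by (rule partial_cong[OF open_S x torsion_free])
  have m: "(\<Gamma> i x ** \<Gamma> j x) $ l $ k = (\<Gamma> i x ** \<Gamma> k x) $ l $ j" for i j k l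
    by (simp add: matrix_matrix_mult_def torsion_free[OF x, of j _ k])
  show ?thesis unfolding curvature_eq[OF x]
    using d[of i j l k] d[of j k l i] d[of k i l j] m[of i j l k] m[of j k l i] m[of k i l j] by simp
qed

lemma partial_curvature:
  assumes x: "x \<in> S"
  shows "partial m (F i j) x = partial m (partial i (\<Gamma> j)) x - partial m (partial j (\<Gamma> i)) x
    + (partial m (\<Gamma> i) x ** \<Gamma> j x + \<Gamma> i x ** partial m (\<Gamma> j) x)
    - (partial m (\<Gamma> j) x ** \<Gamma> i x + \<Gamma> j x ** partial m (\<Gamma> i) x)"
proof -
  have d: "partial i (\<Gamma> j) differentiable (at x)" for i j
    by (rule Ck_on_differentiable[OF Ck_on_partial[OF Ck_connection] x])
  note e = differentiable_connection[OF x]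
  note p = differentiable_matrix_mult[OF e e]
  have "partial m (F i j) x = partial m (\<lambda>y. (partial i (\<Gamma> j) y - partial j (\<Gamma> i) y + \<Gamma> i y ** \<Gamma> j y) - \<Gamma> j y ** \<Gamma> i y) x"
    by (rule partial_cong[OF open_S x curvature_eq])
  then show ?thesis
    by (simp add: partial_diff partial_add differentiable_diff differentiable_add d p partial_matrix_mult[OF e e])
qed

text \<open>The exterior form: the connection acts on the matrix indices only, since the corrections
  for the directions \<open>m\<close>, \<open>i\<close>, \<open>j\<close> would cancel in the cyclic
  sum. The analytic input is that second derivatives of \<Gamma> commute.\<close>

lemma bianchi_second:
  assumes x: "x \<in> S"
  shows "(partial m (F i j) x + \<Gamma> m x ** F i j x - F i j x ** \<Gamma> m x)
    + (partial i (F j m) x + \<Gamma> i x ** F j m x - F j m x ** \<Gamma> i x)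
    + (partial j (F m i) x + \<Gamma> j x ** F m i x - F m i x ** \<Gamma> j x) = 0"
  unfolding partial_curvature[OF x] curvature_eq[OF x]
  by (rule bianchi_algebra[where DD = "\<lambda>m i j. partial m (partial i (\<Gamma> j)) x"])
    (rule partial_commute_matrix[OF open_S x Ck_connection])

text \<open>As the inverse metric is parallel, multiplying by it commutes with covariant
  differentiation. The raised column index changes its correction from
  \<open>- F i j x ** \<Gamma> m x\<close> to a product with the transpose.\<close>

lemma bianchi_K:
  assumes x: "x \<in> S"
  shows "(partial m (K i j) x + \<Gamma> m x ** K i j x + K i j x ** transpose (\<Gamma> m x))
    + (partial i (K j m) x + \<Gamma> i x ** K j m x + K j m x ** transpose (\<Gamma> i x))
    + (partial j (K m i) x + \<Gamma> j x ** K m i x + K m i x ** transpose (\<Gamma> j x)) = 0"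
proof -
  have "partial m (K i j) x + \<Gamma> m x ** K i j x + K i j x ** transpose (\<Gamma> m x)
    = (partial m (F i j) x + \<Gamma> m x ** F i j x - F i j x ** \<Gamma> m x) ** G x" for m i j
  proof -
    have "partial m (K i j) x = F i j x ** partial m G x + partial m (F i j) x ** G x"
      unfolding K_def
      by (intro partial_matrix_mult Ck_on_differentiable[OF Ck_curvature x] Ck_on_differentiable[OF Ck_G x])
    then show ?thesis by (simp add: partial_G[OF x] K_def matrix_ring)
  qed
  then show ?thesis
    using arg_cong[OF bianchi_second[OF x, of m i j], of "\<lambda>M. M ** G x"]
    by (simp add: matrix_mult.add_left matrix_mult.zero_left)
qed

end

section \<open>Ricci curvature and its divergence\<close>

lemma trace_transpose: "trace (transpose A) = trace A"
  by (simp add: trace_def transpose_def)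

lemma trace_symmetric_mult_skew:
  fixes A B :: "real^'n::finite^'n"
  assumes "transpose A = A" "transpose B = - B"
  shows "trace (A ** B) = 0"
proof -
  have "trace (A ** B) = trace (transpose B ** transpose A)"
    by (metis matrix_transpose_mul trace_transpose)
  also have "\<dots> = - trace (B ** A)"
    by (simp add: assms matrix_ring trace_def sum_negf)
  finally show ?thesis by (simp add: trace_mul_sym[of A B])
qed

lemma covariant_derivative_cong:
  assumes "open S" "x \<in> S" "\<And>y. y \<in> S \<Longrightarrow> V y = W y"
  shows "covariant_derivative h V x = covariant_derivative h W x"
proof -
  have "partial j (\<lambda>y. V y $ i) x = partial j (\<lambda>y. W y $ i) x" for i j
    by (rule partial_cong[OF assms(1,2)]) (simp add: assms(3))
  then show ?thesis using assms(2,3) by (simp add: covariant_derivative_def)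
qed

context local_metric
begin

text \<open>The Ricci endomorphism. With one index raised its trace is the scalar curvature and it
  can be applied to vector fields.\<close>

definition ricci_op :: "real^'n \<Rightarrow> real^'n^'n" where "ricci_op x = G x ** ricci h x"

lemma ricci_nth: "ricci h x $ j $ k = (\<Sum>i\<in>UNIV. F i j x $ i $ k)"
  by (simp add: ricci_def curvature_def)

lemma Ck_ricci: "Ck_on k (ricci h) S"
proof -
  have "Ck_on k (\<lambda>x. \<Sum>i\<in>UNIV. F i a x $ i $ b) S" for a b
    by (intro Ck_on_sum Ck_on_nth Ck_curvature open_S)
  then show ?thesis by (intro Ck_on_vec open_S) (simp add: ricci_nth)
qed

lemma Ck_ricci_op: "Ck_on k ricci_op S"
  unfolding ricci_op_def by (intro Ck_on_matrix_mult open_S Ck_ricci Ck_G)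

text \<open>\<open>F i j x\<close> is the symmetric \<open>G x\<close> times the skew
  \<open>h x ** F i j x\<close>.\<close>

lemma trace_curvature: assumes x: "x \<in> S" shows "trace (F i j x) = 0"
proof -
  have "F i j x = G x ** (h x ** F i j x)" by (simp add: matrix_mul_assoc x)
  then show ?thesis
    using trace_symmetric_mult_skew[OF G_symmetric[OF x] lower_curvature_skew[OF x]] by metis
qed

text \<open>Tracing the first Bianchi identity gives the difference of the two entries plus a trace
  of the curvature, which vanishes.\<close>

lemma ricci_symmetric: assumes x: "x \<in> S" shows "ricci h x $ j $ k = ricci h x $ k $ j"
proof -
  have "(\<Sum>i\<in>UNIV. F i j x $ i $ k + F j k x $ i $ i + F k i x $ i $ j) = 0"
    using bianchi_first[OF x] by simp
  moreover have "F k i x $ i $ j = - F i k x $ i $ j" for i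
    by (simp add: curvature_antisymmetric[OF x, of i k])
  ultimately show ?thesis
    using trace_curvature[OF x, of j k] by (simp add: ricci_nth sum.distrib sum_subtractf sum_negf trace_def)
qed

lemma ricci_G_nth: "(ricci h x ** G x) $ m $ l = (\<Sum>i\<in>UNIV. K i m x $ i $ l)"
  unfolding K_def matrix_matrix_mult_def
  by (simp add: ricci_nth sum_distrib_right) (rule sum.swap)

text \<open>\<open>ricci_op\<close> has the inverse metric on the left, \<open>K\<close> has it on
  the right; symmetry of both factors exchanges the sides through a transpose.\<close>

lemma ricci_op_nth: assumes x: "x \<in> S" shows "ricci_op x $ l $ m = (\<Sum>i\<in>UNIV. K i m x $ i $ l)"
proof -
  have "transpose (ricci h x) = ricci h x"
    using ricci_symmetric[OF x] by (simp add: vec_eq_iff transpose_def)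
  then have "ricci_op x = transpose (ricci h x ** G x)"
    by (simp add: ricci_op_def matrix_transpose_mul G_symmetric[OF x])
  then show ?thesis by (simp add: transpose_def ricci_G_nth)
qed

lemma scal_eq_trace: assumes x: "x \<in> S" shows "scal h x = trace (ricci_op x)"
  by (simp add: scal_def ricci_op_def trace_def matrix_matrix_mult_def ricci_symmetric[OF x])

lemma Ck_scal: "Ck_on k (scal h) S"
  using Ck_on_cong[OF open_S, of "scal h"] scal_eq_trace
    Ck_on_bounded_linear[OF bounded_linear_trace open_S Ck_ricci_op] by simp

lemma partial_ricci_op_nth:
  assumes x: "x \<in> S"
  shows "partial p ricci_op x $ l $ m = (\<Sum>i\<in>UNIV. partial p (K i m) x $ i $ l)"
proof -
  have d: "K i j differentiable (at x)" for i j by (rule Ck_on_differentiable[OF Ck_K x])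
  have d2: "(\<lambda>y. K i j y $ a $ b) differentiable (at x)" for i j a b
    by (rule differentiable_bounded_linear[OF bounded_linear_vec_nth2 d])
  have "partial p ricci_op x $ l $ m = partial p (\<lambda>y. ricci_op y $ l $ m) x"
    by (rule partial_nth2[symmetric, OF Ck_on_differentiable[OF Ck_ricci_op x]])
  also have "\<dots> = partial p (\<lambda>y. \<Sum>i\<in>UNIV. K i m y $ i $ l) x"
    by (rule partial_cong[OF open_S x ricci_op_nth])
  also have "\<dots> = (\<Sum>i\<in>UNIV. partial p (K i m) x $ i $ l)"
    by (simp add: partial_sum d2 partial_nth2[OF d])
  finally show ?thesis .
qed

lemma partial_scal:
  assumes x: "x \<in> S"
  shows "partial m (scal h) x = (\<Sum>i\<in>UNIV. partial m ricci_op x $ i $ i)"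
proof -
  have "partial m (scal h) x = partial m (\<lambda>y. trace (ricci_op y)) x"
    by (rule partial_cong[OF open_S x scal_eq_trace])
  also have "\<dots> = trace (partial m ricci_op x)"
    by (rule partial_bounded_linear[OF bounded_linear_trace Ck_on_differentiable[OF Ck_ricci_op x]])
  finally show ?thesis by (simp add: trace_def)
qed

text \<open>In \<open>bianchi_K\<close> the direction \<open>i\<close> is traced with the row and
  \<open>j\<close> with the column. The group differentiated along \<open>m\<close> yields the
  differential of the scalar curvature, and each of the other two yields minus a divergence of the
  Ricci operator; hence the factor 2.\<close>

lemma contracted_bianchi:
  assumes x: "x \<in> S"
  shows "partial m (scal h) x
    = 2 * (\<Sum>i\<in>UNIV. (partial i ricci_op x + \<Gamma> i x ** ricci_op x - ricci_op x ** \<Gamma> i x) $ i $ m)"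
proof -
  let ?U = "UNIV :: 'n set"
  let ?P = "ricci_op x" and ?dP = "\<lambda>i. partial i ricci_op x"
  note P = ricci_op_nth[OF x] and dP = partial_ricci_op_nth[OF x]
  note anti = K_antisymmetric[OF x] and skew = K_skew[OF x] and tf = torsion_free[OF x]
  have P2: "(\<Sum>j\<in>?U. K j k x $ l $ j) = - ?P $ l $ k" for k l
    unfolding P sum_negf[symmetric] by (rule sum.cong[OF refl]) (rule skew)
  have P3: "(\<Sum>i\<in>?U. K k i x $ i $ l) = - ?P $ l $ k" for k l
    unfolding P sum_negf[symmetric] by (rule sum.cong[OF refl]) (simp add: anti[of _ k])
  have P4: "(\<Sum>j\<in>?U. K i j x $ l $ j) = ?P $ l $ i" for i l
    unfolding P by (rule sum.cong[OF refl]) (simp add: anti[of _ i] skew[of _ _ l])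
  have dK: "K i j differentiable (at x)" for i j by (rule Ck_on_differentiable[OF Ck_K x])
  have dskew: "partial p (K i j) x $ a $ b = - partial p (K i j) x $ b $ a" for p i j a b
  proof -
    have "partial p (\<lambda>y. K i j y $ a $ b) x = partial p (\<lambda>y. - K i j y $ b $ a) x"
      by (rule partial_cong[OF open_S x K_skew])
    also have "\<dots> = - partial p (\<lambda>y. K i j y $ b $ a) x"
      by (rule partial_uminus[OF differentiable_bounded_linear[OF bounded_linear_vec_nth2 dK]])
    finally show ?thesis by (simp add: partial_nth2[OF dK])
  qed
  have danti: "partial p (K j i) x = - partial p (K i j) x" for p i j
    by (subst partial_uminus[OF dK, symmetric]) (rule partial_cong[OF open_S x K_antisymmetric])
  have dP2: "(\<Sum>j\<in>?U. partial p (K j k) x $ l $ j) = - ?dP p $ l $ k" for p k l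
    unfolding dP sum_negf[symmetric] by (rule sum.cong[OF refl]) (rule dskew)
  have dP3: "(\<Sum>i\<in>?U. partial p (K k i) x $ i $ l) = - ?dP p $ l $ k" for p k l
    unfolding dP sum_negf[symmetric] by (rule sum.cong[OF refl]) (simp add: danti[of _ _ k])

  \<comment> \<open>A, B, C are the three cyclic groups of \<open>bianchi_K\<close>; 1 is the
    derivative term, 2 and 3 are the left and right connection terms.\<close>
  have A1: "(\<Sum>i\<in>?U. \<Sum>j\<in>?U. partial m (K i j) x $ i $ j) = partial m (scal h) x"
    unfolding partial_scal[OF x] dP by (rule sum.swap)
  have A2: "(\<Sum>i\<in>?U. \<Sum>j\<in>?U. (\<Gamma> m x ** K i j x) $ i $ j) = (\<Sum>i\<in>?U. \<Sum>l\<in>?U. \<Gamma> m x $ i $ l * ?P $ l $ i)"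
    unfolding matrix_matrix_mult_def P4[symmetric]
    by (simp add: sum_distrib_left) (intro sum.cong[OF refl] sum.swap)
  have A3: "(\<Sum>i\<in>?U. \<Sum>j\<in>?U. (K i j x ** transpose (\<Gamma> m x)) $ i $ j) = (\<Sum>j\<in>?U. \<Sum>l\<in>?U. \<Gamma> m x $ j $ l * ?P $ l $ j)"
    unfolding matrix_matrix_mult_def P
    by (subst sum.swap, simp add: sum_distrib_left transpose_def mult.commute)
      (intro sum.cong[OF refl] sum.swap)
  have B1: "(\<Sum>i\<in>?U. \<Sum>j\<in>?U. partial i (K j m) x $ i $ j) = - (\<Sum>i\<in>?U. ?dP i $ i $ m)"
    by (simp add: dP2 sum_negf)
  have B2: "(\<Sum>i\<in>?U. \<Sum>j\<in>?U. (\<Gamma> i x ** K j m x) $ i $ j) = - (\<Sum>i\<in>?U. \<Sum>l\<in>?U. \<Gamma> i x $ i $ l * ?P $ l $ m)"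
  proof -
    have "(\<Sum>j\<in>?U. (\<Gamma> i x ** K j m x) $ i $ j) = (\<Sum>l\<in>?U. \<Gamma> i x $ i $ l * (\<Sum>j\<in>?U. K j m x $ l $ j))" for i
      unfolding matrix_matrix_mult_def by (simp add: sum_distrib_left) (rule sum.swap)
    then show ?thesis by (simp add: P2 sum_negf)
  qed
  \<comment> \<open>Skewness of \<open>K\<close> in its upper indices meets the symmetry of \<Gamma>
    in its lower ones, so the sum equals its own negative. The same happens in
    \<open>C2\<close>.\<close>
  have B3: "(\<Sum>i\<in>?U. \<Sum>j\<in>?U. (K j m x ** transpose (\<Gamma> i x)) $ i $ j) = 0"
  proof -
    let ?f = "\<lambda>i l. \<Sum>j\<in>?U. K j m x $ i $ l * \<Gamma> i x $ j $ l"
    have "(\<Sum>i\<in>?U. \<Sum>j\<in>?U. (K j m x ** transpose (\<Gamma> i x)) $ i $ j) = (\<Sum>i\<in>?U. \<Sum>l\<in>?U. ?f i l)"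
      unfolding matrix_matrix_mult_def transpose_def by (simp, intro sum.cong[OF refl] sum.swap)
    also have "\<dots> = (\<Sum>l\<in>?U. \<Sum>i\<in>?U. ?f i l)" by (rule sum.swap)
    also have "\<dots> = (\<Sum>l\<in>?U. \<Sum>i\<in>?U. - ?f l i)"
    proof (intro sum.cong[OF refl])
      fix i l
      show "?f i l = - ?f l i"
        unfolding sum_negf[symmetric] by (rule sum.cong[OF refl]) (simp add: skew[of _ _ i l] tf[of i _ l])
    qed
    finally show ?thesis
      unfolding sum_negf by (simp add: \<open>(\<Sum>i\<in>?U. \<Sum>j\<in>?U. (K j m x ** transpose (\<Gamma> i x)) $ i $ j) = (\<Sum>i\<in>?U. \<Sum>l\<in>?U. ?f i l)\<close>)
  qed
  have C1: "(\<Sum>i\<in>?U. \<Sum>j\<in>?U. partial j (K m i) x $ i $ j) = - (\<Sum>i\<in>?U. ?dP i $ i $ m)"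
    by (subst sum.swap) (simp add: dP3 sum_negf)
  have C2: "(\<Sum>i\<in>?U. \<Sum>j\<in>?U. (\<Gamma> j x ** K m i x) $ i $ j) = 0"
  proof -
    let ?f = "\<lambda>j l. \<Sum>i\<in>?U. \<Gamma> j x $ i $ l * K m i x $ l $ j"
    have *: "(\<Sum>i\<in>?U. \<Sum>j\<in>?U. (\<Gamma> j x ** K m i x) $ i $ j) = (\<Sum>j\<in>?U. \<Sum>l\<in>?U. ?f j l)"
      unfolding matrix_matrix_mult_def by (subst sum.swap, simp, intro sum.cong[OF refl] sum.swap)
    also have "\<dots> = (\<Sum>l\<in>?U. \<Sum>j\<in>?U. ?f j l)" by (rule sum.swap)
    also have "\<dots> = (\<Sum>l\<in>?U. \<Sum>j\<in>?U. - ?f l j)"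
    proof (intro sum.cong[OF refl])
      fix j l
      show "?f j l = - ?f l j"
        unfolding sum_negf[symmetric] by (rule sum.cong[OF refl]) (simp add: skew[of _ _ l j] tf[of j _ l])
    qed
    finally show ?thesis unfolding sum_negf by (simp add: *)
  qed
  have C3: "(\<Sum>i\<in>?U. \<Sum>j\<in>?U. (K m i x ** transpose (\<Gamma> j x)) $ i $ j) = - (\<Sum>j\<in>?U. \<Sum>l\<in>?U. \<Gamma> j x $ j $ l * ?P $ l $ m)"
  proof -
    have "(\<Sum>i\<in>?U. (K m i x ** transpose (\<Gamma> j x)) $ i $ j) = (\<Sum>l\<in>?U. \<Gamma> j x $ j $ l * (\<Sum>i\<in>?U. K m i x $ i $ l))" for j
      unfolding matrix_matrix_mult_def transpose_def
      by (simp add: sum_distrib_left mult.commute) (rule sum.swap)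
    then show ?thesis by (subst sum.swap) (simp add: P3 sum_negf)
  qed
  \<comment> \<open>By \<open>torsion_free\<close> the correction for the lower index of the Ricci
    operator is the common value of \<open>A2\<close> and \<open>A3\<close>.\<close>
  have D: "(\<Sum>i\<in>?U. (?P ** \<Gamma> i x) $ i $ m) = (\<Sum>i\<in>?U. \<Sum>l\<in>?U. \<Gamma> m x $ i $ l * ?P $ l $ i)"
    unfolding matrix_matrix_mult_def by (subst sum.swap) (simp add: tf[of m] mult.commute)
  have E: "(\<Sum>i\<in>?U. (\<Gamma> i x ** ?P) $ i $ m) = (\<Sum>i\<in>?U. \<Sum>l\<in>?U. \<Gamma> i x $ i $ l * ?P $ l $ m)"
    by (simp add: matrix_matrix_mult_def)
  have "(\<Sum>i\<in>?U. \<Sum>j\<in>?U. ((partial m (K i j) x + \<Gamma> m x ** K i j x + K i j x ** transpose (\<Gamma> m x))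
    + (partial i (K j m) x + \<Gamma> i x ** K j m x + K j m x ** transpose (\<Gamma> i x))
    + (partial j (K m i) x + \<Gamma> j x ** K m i x + K m i x ** transpose (\<Gamma> j x))) $ i $ j) = 0"
    unfolding bianchi_K[OF x] by simp
  then have "partial m (scal h) x - 2 * (\<Sum>i\<in>?U. ?dP i $ i $ m) - 2 * (\<Sum>i\<in>?U. (\<Gamma> i x ** ?P) $ i $ m)
     + 2 * (\<Sum>i\<in>?U. (?P ** \<Gamma> i x) $ i $ m) = 0"
    unfolding vector_add_component sum.distrib A1 A2 A3 B1 B2 B3 C1 C2 C3 D E by simp
  then show ?thesis by (simp add: sum.distrib sum_subtractf algebra_simps)
qed

section \<open>Divergence of vector fields in coordinates\<close>

lemma covariant_derivative_nth:
  assumes "Y differentiable (at x)"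
  shows "covariant_derivative h Y x $ i $ j = (partial j Y x + \<Gamma> j x *v Y x) $ i"
  by (simp add: covariant_derivative_def connection_def matrix_vector_mult_def partial_nth[OF assms])

lemma divergence_eq:
  assumes "Y differentiable (at x)"
  shows "divergence h Y x = (\<Sum>i\<in>UNIV. (partial i Y x + \<Gamma> i x *v Y x) $ i)"
  by (simp add: divergence_def trace_def covariant_derivative_nth[OF assms])

lemma Ck_covariant_derivative:
  assumes "Ck_on (Suc k) Y S"
  shows "Ck_on k (covariant_derivative h Y) S"
proof (intro Ck_on_vec open_S)
  fix i j
  have "Ck_on k (\<lambda>x. (partial j Y x + \<Gamma> j x *v Y x) $ i) S"
    by (intro Ck_on_nth Ck_on_add Ck_on_matrix_vector_mult open_S Ck_connection Ck_on_partial[OF assms] Ck_on_SucD[OF assms])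
  moreover have "covariant_derivative h Y x $ i $ j = (partial j Y x + \<Gamma> j x *v Y x) $ i" if "x \<in> S" for x
    by (rule covariant_derivative_nth[OF Ck_on_differentiable[OF assms that]])
  ultimately show "Ck_on k (\<lambda>x. covariant_derivative h Y x $ i $ j) S"
    using Ck_on_cong[OF open_S, of "\<lambda>x. covariant_derivative h Y x $ i $ j" "\<lambda>x. (partial j Y x + \<Gamma> j x *v Y x) $ i"]
    by blast
qed

lemma Ck_divergence: "Ck_on (Suc k) Y S \<Longrightarrow> Ck_on k (divergence h Y) S"
  unfolding divergence_def by (intro Ck_on_bounded_linear[OF bounded_linear_trace open_S] Ck_covariant_derivative)

lemma divergence_scaleR:
  assumes f: "f differentiable (at x)" and Y: "Y differentiable (at x)"
  shows "divergence h (\<lambda>y. f y *\<^sub>R Y y) x = f x * divergence h Y x + (\<Sum>i\<in>UNIV. partial i f x * Y x $ i)"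
proof -
  have "(\<lambda>y. f y *\<^sub>R Y y) differentiable (at x)"
    by (rule differentiable_bounded_bilinear[OF bounded_bilinear_scaleR f Y])
  then show ?thesis
    by (simp add: divergence_eq Y partial_scaleR[OF f Y] matrix_vector_mult_scaleR sum.distrib sum_distrib_left algebra_simps)
qed

lemma divergence_sum:
  assumes "\<And>a. a \<in> I \<Longrightarrow> Y a differentiable (at x)"
  shows "divergence h (\<lambda>y. \<Sum>a\<in>I. Y a y) x = (\<Sum>a\<in>I. divergence h (Y a) x)"
proof -
  have "(\<lambda>y. \<Sum>a\<in>I. Y a y) differentiable (at x)"
    using assms by (cases "finite I") (auto intro: differentiable_sum)
  then show ?thesis
    using assms sum.swap[of "\<lambda>a i. (partial i (Y a) x + \<Gamma> i x *v Y a x) $ i" UNIV I]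
    by (simp add: divergence_eq partial_sum linear_sum[OF matrix_vector_mul_linear] sum.distrib)
qed

text \<open>Inserting \<open>ricci_op x ** \<Gamma> i x\<close> with both signs splits the product
  rule into covariant derivatives of the two factors; the contraction of the first is half the
  differential of the scalar curvature by \<open>contracted_bianchi\<close>.\<close>

lemma divergence_ricci_op:
  assumes x: "x \<in> S" and Y: "Y differentiable (at x)"
  shows "divergence h (\<lambda>y. ricci_op y *v Y y) x
    = (\<Sum>m\<in>UNIV. partial m (scal h) x * Y x $ m) / 2 + trace (ricci_op x ** covariant_derivative h Y x)"
proof -
  let ?P = "ricci_op x"
  have dP: "ricci_op differentiable (at x)" by (rule Ck_on_differentiable[OF Ck_ricci_op x])
  have "divergence h (\<lambda>y. ricci_op y *v Y y) x
     = (\<Sum>i\<in>UNIV. (?P *v partial i Y x + partial i ricci_op x *v Y x + \<Gamma> i x *v (?P *v Y x)) $ i)"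
    by (simp add: divergence_eq[OF differentiable_bounded_bilinear[OF bounded_bilinear_matrix_vector_mult dP Y]]
        partial_matrix_vector_mult[OF dP Y])
  also have "\<dots> = (\<Sum>i\<in>UNIV. ((partial i ricci_op x + \<Gamma> i x ** ?P - ?P ** \<Gamma> i x) *v Y x) $ i
      + (?P *v (partial i Y x + \<Gamma> i x *v Y x)) $ i)"
    by (simp add: matrix_vector_mult_add_rdistrib matrix_vector_mult_diff_rdistrib
        matrix_vector_right_distrib matrix_vector_mul_assoc add_ac)
  also have "\<dots> = (\<Sum>i\<in>UNIV. ((partial i ricci_op x + \<Gamma> i x ** ?P - ?P ** \<Gamma> i x) *v Y x) $ i)
     + trace (?P ** covariant_derivative h Y x)"
    by (simp add: sum.distrib trace_def matrix_matrix_mult_def covariant_derivative_nth[OF Y])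
      (simp add: matrix_vector_mult_def)
  also have "(\<Sum>i\<in>UNIV. ((partial i ricci_op x + \<Gamma> i x ** ?P - ?P ** \<Gamma> i x) *v Y x) $ i)
     = (\<Sum>m\<in>UNIV. (\<Sum>i\<in>UNIV. (partial i ricci_op x + \<Gamma> i x ** ?P - ?P ** \<Gamma> i x) $ i $ m) * Y x $ m)"
    unfolding matrix_vector_mult_def by (simp only: vec_lambda_beta sum_distrib_right) (rule sum.swap)
  also have "\<dots> = (\<Sum>m\<in>UNIV. partial m (scal h) x * Y x $ m) / 2"
    unfolding contracted_bianchi[OF x] mult.assoc sum_distrib_left[symmetric] by simp
  finally show ?thesis .
qed

text \<open>Commuting the two derivatives of \<open>Y\<close> produces the Ricci term.\<close>

lemma divergence_covariant_derivative:
  assumes x: "x \<in> S" and Y: "Ck_on 2 Y S"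
  shows "divergence h (\<lambda>y. covariant_derivative h Y y *v Y y) x
    = trace (covariant_derivative h Y x ** covariant_derivative h Y x) + Y x \<bullet> (ricci h x *v Y x)
      + (\<Sum>j\<in>UNIV. partial j (divergence h Y) x * Y x $ j)"
proof -
  let ?U = "UNIV :: 'n set"
  \<comment> \<open>\<open>N j\<close> is the covariant derivative of Y along the
    \<open>j\<close>-th coordinate, treated for each fixed \<open>j\<close> as a vector field of its
    own.\<close>
  define N where "N j y = partial j Y y + \<Gamma> j y *v Y y" for j y
  let ?C = "covariant_derivative h Y"
  have dY: "Y differentiable (at y)" if "y \<in> S" for y using Y that by (auto simp: numeral_2_eq_2)
  have C2: "Ck_on (Suc (Suc 0)) Y S" using Y by (simp add: numeral_2_eq_2)
  have dpY: "partial j Y differentiable (at x)" for j by (rule Ck_on_differentiable[OF Ck_on_partial[OF C2] x])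
  have CN: "Ck_on 1 (N j) S" for j
    unfolding N_def One_nat_def
    by (intro Ck_on_add Ck_on_matrix_vector_mult open_S Ck_connection Ck_on_partial C2 Ck_on_SucD[OF C2])
  have dN: "N j differentiable (at x)" for j using CN x by simp
  have CY: "?C y $ i $ j = N j y $ i" if "y \<in> S" for i j y
    using covariant_derivative_nth[OF dY[OF that]] by (simp add: N_def)
  have dYj: "(\<lambda>y. Y y $ j) differentiable (at x)" for j
    by (rule differentiable_bounded_linear[OF bounded_linear_vec_nth dY[OF x]])
  have W: "?C y *v Y y = (\<Sum>j\<in>?U. (Y y $ j) *\<^sub>R N j y)" if "y \<in> S" for y
    using CY[OF that] by (simp add: vec_eq_iff matrix_vector_mult_def mult.commute)
  have dW: "(\<lambda>y. (Y y $ j) *\<^sub>R N j y) differentiable (at x)" for j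
    by (rule differentiable_bounded_bilinear[OF bounded_bilinear_scaleR dYj dN])
  have pN: "partial i (N j) x = partial i (partial j Y) x + (\<Gamma> j x *v partial i Y x + partial i (\<Gamma> j) x *v Y x)" for i j
    unfolding N_def
    by (simp add: partial_add dpY partial_matrix_vector_mult differentiable_bounded_bilinear[OF bounded_bilinear_matrix_vector_mult]
         dY[OF x] differentiable_connection[OF x])
  \<comment> \<open>The Ricci identity for fixed \<open>i\<close> and \<open>j\<close>: the two
    covariant derivatives commute up to the curvature.\<close>
  have comm: "partial i (N j) x + \<Gamma> i x *v N j x = partial j (N i) x + \<Gamma> j x *v N i x + F i j x *v Y x" for i j
    unfolding pN curvature_eq[OF x] unfolding N_def partial_commute_vec[OF open_S x Y, of i j]
    by (simp add: matrix_vector_mult_add_rdistrib matrix_vector_mult_diff_rdistrib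
        matrix_vector_right_distrib matrix_vector_mul_assoc)
  have "divergence h (\<lambda>y. ?C y *v Y y) x = divergence h (\<lambda>y. \<Sum>j\<in>?U. (Y y $ j) *\<^sub>R N j y) x"
    unfolding divergence_def by (intro arg_cong[where f=trace] covariant_derivative_cong[OF open_S x] W)
  also have "\<dots> = (\<Sum>j\<in>?U. Y x $ j * divergence h (N j) x + (\<Sum>i\<in>?U. partial i Y x $ j * N j x $ i))"
    unfolding divergence_sum[OF dW] divergence_scaleR[OF dYj dN] partial_nth[OF dY[OF x]] ..
  also have "\<dots> = (\<Sum>j\<in>?U. Y x $ j * (\<Sum>i\<in>?U. (partial j (N i) x + \<Gamma> j x *v N i x + F i j x *v Y x) $ i))
     + (\<Sum>j\<in>?U. \<Sum>i\<in>?U. partial i Y x $ j * N j x $ i)"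
  proof -
    have "divergence h (N j) x = (\<Sum>i\<in>?U. (partial j (N i) x + \<Gamma> j x *v N i x + F i j x *v Y x) $ i)" for j
      unfolding divergence_eq[OF dN] by (intro sum.cong refl) (simp only: comm[of _ j])
    then show ?thesis by (simp only: sum.distrib)
  qed
  also have "\<dots> = (\<Sum>j\<in>?U. partial j (divergence h Y) x * Y x $ j)
     + (\<Sum>j\<in>?U. Y x $ j * (\<Sum>i\<in>?U. (\<Gamma> j x *v N i x) $ i)) + (\<Sum>j\<in>?U. Y x $ j * (\<Sum>i\<in>?U. (F i j x *v Y x) $ i))
     + (\<Sum>j\<in>?U. \<Sum>i\<in>?U. partial i Y x $ j * N j x $ i)"
  proof -
    have "partial j (divergence h Y) x = (\<Sum>i\<in>?U. partial j (N i) x $ i)" for j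
    proof -
      have "partial j (divergence h Y) x = partial j (\<lambda>y. \<Sum>i\<in>?U. N i y $ i) x"
        by (rule partial_cong[OF open_S x]) (simp add: divergence_eq dY N_def)
      then show ?thesis
        by (simp add: partial_sum differentiable_bounded_linear[OF bounded_linear_vec_nth dN] partial_nth[OF dN])
    qed
    then show ?thesis by (simp add: sum.distrib distrib_left mult.commute)
  qed
  also have "(\<Sum>j\<in>?U. Y x $ j * (\<Sum>i\<in>?U. (F i j x *v Y x) $ i)) = Y x \<bullet> (ricci h x *v Y x)"
  proof -
    have "(\<Sum>i\<in>?U. (F i j x *v Y x) $ i) = (ricci h x *v Y x) $ j" for j
      unfolding matrix_vector_mult_def by (simp add: ricci_nth sum_distrib_right) (rule sum.swap)
    then show ?thesis by (simp add: inner_vec_def)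
  qed
  \<comment> \<open>\<open>torsion_free\<close> rewrites this correction so that it completes
    \<open>partial i Y x $ j\<close> to \<open>N i x $ j\<close>, which then forms the trace of the
    squared covariant derivative.\<close>
  also have "(\<Sum>j\<in>?U. Y x $ j * (\<Sum>i\<in>?U. (\<Gamma> j x *v N i x) $ i))
     = (\<Sum>j\<in>?U. \<Sum>i\<in>?U. (\<Gamma> i x *v Y x) $ j * N j x $ i)"
  proof -
    have "(\<Sum>j\<in>?U. Y x $ j * (\<Sum>i\<in>?U. (\<Gamma> j x *v N i x) $ i))
      = (\<Sum>j\<in>?U. \<Sum>i\<in>?U. \<Sum>l\<in>?U. Y x $ j * \<Gamma> j x $ i $ l * N i x $ l)"
      by (simp add: matrix_vector_mult_def sum_distrib_left mult.assoc)
    also have "\<dots> = (\<Sum>i\<in>?U. \<Sum>j\<in>?U. \<Sum>l\<in>?U. Y x $ j * \<Gamma> j x $ i $ l * N i x $ l)"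
      by (rule sum.swap)
    also have "\<dots> = (\<Sum>i\<in>?U. \<Sum>l\<in>?U. \<Sum>j\<in>?U. Y x $ j * \<Gamma> j x $ i $ l * N i x $ l)"
      by (intro sum.cong[OF refl] sum.swap)
    also have "\<dots> = (\<Sum>i\<in>?U. \<Sum>l\<in>?U. (\<Gamma> l x *v Y x) $ i * N i x $ l)"
      by (intro sum.cong[OF refl]) (simp add: matrix_vector_mult_def sum_distrib_right sum_distrib_left torsion_free[OF x, of _ _ l for l] mult.commute mult.left_commute)
    finally show ?thesis .
  qed
  finally have "divergence h (\<lambda>y. ?C y *v Y y) x = (\<Sum>j\<in>?U. partial j (divergence h Y) x * Y x $ j)
      + Y x \<bullet> (ricci h x *v Y x) + (\<Sum>j\<in>?U. \<Sum>i\<in>?U. N i x $ j * N j x $ i)"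
    by (simp add: N_def[of _ x] sum.distrib algebra_simps)
  moreover have "trace (?C x ** ?C x) = (\<Sum>j\<in>?U. \<Sum>i\<in>?U. N i x $ j * N j x $ i)"
    by (simp add: trace_def matrix_matrix_mult_def CY[OF x])
  ultimately show ?thesis by simp
qed

text \<open>\<open>compatible\<close> splits the derivative of the metric along Y into a lowered
  connection term and its transpose; by \<open>torsion_free\<close> each completes a partial
  derivative of Y to a covariant one.\<close>

lemma lie_derivative_eq:
  assumes x: "x \<in> S" and Y: "Y differentiable (at x)"
  shows "lie_derivative Y h x = h x ** covariant_derivative h Y x + transpose (h x ** covariant_derivative h Y x)"
proof -
  let ?U = "UNIV :: 'n set"
  let ?L = "\<lambda>i j. (\<Sum>k\<in>?U. h x $ i $ k * partial j Y x $ k) + (\<Sum>m\<in>?U. Y x $ m * (h x ** \<Gamma> m x) $ i $ j)"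
  have hC: "(h x ** covariant_derivative h Y x) $ i $ j = ?L i j" for i j
  proof -
    have "(\<Sum>k\<in>?U. h x $ i $ k * (\<Gamma> j x *v Y x) $ k) = (\<Sum>k\<in>?U. \<Sum>m\<in>?U. Y x $ m * (h x $ i $ k * \<Gamma> m x $ k $ j))"
      by (simp add: matrix_vector_mult_def sum_distrib_left torsion_free[OF x, of j] mult_ac)
    also have "\<dots> = (\<Sum>m\<in>?U. Y x $ m * (h x ** \<Gamma> m x) $ i $ j)"
      by (subst sum.swap) (simp add: matrix_matrix_mult_def sum_distrib_left)
    finally show ?thesis
      by (simp add: matrix_matrix_mult_def[of "h x" "covariant_derivative h Y x"] covariant_derivative_nth[OF Y] distrib_left sum.distrib)
  qed
  have dh: "partial m h x $ i $ j = (h x ** \<Gamma> m x) $ i $ j + (h x ** \<Gamma> m x) $ j $ i" for m i j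
  proof -
    have "transpose (\<Gamma> m x) ** h x = transpose (h x ** \<Gamma> m x)"
      by (simp add: matrix_transpose_mul symmetric x)
    then show ?thesis unfolding compatible[OF x] by (simp add: transpose_def)
  qed
  have sym: "h x $ a $ b = h x $ b $ a" for a b
    using arg_cong[OF symmetric[OF x], of "\<lambda>M. M $ b $ a"] by (simp add: transpose_def)
  have "lie_derivative Y h x $ i $ j = ?L i j + ?L j i" for i j
    by (simp add: lie_derivative_def partial_nth[OF Y] partial_nth2[OF differentiable_h[OF x]] dh sum.distrib
        distrib_left sym[of _ j])
  then show ?thesis by (simp add: vec_eq_iff transpose_def hC)
qed

section \<open>The Riemannian volume density\<close>

lemma det_positive: assumes "x \<in> S" shows "det (h x) > 0"
proof -
  \<comment> \<open>The segment from the identity to \<open>h x\<close> stays in the positive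
    definite matrices, so the determinant starts at 1 and never reaches 0; the intermediate value
    theorem fixes its sign.\<close>
  define f where "f t = det ((1 - t) *\<^sub>R mat 1 + t *\<^sub>R h x)" for t :: real
  have c: "continuous_on {0..1} f"
    unfolding f_def det_def by (intro continuous_intros)
  have nz: "f t \<noteq> 0" if "t \<in> {0..1}" for t
  proof -
    have "v = 0" if "((1 - t) *\<^sub>R mat 1 + t *\<^sub>R h x) *v v = 0" for v
    proof (rule ccontr)
      assume v: "v \<noteq> 0"
      have "v \<bullet> (((1 - t) *\<^sub>R mat 1 + t *\<^sub>R h x) *v v) = (1 - t) * (v \<bullet> v) + t * (v \<bullet> (h x *v v))"
        by (simp add: matrix_vector_mult_add_rdistrib scaleR_matrix_vector_assoc[symmetric] inner_add_right)
      moreover have "\<dots> > 0"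
      proof (cases "t = 0")
        case True then show ?thesis using v by simp
      next
        case False
        then have "t * (v \<bullet> (h x *v v)) > 0" "(1 - t) * (v \<bullet> v) \<ge> 0"
          using \<open>t \<in> {0..1}\<close> positive[OF assms v] by auto
        then show ?thesis by linarith
      qed
      ultimately show False using that by simp
    qed
    then have "invertible ((1 - t) *\<^sub>R mat 1 + t *\<^sub>R h x)"
      by (simp add: invertible_left_inverse matrix_left_invertible_ker)
    then show ?thesis by (simp add: f_def invertible_det_nz)
  qed
  have "f 0 = 1" "f 1 = det (h x)" by (simp_all add: f_def)
  moreover have "\<not> f 1 < 0"
  proof
    assume "f 1 < 0"
    with IVT2'[of f 1 0 0] c \<open>f 0 = 1\<close> obtain t where "0 \<le> t" "t \<le> 1" "f t = 0" by auto
    then show False using nz by auto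
  qed
  ultimately show ?thesis using nz[of 1] by force
qed

definition volume_density :: "real^'n \<Rightarrow> real" where "volume_density x = sqrt (det (h x))"

lemma Ck_volume_density: "Ck_on k volume_density S"
  unfolding volume_density_def by (intro Ck_on_sqrt Ck_on_det Ck_on_nth smooth open_S det_positive)

text \<open>Factoring \<open>det (h y)\<close> as \<open>det (h x) * det (G x ** h y)\<close>
  reduces Jacobi's formula to the derivative of the determinant at the identity. Compatibility makes
  the trace of \<open>G x ** partial i h x\<close> twice that of \<Gamma>, and the square root
  halves it again.\<close>

lemma partial_volume_density:
  assumes x: "x \<in> S"
  shows "partial i volume_density x = volume_density x * trace (\<Gamma> i x)"
proof -
  have dM: "(\<lambda>y. G x ** h y) differentiable (at x)"
    by (rule differentiable_matrix_mult) (use x in auto)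
  have ddet: "(\<lambda>y. det (h y)) differentiable (at x)"
    by (rule Ck_on_differentiable[OF Ck_on_det[OF open_S] x]) (intro Ck_on_nth open_S smooth)
  have "det (h y) = det (h x) * det (G x ** h y)" for y
    using arg_cong[OF h_G[OF x], of det] by (simp add: det_mul)
  then have e: "(\<lambda>y. det (h y)) = (\<lambda>y. det (h x) * det (G x ** h y))" by (rule ext)
  have d: "(\<lambda>y. det (G x ** h y)) differentiable (at x)"
    unfolding det_mul by (rule differentiable_bounded_bilinear[OF bounded_bilinear_mult differentiable_const ddet])
  have "partial i (\<lambda>y. det (h y)) x = partial i (\<lambda>y. det (h x) * det (G x ** h y)) x"
    by (rule arg_cong[OF e, of "\<lambda>f. partial i f x"])
  also have "\<dots> = det (h x) * partial i (\<lambda>y. det (G x ** h y)) x"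
    unfolding partial_mult[OF differentiable_const d] by simp
  also have "partial i (\<lambda>y. det (G x ** h y)) x = trace (G x ** partial i h x)"
    unfolding partial_det_mat1[OF G_h[OF x] dM] partial_matrix_mult[OF differentiable_const differentiable_h[OF x]]
    by (simp add: matrix_mult.zero_left)
  also have "\<dots> = 2 * trace (\<Gamma> i x)"
  proof -
    have "trace (G x ** (transpose (\<Gamma> i x) ** h x)) = trace ((h x ** G x) ** transpose (\<Gamma> i x))"
      by (metis matrix_mul_assoc trace_mul_sym)
    then show ?thesis unfolding compatible[OF x] matrix_mult.add_right trace_add
      by (simp add: matrix_mul_assoc x trace_transpose)
  qed
  finally have "partial i (\<lambda>y. det (h y)) x = 2 * det (h x) * trace (\<Gamma> i x)" by simp
  moreover have "partial i volume_density x = inverse (sqrt (det (h x))) / 2 * partial i (\<lambda>y. det (h y)) x"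
    unfolding volume_density_def
    by (rule partial_compose_real(1)[OF ddet]) (use DERIV_real_sqrt[OF det_positive[OF x]] in simp)
  moreover have "det (h x) = volume_density x * volume_density x" "volume_density x > 0"
    using det_positive[OF x] by (simp_all add: volume_density_def)
  ultimately show ?thesis by (simp add: volume_density_def[symmetric] field_simps)
qed

text \<open>The bridge to integration: against the volume density the Riemannian divergence is a
  Euclidean one. The trace terms match by \<open>torsion_free\<close>.\<close>

lemma divergence_volume_density:
  assumes x: "x \<in> S" and Y: "Y differentiable (at x)"
  shows "(\<Sum>i\<in>UNIV. partial i (\<lambda>y. volume_density y * Y y $ i) x) = volume_density x * divergence h Y x"
proof -
  have d: "volume_density differentiable (at x)" by (rule Ck_on_differentiable[OF Ck_volume_density x])
  have "(\<Sum>i\<in>UNIV. partial i (\<lambda>y. volume_density y * Y y $ i) x)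
     = volume_density x * ((\<Sum>i\<in>UNIV. partial i Y x $ i) + (\<Sum>i\<in>UNIV. trace (\<Gamma> i x) * Y x $ i))"
    unfolding partial_mult[OF d differentiable_bounded_linear[OF bounded_linear_vec_nth Y]] partial_nth[OF Y]
      partial_volume_density[OF x] sum.distrib[symmetric] sum_distrib_left
    by (intro sum.cong refl) (simp add: algebra_simps)
  also have "(\<Sum>i\<in>UNIV. trace (\<Gamma> i x) * Y x $ i) = (\<Sum>i\<in>UNIV. (\<Gamma> i x *v Y x) $ i)"
  proof -
    have "(\<Sum>i\<in>UNIV. trace (\<Gamma> i x) * Y x $ i) = (\<Sum>i\<in>UNIV. \<Sum>a\<in>UNIV. \<Gamma> a x $ a $ i * Y x $ i)"
      unfolding trace_def sum_distrib_right
      by (intro sum.cong[OF refl] arg_cong2[where f="(*)"] torsion_free[OF x] refl)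
    also have "\<dots> = (\<Sum>a\<in>UNIV. \<Sum>i\<in>UNIV. \<Gamma> a x $ a $ i * Y x $ i)" by (rule sum.swap)
    finally show ?thesis by (simp add: matrix_vector_mult_def)
  qed
  finally show ?thesis by (simp add: divergence_eq[OF Y] sum.distrib)
qed

end

section \<open>Change of charts\<close>

lemma matrix_mult_scaleR [simp]:
  fixes A :: "real^'n::finite^'m::finite" and B :: "real^'p::finite^'n"
  shows "(c *\<^sub>R A) ** B = c *\<^sub>R (A ** B)" "A ** (c *\<^sub>R B) = c *\<^sub>R (A ** B)"
  by (rule matrix_mult.scaleR_left, rule matrix_mult.scaleR_right)

lemma transpose_sum: "transpose (\<Sum>b\<in>I. f b) = (\<Sum>b\<in>I. transpose (f b :: real^'n::finite^'m::finite))"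
  by (rule linear_sum[OF bounded_linear.linear[OF bounded_linear_transpose]])

text \<open>Curvature of a connection after the change of frame \<open>J\<close>, where \<open>e\<close> is the derivative of
  the transformation law \<open>L\<close>.\<close>

lemma gauge_curvature_algebra:
  fixes J :: "real^'n::finite^'n" and A B dJ :: "'i \<Rightarrow> real^'n^'n"
  assumes L: "\<And>i. dJ i = J ** B i - A i ** J"
    and e: "\<And>i j. ddJ j i + (A i ** dJ j + dA j i ** J) = J ** dB j i + dJ j ** B i"
    and c: "ddJ i j = ddJ j i"
  shows "J ** (dB j i - dB i j + B j ** B i - B i ** B j) = (dA j i - dA i j + A j ** A i - A i ** A j) ** J"
proof -
  have "J ** dB j i = ddJ j i + (A i ** dJ j + dA j i ** J) - dJ j ** B i" for i j
    using e[of j i] by simp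
  then show ?thesis unfolding matrix_mult.add_right matrix_mult.diff_right L
    by (simp add: c matrix_ring)
qed

text \<open>The coordinate change is only assumed to map \<open>S\<close> smoothly into
  \<open>S'\<close> and to pull \<open>h'\<close> back to \<open>h\<close>; invertibility of its
  Jacobian follows from positivity of \<open>h\<close>.\<close>

locale chart_change = src: local_metric S h + dst: local_metric S' h'
  for S :: "(real^'n::finite) set" and h and S' :: "(real^'n) set" and h' +
  fixes \<psi> :: "real^'n \<Rightarrow> real^'n"
  assumes smooth_\<psi>: "\<And>k. Ck_on k \<psi> S" and image_\<psi>: "\<psi> ` S \<subseteq> S'"
    and pullback: "x \<in> S \<Longrightarrow>
      h x = transpose (jacobian \<psi> (at x)) ** h' (\<psi> x) ** jacobian \<psi> (at x)"
begin

definition J where "J x = jacobian \<psi> (at x)"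

text \<open>The connection of \<open>h'\<close> along \<open>\<psi>\<close>: directions are pulled
  back to the source, while the matrix indices still refer to the target frame.\<close>

definition pullback_connection where
  "pullback_connection i x = (\<Sum>b\<in>UNIV. (J x $ b $ i) *\<^sub>R connection h' b (\<psi> x))"

lemma \<psi>_in: "x \<in> S \<Longrightarrow> \<psi> x \<in> S'"
  using image_\<psi> by auto

lemma J_nth: "J x $ a $ i = partial i \<psi> x $ a"
  by (simp add: J_def jacobian_def matrix_def partial_def)

lemma h_eq: "x \<in> S \<Longrightarrow> h x = transpose (J x) ** h' (\<psi> x) ** J x"
  unfolding J_def by (rule pullback)

lemma Ck_J: "Ck_on k J S"
proof -
  have "Ck_on k (\<lambda>x. partial i \<psi> x $ a) S" for i a
    by (intro Ck_on_nth Ck_on_partial src.open_S smooth_\<psi>)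
  then show ?thesis by (intro Ck_on_vec src.open_S) (simp add: J_nth)
qed

lemma differentiable_J: "x \<in> S \<Longrightarrow> J differentiable (at x)"
  by (rule Ck_on_differentiable[OF Ck_J])

lemma differentiable_\<psi>: "x \<in> S \<Longrightarrow> \<psi> differentiable (at x)"
  by (rule Ck_on_differentiable[OF smooth_\<psi>])

lemma partial_J_nth: assumes x: "x \<in> S" shows "partial i J x $ a $ j = partial i (partial j \<psi>) x $ a"
proof -
  have "partial i J x $ a $ j = partial i (\<lambda>y. partial j \<psi> y $ a) x"
    by (simp add: partial_nth2[OF differentiable_J[OF x], symmetric] J_nth)
  also have "\<dots> = partial i (partial j \<psi>) x $ a"
    by (rule partial_nth[OF Ck_on_differentiable[OF Ck_on_partial[OF smooth_\<psi>] x]])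
  finally show ?thesis .
qed

lemma partial_J_swap: "x \<in> S \<Longrightarrow> partial i J x $ a $ j = partial j J x $ a $ i"
  by (simp add: partial_J_nth partial_commute_vec[OF src.open_S _ smooth_\<psi>, of x i j])

lemma partial_pullback:
  assumes x: "x \<in> S" and f: "f differentiable (at (\<psi> x))"
  shows "partial i (\<lambda>y. f (\<psi> y)) x = (\<Sum>b\<in>UNIV. (J x $ b $ i) *\<^sub>R partial b f (\<psi> x))"
  by (simp add: partial_compose[OF differentiable_\<psi>[OF x] f] J_nth)

lemma invertible_J: assumes x: "x \<in> S" shows "invertible (J x)"
proof -
  have "v = 0" if "J x *v v = 0" for v
  proof -
    have "h x *v v = 0" using that by (simp add: h_eq[OF x] matrix_vector_mul_assoc[symmetric] matrix_mul_assoc[symmetric])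
    then show ?thesis using src.positive[OF x, of v] by force
  qed
  then show ?thesis by (simp add: invertible_left_inverse matrix_left_invertible_ker)
qed

lemma J_inverse [simp]: "x \<in> S \<Longrightarrow> J x ** matrix_inv (J x) = mat 1"
    "x \<in> S \<Longrightarrow> matrix_inv (J x) ** J x = mat 1"
  using invertible_J[of x] someI_ex[of "\<lambda>B. J x ** B = mat 1 \<and> B ** J x = mat 1"]
  unfolding invertible_def matrix_inv_def by blast+

text \<open>The inhomogeneous transformation law. Solving it for the source connection gives
  candidates \<open>B\<close>; they are compatible with \<open>h\<close> by differentiating the
  pullback formula and torsion-free because second derivatives of \<open>\<psi>\<close> commute, so
  \<open>connection_unique\<close> identifies them.\<close>

lemma connection_change:
  assumes x: "x \<in> S"
  shows "partial i J x + pullback_connection i x ** J x = J x ** connection h i x"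
proof -
  let ?A = "\<lambda>i. pullback_connection i x" and ?H = "h' (\<psi> x)" and ?J = "J x"
  define M where "M i = partial i J x + ?A i ** ?J" for i
  define B where "B i = matrix_inv ?J ** M i" for i
  have JB: "?J ** B i = M i" for i by (simp add: B_def matrix_mul_assoc x)
  have dH: "partial i (\<lambda>y. h' (\<psi> y)) x = ?H ** ?A i + transpose (?A i) ** ?H" for i
    by (simp add: partial_pullback[OF x dst.differentiable_h[OF \<psi>_in[OF x]]] dst.compatible[OF \<psi>_in[OF x]]
        pullback_connection_def matrix_mult.sum_left matrix_mult.sum_right transpose_sum transpose_scalar
        scaleR_add_right sum.distrib)
  have dt: "(\<lambda>y. transpose (J y)) differentiable (at x)"
    by (rule differentiable_bounded_linear[OF bounded_linear_transpose differentiable_J[OF x]])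
  have dH': "(\<lambda>y. h' (\<psi> y)) differentiable (at x)"
    by (rule differentiable_compose_at[OF differentiable_\<psi>[OF x] dst.differentiable_h[OF \<psi>_in[OF x]]])
  have "partial i h x = h x ** B i + transpose (B i) ** h x" for i
  proof -
    have "partial i h x = partial i (\<lambda>y. transpose (J y) ** h' (\<psi> y) ** J y) x"
      by (rule partial_cong[OF src.open_S x h_eq])
    also have "\<dots> = transpose ?J ** ?H ** partial i J x
        + (transpose ?J ** (?H ** ?A i + transpose (?A i) ** ?H) + transpose (partial i J x) ** ?H) ** ?J"
      by (simp add: partial_matrix_mult differentiable_matrix_mult
          dt dH' differentiable_J x dH partial_bounded_linear[OF bounded_linear_transpose])
    also have "\<dots> = transpose ?J ** ?H ** M i + transpose (M i) ** ?H ** ?J"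
      by (simp add: M_def matrix_ring transpose_add matrix_transpose_mul)
    also have "transpose ?J ** ?H ** M i = h x ** B i"
      by (simp add: h_eq[OF x] JB[symmetric] matrix_mul_assoc)
    also have "transpose (M i) ** ?H ** ?J = transpose (B i) ** h x"
      by (simp add: h_eq[OF x] JB[symmetric] matrix_mul_assoc matrix_transpose_mul)
    finally show ?thesis .
  qed
  moreover have "B i $ k $ j = B j $ k $ i" for i j k
  proof -
    have "(?A i ** ?J) $ a $ j = (?A j ** ?J) $ a $ i" for a i j
    proof -
      have e: "(?A i ** ?J) $ a $ j = (\<Sum>c\<in>UNIV. \<Sum>b\<in>UNIV. ?J $ b $ i * ?J $ c $ j * connection h' b (\<psi> x) $ a $ c)" for i j
        by (simp add: matrix_matrix_mult_def pullback_connection_def sum_distrib_left sum_distrib_right mult_ac)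
      show ?thesis unfolding e
        by (subst sum.swap) (simp add: dst.torsion_free[OF \<psi>_in[OF x], of _ a] mult_ac)
    qed
    then have "M i $ a $ j = M j $ a $ i" for a i j
      by (simp add: M_def partial_J_swap[OF x, of i a j])
    then show ?thesis by (simp add: B_def matrix_matrix_mult_def)
  qed
  ultimately have "B i = connection h i x" by (intro src.connection_unique[OF x])
  then show ?thesis using JB[of i] by (simp add: M_def)
qed

lemma Ck_connection_\<psi>: "Ck_on k (\<lambda>x. connection h' b (\<psi> x)) S"
  by (rule Ck_on_compose[OF src.open_S image_\<psi> smooth_\<psi> dst.Ck_connection])

lemma Ck_pullback_connection: "Ck_on k (pullback_connection i) S"
  unfolding pullback_connection_def
  by (intro Ck_on_sum Ck_on_scaleR Ck_on_nth src.open_S Ck_J Ck_connection_\<psi>)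

lemma partial_pullback_connection:
  assumes x: "x \<in> S"
  shows "partial j (pullback_connection i) x = (\<Sum>b\<in>UNIV. (partial j J x $ b $ i) *\<^sub>R connection h' b (\<psi> x))
    + (\<Sum>b\<in>UNIV. \<Sum>c\<in>UNIV. (J x $ c $ j * J x $ b $ i) *\<^sub>R partial c (connection h' b) (\<psi> x))"
proof -
  have d1: "(\<lambda>y. J y $ b $ i) differentiable (at x)" for b
    by (rule differentiable_bounded_linear[OF bounded_linear_vec_nth2 differentiable_J[OF x]])
  have d2: "(\<lambda>y. connection h' b (\<psi> y)) differentiable (at x)" for b
    by (rule Ck_on_differentiable[OF Ck_connection_\<psi> x])
  show ?thesis
    unfolding pullback_connection_def
    by (simp add: partial_sum differentiable_bounded_bilinear[OF bounded_bilinear_scaleR d1 d2]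
        partial_scaleR[OF d1 d2] partial_nth2[OF differentiable_J[OF x]]
        partial_pullback[OF x dst.differentiable_connection[OF \<psi>_in[OF x]]] sum.distrib scaleR_sum_right mult.commute)
qed

text \<open>Differentiating \<open>connection_change\<close> and antisymmetrising removes the second
  derivatives of \<open>J\<close>, by \<open>gauge_curvature_algebra\<close>. It remains to see that
  the curvature of the pulled back connection is the pulled back curvature.\<close>

lemma curvature_change:
  assumes x: "x \<in> S"
  shows "J x ** curvature h j i x = (\<Sum>c\<in>UNIV. \<Sum>b\<in>UNIV. (J x $ c $ j * J x $ b $ i) *\<^sub>R curvature h' c b (\<psi> x)) ** J x"
proof -
  let ?A = "pullback_connection"
  let ?\<Gamma>' = "\<lambda>b. connection h' b (\<psi> x)" and ?J = "J x"
  have dA: "?A i differentiable (at x)" for i by (rule Ck_on_differentiable[OF Ck_pullback_connection x])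
  note dG = src.differentiable_connection[OF x] and dJ = differentiable_J[OF x]
  have ddJ: "partial i J differentiable (at x)" for i by (rule Ck_on_differentiable[OF Ck_on_partial[OF Ck_J] x])
  have "?J ** (partial j (connection h i) x - partial i (connection h j) x
      + connection h j x ** connection h i x - connection h i x ** connection h j x)
    = (partial j (?A i) x - partial i (?A j) x + ?A j x ** ?A i x - ?A i x ** ?A j x) ** ?J"
  proof (rule gauge_curvature_algebra[where dJ="\<lambda>i. partial i J x" and ddJ="\<lambda>i j. partial i (partial j J) x"])
    show "partial i J x = ?J ** connection h i x - ?A i x ** ?J" for i
      using connection_change[OF x, of i] by (simp add: eq_diff_eq)
    show "partial i (partial j J) x = partial j (partial i J) x"
      by (rule partial_commute_matrix[OF src.open_S x Ck_J])
    fix i j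
    have "partial j (\<lambda>y. partial i J y + ?A i y ** J y) x = partial j (\<lambda>y. J y ** connection h i y) x"
      by (rule partial_cong[OF src.open_S x connection_change])
    then show "partial j (partial i J) x + (?A i x ** partial j J x + partial j (?A i) x ** ?J)
        = ?J ** partial j (connection h i) x + partial j J x ** connection h i x"
      by (simp add: partial_add ddJ partial_matrix_mult[OF dA dJ] partial_matrix_mult[OF dJ dG]
          differentiable_matrix_mult[OF dA dJ])
  qed
  moreover have "partial j (?A i) x - partial i (?A j) x + ?A j x ** ?A i x - ?A i x ** ?A j x
    = (\<Sum>c\<in>UNIV. \<Sum>b\<in>UNIV. (?J $ c $ j * ?J $ b $ i) *\<^sub>R curvature h' c b (\<psi> x))"
  proof -
    have AA: "?A j x ** ?A i x = (\<Sum>c\<in>UNIV. \<Sum>b\<in>UNIV. (?J $ c $ j * ?J $ b $ i) *\<^sub>R (?\<Gamma>' c ** ?\<Gamma>' b))" for i j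
      by (simp add: pullback_connection_def matrix_mult.sum_left matrix_mult.sum_right scaleR_sum_right mult.commute)
        (subst sum.swap, simp add: mult.commute)
    have AA': "?A i x ** ?A j x = (\<Sum>c\<in>UNIV. \<Sum>b\<in>UNIV. (?J $ c $ j * ?J $ b $ i) *\<^sub>R (?\<Gamma>' b ** ?\<Gamma>' c))"
      unfolding AA by (subst sum.swap) (simp add: mult.commute)
    have D: "partial j (?A i) x = (\<Sum>b\<in>UNIV. (partial j J x $ b $ i) *\<^sub>R ?\<Gamma>' b)
      + (\<Sum>c\<in>UNIV. \<Sum>b\<in>UNIV. (?J $ c $ j * ?J $ b $ i) *\<^sub>R partial c (connection h' b) (\<psi> x))"
      unfolding partial_pullback_connection[OF x] by (subst (2) sum.swap) (rule refl)
    \<comment> \<open>Rewritten so that its first sum is literally that of \<open>D\<close>, by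
      symmetry of second derivatives of \<open>\<psi>\<close>; these sums then cancel.\<close>
    have D': "partial i (?A j) x = (\<Sum>b\<in>UNIV. (partial j J x $ b $ i) *\<^sub>R ?\<Gamma>' b)
      + (\<Sum>c\<in>UNIV. \<Sum>b\<in>UNIV. (?J $ c $ j * ?J $ b $ i) *\<^sub>R partial b (connection h' c) (\<psi> x))"
      unfolding partial_pullback_connection[OF x] by (simp add: partial_J_swap[OF x, of i] mult.commute)
    show ?thesis unfolding AA[of j i] AA' D D' dst.curvature_eq[OF \<psi>_in[OF x]]
      by (simp add: scaleR_add_right scaleR_diff_right sum.distrib sum_subtractf)
  qed
  ultimately show ?thesis unfolding src.curvature_eq[OF x] by metis
qed

lemma ricci_change:
  assumes x: "x \<in> S"
  shows "ricci h x = transpose (J x) ** ricci h' (\<psi> x) ** J x"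
proof -
  let ?J = "J x" and ?I = "matrix_inv (J x)" and ?U = "UNIV :: 'n set"
  let ?F = "\<lambda>c b. curvature h' c b (\<psi> x) ** ?J"
  have F: "curvature h i j x $ i $ k = (\<Sum>a\<in>?U. \<Sum>c\<in>?U. \<Sum>b\<in>?U. ?I $ i $ a * (?J $ c $ i * ?J $ b $ j * ?F c b $ a $ k))" for i j k
  proof -
    have "curvature h i j x = ?I ** (?J ** curvature h i j x)" by (simp add: matrix_mul_assoc x)
    also have "\<dots> = ?I ** (\<Sum>c\<in>?U. \<Sum>b\<in>?U. (?J $ c $ i * ?J $ b $ j) *\<^sub>R ?F c b)"
      by (simp add: curvature_change[OF x] matrix_mult.sum_left)
    finally show ?thesis by (simp add: matrix_matrix_mult_def[of ?I] sum_distrib_left)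
  qed
  have JI: "(\<Sum>i\<in>?U. ?J $ c $ i * ?I $ i $ a) = (if c = a then 1 else 0)" for c a
    using arg_cong[OF J_inverse(1)[OF x], of "\<lambda>M. M $ c $ a"] by (simp add: matrix_matrix_mult_def mat_def)
  have "ricci h x $ j $ k = (transpose ?J ** ricci h' (\<psi> x) ** ?J) $ j $ k" for j k
  proof -
    \<comment> \<open>The sum over the traced index \<open>i\<close> is moved innermost, where
      \<open>J\<close> and its inverse collapse to a Kronecker delta.\<close>
    have "ricci h x $ j $ k = (\<Sum>i\<in>?U. \<Sum>a\<in>?U. \<Sum>c\<in>?U. \<Sum>b\<in>?U. ?I $ i $ a * (?J $ c $ i * ?J $ b $ j * ?F c b $ a $ k))"
      by (simp add: src.ricci_nth F)
    also have "\<dots> = (\<Sum>a\<in>?U. \<Sum>i\<in>?U. \<Sum>c\<in>?U. \<Sum>b\<in>?U. ?I $ i $ a * (?J $ c $ i * ?J $ b $ j * ?F c b $ a $ k))"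
      by (rule sum.swap)
    also have "\<dots> = (\<Sum>a\<in>?U. \<Sum>c\<in>?U. \<Sum>i\<in>?U. \<Sum>b\<in>?U. ?I $ i $ a * (?J $ c $ i * ?J $ b $ j * ?F c b $ a $ k))"
      by (intro sum.cong[OF refl] sum.swap)
    also have "\<dots> = (\<Sum>a\<in>?U. \<Sum>c\<in>?U. \<Sum>b\<in>?U. \<Sum>i\<in>?U. ?I $ i $ a * (?J $ c $ i * ?J $ b $ j * ?F c b $ a $ k))"
      by (intro sum.cong[OF refl] sum.swap)
    also have "\<dots> = (\<Sum>a\<in>?U. \<Sum>c\<in>?U. \<Sum>b\<in>?U. (\<Sum>i\<in>?U. ?J $ c $ i * ?I $ i $ a) * (?J $ b $ j * ?F c b $ a $ k))"
      by (simp add: sum_distrib_left sum_distrib_right mult_ac)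
    also have "\<dots> = (\<Sum>a\<in>?U. \<Sum>b\<in>?U. ?J $ b $ j * ?F a b $ a $ k)"
      unfolding JI sum_distrib_left[symmetric] by (simp add: mult_delta_left)
    also have "\<dots> = (\<Sum>b\<in>?U. ?J $ b $ j * (\<Sum>a\<in>?U. ?F a b $ a $ k))"
      by (subst sum.swap) (simp add: sum_distrib_left)
    also have "\<dots> = (\<Sum>b\<in>?U. ?J $ b $ j * (ricci h' (\<psi> x) ** ?J) $ b $ k)"
    proof -
      have "(\<Sum>a\<in>?U. ?F a b $ a $ k) = (ricci h' (\<psi> x) ** ?J) $ b $ k" for b
        unfolding matrix_matrix_mult_def by (simp add: dst.ricci_nth sum_distrib_right) (rule sum.swap)
      then show ?thesis by simp
    qed
    also have "\<dots> = (transpose ?J ** (ricci h' (\<psi> x) ** ?J)) $ j $ k"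
      unfolding matrix_matrix_mult_def[of "transpose ?J"] by (simp add: transpose_def)
    finally show ?thesis by (simp add: matrix_mul_assoc)
  qed
  then show ?thesis by (simp add: vec_eq_iff)
qed

lemma matrix_inv_change:
  assumes x: "x \<in> S"
  shows "J x ** matrix_inv (h x) ** transpose (J x) = matrix_inv (h' (\<psi> x))"
proof -
  let ?J = "J x" and ?H = "h' (\<psi> x)" and ?G = "matrix_inv (h x)"
  have "?J ** (?G ** (transpose ?J ** ?H ** ?J)) = ?J"
    using src.G_h[OF x] by (simp add: h_eq[OF x, symmetric])
  then have "(?J ** ?G ** transpose ?J ** ?H) ** ?J ** matrix_inv ?J = ?J ** matrix_inv ?J"
    by (simp add: matrix_mul_assoc)
  then have "?J ** ?G ** transpose ?J ** ?H = mat 1"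
    by (simp add: matrix_mul_assoc[symmetric] x)
  then have "?J ** ?G ** transpose ?J ** ?H ** matrix_inv ?H = matrix_inv ?H" by simp
  then show ?thesis by (simp add: matrix_mul_assoc[symmetric] \<psi>_in[OF x])
qed

lemma ricci_op_change:
  assumes x: "x \<in> S"
  shows "J x ** src.ricci_op x = dst.ricci_op (\<psi> x) ** J x"
  unfolding src.ricci_op_def dst.ricci_op_def ricci_change[OF x] matrix_inv_change[OF x, symmetric]
  by (simp add: matrix_mul_assoc)

lemma trace_change:
  assumes "x \<in> S" "J x ** M = N ** J x"
  shows "trace M = trace N"
proof -
  have "M = matrix_inv (J x) ** (N ** J x)" using assms by (simp add: assms(2)[symmetric] matrix_mul_assoc)
  then have "trace M = trace ((N ** J x) ** matrix_inv (J x))" by (metis trace_mul_sym)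
  then show ?thesis using assms(1) by (simp add: matrix_mul_assoc[symmetric])
qed

lemma scal_change: "x \<in> S \<Longrightarrow> scal h x = scal h' (\<psi> x)"
  using trace_change[OF _ ricci_op_change] by (simp add: src.scal_eq_trace dst.scal_eq_trace \<psi>_in)

text \<open>Differentiating \<open>V' (\<psi> y) = J y *v V y\<close> produces a derivative of
  \<open>J\<close>, which is exactly the inhomogeneous term of
  \<open>connection_change\<close>.\<close>

lemma covariant_derivative_change:
  assumes x: "x \<in> S" and V: "V differentiable (at x)" and V': "V' differentiable (at (\<psi> x))"
    and e: "\<And>y. y \<in> S \<Longrightarrow> V' (\<psi> y) = J y *v V y"
  shows "J x ** covariant_derivative h V x = covariant_derivative h' V' (\<psi> x) ** J x"
proof -
  let ?U = "UNIV :: 'n set"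
  have "(J x ** covariant_derivative h V x) $ a $ i = (covariant_derivative h' V' (\<psi> x) ** J x) $ a $ i" for a i
  proof -
    have "partial i (\<lambda>y. V' (\<psi> y)) x = partial i (\<lambda>y. J y *v V y) x"
      by (rule partial_cong[OF src.open_S x e])
    then have d: "(\<Sum>b\<in>?U. (J x $ b $ i) *\<^sub>R partial b V' (\<psi> x)) = J x *v partial i V x + partial i J x *v V x"
      by (simp add: partial_pullback[OF x V'] partial_matrix_vector_mult[OF differentiable_J[OF x] V])
    have "(covariant_derivative h' V' (\<psi> x) ** J x) $ a $ i
      = (\<Sum>b\<in>?U. (J x $ b $ i) *\<^sub>R partial b V' (\<psi> x)) $ a + (pullback_connection i x *v V' (\<psi> x)) $ a"
      by (simp add: matrix_matrix_mult_def dst.covariant_derivative_nth[OF V'] pullback_connection_def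
          distrib_left distrib_right sum.distrib mult.commute linear_sum[OF matrix_vector_mul_linear]
          bounded_bilinear.sum_left[OF bounded_bilinear_matrix_vector_mult] scaleR_matrix_vector_assoc[symmetric])
    also have "\<dots> = (J x *v partial i V x + (partial i J x + pullback_connection i x ** J x) *v V x) $ a"
      unfolding d e[OF x] by (simp add: matrix_vector_mult_add_rdistrib matrix_vector_mul_assoc)
    also have "\<dots> = (J x *v (partial i V x + connection h i x *v V x)) $ a"
      unfolding connection_change[OF x] by (simp add: matrix_vector_right_distrib matrix_vector_mul_assoc)
    also have "\<dots> = (J x ** covariant_derivative h V x) $ a $ i"
      unfolding matrix_vector_mult_def[of "J x"] matrix_matrix_mult_def[of "J x"]
      by (simp only: vec_lambda_beta src.covariant_derivative_nth[OF V])
    finally show ?thesis by simp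
  qed
  then show ?thesis by (simp add: vec_eq_iff)
qed

lemma divergence_change:
  assumes "x \<in> S" "V differentiable (at x)" "V' differentiable (at (\<psi> x))"
    and "\<And>y. y \<in> S \<Longrightarrow> V' (\<psi> y) = J y *v V y"
  shows "divergence h V x = divergence h' V' (\<psi> x)"
  unfolding divergence_def by (rule trace_change[OF assms(1) covariant_derivative_change[OF assms]])

lemma volume_density_change: 
  assumes x: "x \<in> S" shows "src.volume_density x = \<bar>det (J x)\<bar> * dst.volume_density (\<psi> x)"
proof -
  have "det (h x) = (det (J x))\<^sup>2 * det (h' (\<psi> x))"
    by (simp add: h_eq[OF x] det_mul power2_eq_square)
  then show ?thesis by (simp add: src.volume_density_def dst.volume_density_def real_sqrt_mult)
qed

end

text \<open>Orthonormal sets are independent, so their size is bounded by the dimension and a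
  largest one exists. A vector not recovered by its expansion would leave a nonzero orthogonal
  remainder, whose normalisation could be added.\<close>

lemma ex_orthonormal_frame:
  fixes H :: "real^'n::finite^'n"
  assumes sym: "transpose H = H" and pos: "\<And>v. v \<noteq> 0 \<Longrightarrow> v \<bullet> (H *v v) > 0"
  obtains B where "finite B" "\<And>v. v = (\<Sum>b\<in>B. (b \<bullet> (H *v v)) *\<^sub>R b)"
proof -
  define orth where "orth B \<longleftrightarrow> finite B \<and> (\<forall>b\<in>B. \<forall>c\<in>B. b \<bullet> (H *v c) = (if b = c then 1 else 0))" for B :: "(real^'n) set"
  have expand: "c \<bullet> (H *v (\<Sum>b\<in>B. f b *\<^sub>R b)) = f c" if "orth B" "c \<in> B" for B c f
  proof -
    have "c \<bullet> (H *v (\<Sum>b\<in>B. f b *\<^sub>R b)) = (\<Sum>b\<in>B. f b * (c \<bullet> (H *v b)))"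
      by (simp add: linear_sum[OF matrix_vector_mul_linear] matrix_vector_mult_scaleR inner_sum_right)
    also have "\<dots> = (\<Sum>b\<in>B. if b = c then f b else 0)"
      using that by (intro sum.cong) (auto simp: orth_def)
    finally show ?thesis using that by (simp add: orth_def)
  qed
  have card: "card B < Suc (DIM(real^'n))" if "orth B" for B
  proof -
    have "independent B"
    proof (rule independent_if_scalars_zero)
      show "finite B" using that by (simp add: orth_def)
      fix f c assume "(\<Sum>b\<in>B. f b *\<^sub>R b) = 0" "c \<in> B"
      then show "f c = 0" using expand[OF that, of c f] by simp
    qed
    then show ?thesis using independent_bound[of B] by (simp add: less_Suc_eq_le)
  qed
  have "orth {}" by (simp add: orth_def)
  then obtain B where B: "orth B" and max: "\<And>C. orth C \<Longrightarrow> card C \<le> card B"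
    using ex_has_greatest_nat[of orth "{}" card] card by (metis less_Suc_eq_le less_imp_le)
  have symm: "v \<bullet> (H *v w) = w \<bullet> (H *v v)" for v w
    using sym by (metis dot_lmul_matrix inner_commute transpose_matrix_vector)
  show ?thesis
  proof (rule that)
    show fin: "finite B" using B by (simp add: orth_def)
    fix v
    define w where "w = v - (\<Sum>b\<in>B. (b \<bullet> (H *v v)) *\<^sub>R b)"
    have w: "c \<bullet> (H *v w) = 0" if "c \<in> B" for c
      unfolding w_def matrix_vector_mult_diff_distrib inner_diff_right expand[OF B that] by simp
    have "w = 0"
    proof (rule ccontr)
      assume nz: "w \<noteq> 0"
      let ?n = "sqrt (w \<bullet> (H *v w))"
      define u where "u = inverse ?n *\<^sub>R w"
      have n: "?n > 0" "?n * ?n = w \<bullet> (H *v w)" using pos[OF nz] by simp_all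
      have u: "u \<bullet> (H *v u) = 1"
        using n by (simp add: u_def matrix_vector_mult_scaleR field_simps)
      have uB: "c \<bullet> (H *v u) = 0" "u \<bullet> (H *v c) = 0" if "c \<in> B" for c
        using w[OF that] symm[of u c] by (simp_all add: u_def matrix_vector_mult_scaleR)
      have notin: "u \<notin> B" using u uB(1)[of u] by auto
      have "orth (insert u B)"
        using B u uB notin unfolding orth_def by auto
      then show False using max[of "insert u B"] fin notin by simp
    qed
    then show "v = (\<Sum>b\<in>B. (b \<bullet> (H *v v)) *\<^sub>R b)" by (simp add: w_def)
  qed
qed

text \<open>For \<open>N\<close> skew with respect to \<open>H\<close>, \<open>- trace (N ** N)\<close> is the squared norm of \<open>N\<close>.\<close>

lemma trace_square_skew:
  fixes H N :: "real^'n::finite^'n"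
  assumes sym: "transpose H = H" and pos: "\<And>v. v \<noteq> 0 \<Longrightarrow> v \<bullet> (H *v v) > 0"
    and skew: "transpose (H ** N) = - (H ** N)"
  shows "trace (N ** N) \<le> 0" and "trace (N ** N) = 0 \<Longrightarrow> N = 0"
proof -
  obtain B where B: "finite B" "\<And>v. v = (\<Sum>b\<in>B. (b \<bullet> (H *v v)) *\<^sub>R b)"
    using ex_orthonormal_frame[OF sym pos] by blast
  \<comment> \<open>Expanding the columns in the frame turns the coordinate trace into a trace over
    the frame; skewness then moves one factor \<open>N\<close> across the inner product with a
    sign.\<close>
  have "(N ** N) $ i $ j = (\<Sum>b\<in>B. b $ i * (b \<bullet> (H *v ((N ** N) *v axis j 1))))" for i j
    using arg_cong[OF B(2)[of "(N ** N) *v axis j 1"], of "\<lambda>v. v $ i"]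
    by (simp add: matrix_vector_mult_basis column_def mult.commute)
  then have "trace (N ** N) = (\<Sum>i\<in>UNIV. \<Sum>b\<in>B. b $ i * (b \<bullet> (H *v ((N ** N) *v axis i 1))))"
    by (simp add: trace_def)
  also have "\<dots> = (\<Sum>b\<in>B. \<Sum>i\<in>UNIV. b $ i * (b \<bullet> (H *v ((N ** N) *v axis i 1))))"
    by (rule sum.swap)
  also have "\<dots> = (\<Sum>b\<in>B. - ((N *v b) \<bullet> (H *v (N *v b))))"
  proof (rule sum.cong[OF refl])
    fix b
    have "(\<Sum>i\<in>UNIV. b $ i * (b \<bullet> (H *v ((N ** N) *v axis i 1)))) = b \<bullet> (H *v ((N ** N) *v (\<Sum>i\<in>UNIV. (b $ i) *\<^sub>R axis i 1)))"
      by (simp add: linear_sum[OF matrix_vector_mul_linear] matrix_vector_mult_scaleR inner_sum_right)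
    also have "(\<Sum>i\<in>UNIV. (b $ i) *\<^sub>R axis i 1) = b"
      using basis_expansion[of b] by (simp add: scalar_mult_eq_scaleR)
    also have "b \<bullet> (H *v ((N ** N) *v b)) = b \<bullet> ((H ** N) *v (N *v b))"
      by (simp add: matrix_vector_mul_assoc matrix_mul_assoc)
    also have "\<dots> = (transpose (H ** N) *v b) \<bullet> (N *v b)"
      by (simp only: transpose_matrix_vector dot_lmul_matrix)
    also have "\<dots> = - ((N *v b) \<bullet> (H *v (N *v b)))"
      unfolding skew bounded_bilinear.minus_left[OF bounded_bilinear_matrix_vector_mult]
      by (simp add: matrix_vector_mul_assoc inner_commute)
    finally show "(\<Sum>i\<in>UNIV. b $ i * (b \<bullet> (H *v ((N ** N) *v axis i 1)))) = - ((N *v b) \<bullet> (H *v (N *v b)))" .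
  qed
  finally have tr: "trace (N ** N) = (\<Sum>b\<in>B. - ((N *v b) \<bullet> (H *v (N *v b))))" .
  have nonneg: "0 \<le> v \<bullet> (H *v v)" for v
    using pos[of v] by (cases "v = 0") auto
  show "trace (N ** N) \<le> 0" unfolding tr using nonneg by (simp add: sum_nonpos)
  assume "trace (N ** N) = 0"
  then have "\<forall>b\<in>B. (N *v b) \<bullet> (H *v (N *v b)) = 0"
    unfolding tr sum_negf using sum_nonneg_eq_0_iff[OF B(1), of "\<lambda>b. (N *v b) \<bullet> (H *v (N *v b))"] nonneg by auto
  then have Nb: "N *v b = 0" if "b \<in> B" for b using pos[of "N *v b"] that by force
  have "N *v v = 0" for v
  proof -
    have "N *v v = N *v (\<Sum>b\<in>B. (b \<bullet> (H *v v)) *\<^sub>R b)" using B(2) by metis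
    also have "\<dots> = 0"
      by (simp add: linear_sum[OF matrix_vector_mul_linear] matrix_vector_mult_scaleR Nb)
    finally show ?thesis .
  qed
  then show "N = 0" by (simp add: matrix_eq)
qed

section \<open>Change of variables and integration by parts\<close>

text \<open>The change of variables theorem of the library needs a wellordered index type. An arbitrary
  finite index type is transported to the following wellordered copy of it.\<close>

typedef 'n ordered_index = "{..<CARD('n::finite)}"
  by (rule exI[of _ 0]) simp

instantiation ordered_index :: (finite) wellorder
begin

definition "a \<le> b \<longleftrightarrow> Rep_ordered_index a \<le> Rep_ordered_index b"
definition "a < b \<longleftrightarrow> Rep_ordered_index a < Rep_ordered_index b"

instance
proof
  fix P :: "'a ordered_index \<Rightarrow> bool" and a
  assume step: "\<And>x. (\<And>y. y < x \<Longrightarrow> P y) \<Longrightarrow> P x"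
  show "P a"
  proof (induction a rule: measure_induct_rule[of Rep_ordered_index])
    case (less x)
    show ?case by (rule step) (rule less, simp add: less_ordered_index_def)
  qed
next
  fix a b :: "'a ordered_index"
  assume "a \<le> b" "b \<le> a"
  then have "Rep_ordered_index a = Rep_ordered_index b" by (simp add: less_eq_ordered_index_def)
  then show "a = b" by (simp only: Rep_ordered_index_inject)
qed (auto simp: less_eq_ordered_index_def less_ordered_index_def)

end

instance ordered_index :: (finite) finite
proof
  have "(UNIV :: 'a ordered_index set) = Abs_ordered_index ` {..<CARD('a)}"
    using type_definition.univ[OF type_definition_ordered_index] .
  then show "finite (UNIV :: 'a ordered_index set)" by (metis finite_imageI finite_lessThan)
qed

lemma ex_bij_ordered_index: "\<exists>e :: 'n::finite ordered_index \<Rightarrow> 'n. bij e"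
proof -
  have "bij_betw Rep_ordered_index (UNIV :: 'n ordered_index set) {..<CARD('n)}"
    unfolding bij_betw_def
    by (simp add: inj_on_def Rep_ordered_index_inject type_definition.Rep_range[OF type_definition_ordered_index])
  then have "card (UNIV :: 'n ordered_index set) = CARD('n)" by (simp add: bij_betw_same_card)
  then show ?thesis by (simp add: finite_same_card_bij)
qed

text \<open>Conjugation by a bijection turns a transposition into the transposition of the images,
  so induction over products of transpositions applies even though the two index types
  differ.\<close>

lemma sign_conj_bij:
  fixes e :: "'m::finite \<Rightarrow> 'n::finite"
  assumes e: "bij e" and p: "p permutes UNIV"
  shows "sign (e \<circ> p \<circ> inv e) = sign p"
  using p finite
proof (induction rule: permutes_induct)
  case id
  have "e \<circ> id \<circ> inv e = id" using bij_is_surj[OF e] unfolding surj_iff by simp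
  then show ?case by (simp only: sign_id)
next
  case (swap a b p)
  have "bij (e \<circ> p \<circ> inv e)"
    using e permutes_bij[OF swap.hyps(4)] by (auto intro!: bij_comp bij_imp_bij_inv)
  then have "(e \<circ> p \<circ> inv e) permutes UNIV" by (intro bij_imp_permutes) auto
  then have perm: "permutation (e \<circ> p \<circ> inv e)" "permutation p"
    using swap.hyps(4) by (auto simp: permutation_permutes)
  have eq: "e \<circ> (Transposition.transpose a b \<circ> p) \<circ> inv e
      = Transposition.transpose (e a) (e b) \<circ> (e \<circ> p \<circ> inv e)"
    using bij_is_inj[OF e] by (auto simp: fun_eq_iff Transposition.transpose_def inj_eq)
  have ne: "e a \<noteq> e b" using swap.hyps(3) bij_is_inj[OF e] by (simp add: inj_eq)
  show ?case
    unfolding eq sign_compose[OF permutation_swap_id perm(1)] sign_compose[OF permutation_swap_id perm(2)]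
      swap.IH sign_swap_id using ne swap.hyps(3) by simp
qed

lemma det_reindex:
  fixes e :: "'m::finite \<Rightarrow> 'n::finite" and A :: "real^'n^'n"
  assumes e: "bij e"
  shows "det (\<chi> i j. A $ e i $ e j) = det A"
proof -
  have conj: "(f \<circ> p \<circ> inv f) permutes UNIV" if "bij f" "p permutes UNIV" for p and f :: "'x::finite \<Rightarrow> 'y::finite"
    using that permutes_bij[OF that(2)] by (intro bij_imp_permutes) (auto intro!: bij_comp bij_imp_bij_inv)
  have ie: "inv (inv e) = e" "\<And>x. inv e (e x) = x" "\<And>y. e (inv e y) = y"
    using e by (simp_all add: inv_inv_eq bij_is_inj bij_is_surj surj_f_inv_f)
  show ?thesis unfolding det_def
  proof (rule sum.reindex_bij_witness[where i="\<lambda>q. inv e \<circ> q \<circ> e" and j="\<lambda>p. e \<circ> p \<circ> inv e"])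
    fix p :: "'m \<Rightarrow> 'm" assume p: "p \<in> {p. p permutes UNIV}"
    then show "e \<circ> p \<circ> inv e \<in> {p. p permutes UNIV}" using conj[OF e] by simp
    have "(\<Prod>i\<in>UNIV. A $ i $ (e \<circ> p \<circ> inv e) i) = (\<Prod>i\<in>UNIV. A $ e i $ (e \<circ> p \<circ> inv e) (e i))"
      by (rule prod.reindex_bij_betw[OF e, symmetric])
    then show "of_int (sign (e \<circ> p \<circ> inv e)) * (\<Prod>i\<in>UNIV. A $ i $ (e \<circ> p \<circ> inv e) i)
      = of_int (sign p) * (\<Prod>i\<in>UNIV. (\<chi> i j. A $ e i $ e j) $ i $ p i)"
      using sign_conj_bij[OF e] p by (simp add: ie)
  next
    fix q :: "'n \<Rightarrow> 'n" assume "q \<in> {p. p permutes UNIV}"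
    then show "inv e \<circ> q \<circ> e \<in> {p. p permutes UNIV}"
      using conj[of "inv e" q] e by (simp add: ie bij_imp_bij_inv)
  qed (auto simp: fun_eq_iff ie)
qed

lemma prod_Basis_vec: "(\<Prod>b\<in>(Basis :: (real^'n::finite) set). x \<bullet> b) = (\<Prod>i\<in>UNIV. x $ i)"
proof -
  have B: "(Basis :: (real^'n) set) = (\<lambda>i. axis i 1) ` UNIV"
    by (auto simp: Basis_vec_def)
  have "inj (\<lambda>i::'n. axis i (1::real))" by (auto simp: inj_def axis_eq_axis)
  then show ?thesis unfolding B by (simp add: prod.reindex inner_axis)
qed

definition reindex :: "('m \<Rightarrow> 'n) \<Rightarrow> real^'n::finite \<Rightarrow> real^'m::finite" where
  "reindex e x = (\<chi> i. x $ e i)"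

lemma bounded_linear_reindex: "bounded_linear (reindex e)"
  by (intro linear_conv_bounded_linear[THEN iffD1] linearI) (auto simp: reindex_def vec_eq_iff)

lemma reindex_reindex: "bij e \<Longrightarrow> reindex e (reindex (inv e) x) = x"
  "bij e \<Longrightarrow> reindex (inv e) (reindex e y) = y"
  by (simp_all add: reindex_def vec_eq_iff bij_is_inj bij_is_surj surj_f_inv_f)

lemma measurable_reindex [measurable]: "reindex e \<in> borel_measurable borel"
  by (intro borel_measurable_continuous_onI linear_continuous_on bounded_linear_reindex)

lemma distr_reindex:
  fixes e :: "'m::finite \<Rightarrow> 'n::finite"
  assumes e: "bij e"
  shows "distr lborel borel (reindex e :: real^'n \<Rightarrow> real^'m) = lborel"
proof (rule lborel_eqI[symmetric])
  fix l u :: "real^'m" assume le: "\<And>b. b \<in> Basis \<Longrightarrow> l \<bullet> b \<le> u \<bullet> b"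
  have lu: "l $ i \<le> u $ i" for i using le[of "axis i 1"] by (simp add: inner_axis axis_in_Basis_iff)
  let ?r = "reindex (inv e) :: real^'m \<Rightarrow> real^'n"
  have "reindex e -` box l u = box (?r l) (?r u)"
  proof -
    have "(\<forall>i. l $ i < x $ e i \<and> x $ e i < u $ i) \<longleftrightarrow> (\<forall>k. l $ inv e k < x $ k \<and> x $ k < u $ inv e k)" for x :: "real^'n"
      by (metis e bij_inv_eq_iff)
    then show ?thesis by (auto simp: mem_box_cart reindex_def)
  qed
  then have "emeasure (distr lborel borel (reindex e)) (box l u) = emeasure lborel (box (?r l) (?r u))"
    by (simp add: emeasure_distr)
  also have "\<dots> = (\<Prod>b\<in>Basis. (?r u - ?r l) \<bullet> b)"
    by (rule emeasure_lborel_box) (use lu in \<open>auto simp: Basis_vec_def inner_axis reindex_def\<close>)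
  also have "(\<Prod>b\<in>Basis. (?r u - ?r l) \<bullet> b) = (\<Prod>b\<in>Basis. (u - l) \<bullet> b)"
    unfolding prod_Basis_vec using prod.reindex_bij_betw[OF e, of "\<lambda>k. (?r u - ?r l) $ k"] e
    by (simp add: reindex_def bij_is_inj)
  finally show "emeasure (distr lborel borel (reindex e)) (box l u) = (\<Prod>b\<in>Basis. (u - l) \<bullet> b)" .
qed simp

text \<open>Translates between nonnegative Lebesgue integrals, which may be infinite, and the gauge
  integral with absolute integrability, in whose terms the change of variables theorem is
  phrased.\<close>

lemma set_nn_integral_eq_integral:
  fixes F :: "'a::euclidean_space \<Rightarrow> real"
  assumes m: "(\<lambda>x. indicator S x * F x) \<in> borel_measurable borel" and nn: "\<And>x. x \<in> S \<Longrightarrow> 0 \<le> F x"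
  shows "(\<integral>\<^sup>+x\<in>S. F x \<partial>lborel) = (if F absolutely_integrable_on S then ennreal (integral S F) else \<infinity>)"
proof (cases "F absolutely_integrable_on S")
  case True
  then have "(F has_integral integral S F) S"
    by (simp add: absolutely_integrable_on_def has_integral_integral)
  from nn_integral_has_integral_lebesgue'[OF nn this] True show ?thesis by simp
next
  case False
  have "(\<integral>\<^sup>+x\<in>S. F x \<partial>lborel) = \<infinity>"
  proof (rule ccontr)
    assume "\<not> ?thesis"
    then have fin: "(\<integral>\<^sup>+x\<in>S. F x \<partial>lborel) < \<infinity>" by (simp add: less_top)
    have "(\<integral>\<^sup>+x\<in>S. F x \<partial>lborel) = (\<integral>\<^sup>+x. ennreal (indicator S x * F x) \<partial>lborel)"
      by (intro nn_integral_cong) (auto simp: indicator_def)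
    then have "(\<lambda>x. indicator S x * F x) integrable_on UNIV"
      using fin nn by (intro nn_integral_integrable_on m) (auto simp: indicator_def)
    moreover have "(\<lambda>x. indicator S x * F x) = (\<lambda>x. if x \<in> S then F x else 0)"
      by (auto simp: indicator_def)
    ultimately have "F integrable_on S" by (simp add: integrable_restrict_UNIV)
    then have "F absolutely_integrable_on S" using absolutely_integrable_on_iff_nonneg[of S F] nn by simp
    with False show False by (rule notE)
  qed
  then show ?thesis using False by simp
qed

lemma nn_integral_change_of_variables_wellorder:
  fixes \<psi> :: "real^'n::{finite,wellorder} \<Rightarrow> real^'n::_" and f :: "real^'n::_ \<Rightarrow> real"
  assumes X: "X \<in> sets borel" and d: "\<And>x. x \<in> X \<Longrightarrow> (\<psi> has_derivative \<psi>' x) (at x)" and inj: "inj_on \<psi> X"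
    and f: "(\<lambda>x. indicator (\<psi> ` X) x * f x) \<in> borel_measurable borel" "\<And>x. 0 \<le> f x"
    and m: "(\<lambda>x. indicator X x * (\<bar>det (matrix (\<psi>' x))\<bar> * f (\<psi> x))) \<in> borel_measurable borel"
  shows "(\<integral>\<^sup>+y\<in>\<psi> ` X. f y \<partial>lborel) = (\<integral>\<^sup>+x\<in>X. \<bar>det (matrix (\<psi>' x))\<bar> * f (\<psi> x) \<partial>lborel)"
proof -
  let ?F = "\<lambda>x. \<bar>det (matrix (\<psi>' x))\<bar> * f (\<psi> x)"
  have X': "X \<in> sets lebesgue" using X by simp
  have d': "\<And>x. x \<in> X \<Longrightarrow> (\<psi> has_derivative \<psi>' x) (at x within X)"
    using d has_derivative_at_withinI by blast
  \<comment> \<open>The theorem speaks of vector-valued integrands, so \<open>f\<close> is encoded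
    with values in \<open>real^1\<close>. The free value \<open>b\<close> yields both the
    equivalence of integrability and the equality of the integrals.\<close>
  have iff: "?F absolutely_integrable_on X \<and> integral X ?F = b
    \<longleftrightarrow> f absolutely_integrable_on \<psi> ` X \<and> integral (\<psi> ` X) f = b" for b
    using has_absolute_integral_change_of_variables[OF X' d' inj, of "\<lambda>x. vec (f x) :: real^1" "vec b"]
    by (simp add: absolutely_integrable_on_1_iff integral_on_1_eq)
  have "?F absolutely_integrable_on X \<longleftrightarrow> f absolutely_integrable_on \<psi> ` X" using iff by blast
  moreover have "integral X ?F = integral (\<psi> ` X) f" if "?F absolutely_integrable_on X"
    using iff that by blast
  ultimately show ?thesis
    unfolding set_nn_integral_eq_integral[OF f] by (subst set_nn_integral_eq_integral[OF m]) (auto simp: f)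
qed

text \<open>The wellordered case is conjugated with a permutation of coordinates, which preserves
  Lebesgue measure (\<open>distr_reindex\<close>) and the Jacobian determinant
  (\<open>det_reindex\<close>).\<close>

lemma nn_integral_change_of_variables:
  fixes \<psi> :: "real^'n::finite \<Rightarrow> real^'n" and f :: "real^'n \<Rightarrow> real"
  assumes X: "X \<in> sets borel" and d: "\<And>x. x \<in> X \<Longrightarrow> (\<psi> has_derivative \<psi>' x) (at x)" and inj: "inj_on \<psi> X"
    and f: "(\<lambda>x. indicator (\<psi> ` X) x * f x) \<in> borel_measurable borel" "\<And>x. 0 \<le> f x"
    and m: "(\<lambda>x. indicator X x * (\<bar>det (matrix (\<psi>' x))\<bar> * f (\<psi> x))) \<in> borel_measurable borel"
  shows "(\<integral>\<^sup>+y\<in>\<psi> ` X. f y \<partial>lborel) = (\<integral>\<^sup>+x\<in>X. \<bar>det (matrix (\<psi>' x))\<bar> * f (\<psi> x) \<partial>lborel)"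
proof -
  obtain e :: "'n ordered_index \<Rightarrow> 'n" where e: "bij e" using ex_bij_ordered_index by blast
  let ?r = "reindex e :: real^'n \<Rightarrow> real^'n ordered_index" and ?s = "reindex (inv e) :: real^'n ordered_index \<Rightarrow> real^'n"
  have rs [simp]: "?r (?s y) = y" "?s (?r x) = x" for x y using reindex_reindex[OF e] by auto
  let ?X = "?s -` X" and ?\<psi> = "\<lambda>y. ?r (\<psi> (?s y))" and ?\<psi>' = "\<lambda>y v. ?r (\<psi>' (?s y) (?s v))"
  have ms: "?s \<in> borel_measurable borel" by simp
  have X': "?X \<in> sets borel" using measurable_sets[OF ms X] by simp
  have d': "(?\<psi> has_derivative ?\<psi>' y) (at y)" if "y \<in> ?X" for y
  proof -
    have "(?s has_derivative ?s) (at y)" by (rule bounded_linear_imp_has_derivative[OF bounded_linear_reindex])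
    from has_derivative_compose[OF this d] that
    have "((\<lambda>y. \<psi> (?s y)) has_derivative (\<lambda>v. \<psi>' (?s y) (?s v))) (at y)" by simp
    from bounded_linear.has_derivative[OF bounded_linear_reindex this] show ?thesis .
  qed
  have inj': "inj_on ?\<psi> ?X"
  proof (rule inj_onI)
    fix y z assume yz: "y \<in> ?X" "z \<in> ?X" and e: "?\<psi> y = ?\<psi> z"
    have "\<psi> (?s y) = \<psi> (?s z)" using arg_cong[OF e, of ?s] by simp
    with yz have "?s y = ?s z" using inj by (auto dest: inj_onD)
    from arg_cong[OF this, of ?r] show "y = z" by simp
  qed
  have im: "?\<psi> ` ?X = ?s -` (\<psi> ` X)"
  proof (intro equalityI subsetI)
    fix y assume "y \<in> ?s -` (\<psi> ` X)"
    then obtain x where x: "x \<in> X" "?s y = \<psi> x" by auto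
    have "y = ?\<psi> (?r x)" by (simp add: x(2)[symmetric])
    moreover have "?r x \<in> ?X" using x(1) by simp
    ultimately show "y \<in> ?\<psi> ` ?X" by (rule image_eqI)
  qed auto
  have det: "det (matrix (?\<psi>' y)) = det (matrix (\<psi>' (?s y)))" for y
  proof -
    have "?s (axis j 1) = axis (e j) 1" for j
    proof -
      have "inv e k = j \<longleftrightarrow> k = e j" for k using bij_inv_eq_iff[OF e] by metis
      then show ?thesis by (simp add: reindex_def vec_eq_iff axis_def)
    qed
    then have "matrix (?\<psi>' y) = (\<chi> i j. matrix (\<psi>' (?s y)) $ e i $ e j)"
      by (simp add: matrix_def vec_eq_iff reindex_def)
    then show ?thesis using det_reindex[OF e] by simp
  qed
  have tr: "(\<integral>\<^sup>+y. F (?s y) \<partial>lborel) = (\<integral>\<^sup>+x. F x \<partial>lborel)" if "F \<in> borel_measurable borel" for F :: "real^'n \<Rightarrow> ennreal"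
  proof -
    have "(\<integral>\<^sup>+x. F x \<partial>lborel) = (\<integral>\<^sup>+x. F x \<partial>distr lborel borel ?s)"
      by (simp add: distr_reindex[OF bij_imp_bij_inv[OF e]])
    also have "\<dots> = (\<integral>\<^sup>+y. F (?s y) \<partial>lborel)"
      by (rule nn_integral_distr) (use that in auto)
    finally show ?thesis by simp
  qed
  have ind: "ennreal (indicator S x * r) = ennreal r * indicator S x" for S :: "'b set" and x r
    by (simp add: indicator_def)
  have "(\<integral>\<^sup>+y\<in>?\<psi> ` ?X. f (?s y) \<partial>lborel) = (\<integral>\<^sup>+y\<in>?X. \<bar>det (matrix (?\<psi>' y))\<bar> * f (?s (?\<psi> y)) \<partial>lborel)"
  proof (rule nn_integral_change_of_variables_wellorder[OF X' d' inj'])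
    have "(\<lambda>y. indicator (\<psi> ` X) (?s y) * f (?s y)) \<in> borel_measurable borel"
      by (rule measurable_compose[OF ms f(1)])
    then show "(\<lambda>y. indicator (?\<psi> ` ?X) y * f (?s y)) \<in> borel_measurable borel"
      unfolding im by (simp add: indicator_def)
    have "(\<lambda>y. indicator X (?s y) * (\<bar>det (matrix (\<psi>' (?s y)))\<bar> * f (\<psi> (?s y)))) \<in> borel_measurable borel"
      by (rule measurable_compose[OF ms m])
    then show "(\<lambda>y. indicator ?X y * (\<bar>det (matrix (?\<psi>' y))\<bar> * f (?s (?\<psi> y)))) \<in> borel_measurable borel"
      unfolding det by (simp add: indicator_def)
  qed (simp_all add: f)
  moreover have "(\<integral>\<^sup>+y\<in>?\<psi> ` ?X. f (?s y) \<partial>lborel) = (\<integral>\<^sup>+y\<in>\<psi> ` X. f y \<partial>lborel)"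
  proof -
    have "(\<lambda>x. ennreal (indicator (\<psi> ` X) x * f x)) \<in> borel_measurable borel"
      using f(1) by simp
    from tr[OF this] show ?thesis unfolding im ind by (simp add: indicator_def)
  qed
  moreover have "(\<integral>\<^sup>+y\<in>?X. \<bar>det (matrix (?\<psi>' y))\<bar> * f (?s (?\<psi> y)) \<partial>lborel) = (\<integral>\<^sup>+x\<in>X. \<bar>det (matrix (\<psi>' x))\<bar> * f (\<psi> x) \<partial>lborel)"
  proof -
    have "(\<lambda>x. ennreal (indicator X x * (\<bar>det (matrix (\<psi>' x))\<bar> * f (\<psi> x)))) \<in> borel_measurable borel"
      using m by simp
    from tr[OF this] show ?thesis unfolding det ind by (simp add: indicator_def)
  qed
  ultimately show ?thesis by simp
qed

text \<open>Difference quotients integrate to \<open>0\<close> by translation invariance.\<close>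

lemma integral_partial_compact_support:
  fixes f :: "real^'n::finite \<Rightarrow> real"
  assumes f: "Ck_on 1 f UNIV" and K: "compact K" and zero: "\<And>x. x \<notin> K \<Longrightarrow> f x = 0"
  shows "integrable lborel (partial i f)" "(\<integral>x. partial i f x \<partial>lborel) = 0"
proof -
  let ?v = "axis i 1 :: real^'n"
  have df: "f differentiable (at x)" for x using f by simp
  have cf: "continuous_on UNIV f" by (rule Ck_on_continuous[OF f])
  have cp: "continuous_on UNIV (partial i f)" using f by simp
  have pz: "partial i f x = 0" if "x \<notin> K" for x
    using partial_cong[of "- K" x f "\<lambda>x. 0" i] that zero compact_imp_closed[OF K] by (simp add: open_Compl)
  have "bounded (partial i f ` K)"
    by (intro compact_imp_bounded compact_continuous_image K continuous_on_subset[OF cp]) simp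
  then obtain M where M: "M > 0" "\<And>x. x \<in> K \<Longrightarrow> \<bar>partial i f x\<bar> \<le> M"
    by (auto simp: bounded_pos)
  then have M: "M > 0" "\<And>x. \<bar>partial i f x\<bar> \<le> M" using pz by (auto, metis abs_zero less_imp_le)
  obtain r where r: "r > 0" "K \<subseteq> cball 0 r"
    using compact_imp_bounded[OF K] by (auto simp: bounded_pos subset_iff)
  have int: "integrable lborel F" if "continuous_on UNIV F" "\<And>x. x \<notin> K \<Longrightarrow> F x = 0" for F :: "real^'n \<Rightarrow> real"
  proof -
    have "integrable lborel (\<lambda>x. indicator K x *\<^sub>R F x)"
      by (intro borel_integrable_compact K continuous_on_subset[OF that(1)]) simp
    moreover have "(\<lambda>x. indicator K x *\<^sub>R F x) = F" using that(2) by (auto simp: indicator_def fun_eq_iff)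
    ultimately show ?thesis by simp
  qed
  show ip: "integrable lborel (partial i f)" by (rule int[OF cp pz])
  have fi: "integrable lborel f" by (rule int[OF cf zero])
  \<comment> \<open>Step sizes tending to 0. Being at most 1, they keep all difference quotients
    supported in the ball of radius \<open>r + 1\<close>.\<close>
  define t where "t n = 1 / real (Suc n)" for n
  have t: "0 < t n" "t n \<le> 1" for n by (simp_all add: t_def)
  define D where "D n x = (f (x + t n *\<^sub>R ?v) - f x) / t n" for n x
  have mf [measurable]: "f \<in> borel_measurable borel" using cf by (rule borel_measurable_continuous_onI)
  have tr: "integrable lborel (\<lambda>x. f (x + c))" "(\<integral>x. f (x + c) \<partial>lborel) = (\<integral>x. f x \<partial>lborel)" for c
  proof -
    have "distr lborel borel (\<lambda>x. x + c) = (lborel :: (real^'n) measure)"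
    proof -
      have e: "(\<lambda>x. x + c) = (+) c" by (auto simp: add.commute)
      show ?thesis unfolding e by (rule lborel_distr_plus)
    qed
    then show "integrable lborel (\<lambda>x. f (x + c))" "(\<integral>x. f (x + c) \<partial>lborel) = (\<integral>x. f x \<partial>lborel)"
      using integrable_distr_eq[of "\<lambda>x. x + c" lborel borel f] integral_distr[of "\<lambda>x. x + c" lborel borel f] fi by auto
  qed
  have D0: "(\<integral>x. D n x \<partial>lborel) = 0" for n
    unfolding D_def using tr fi by simp
  have "(\<lambda>n. \<integral>x. D n x \<partial>lborel) \<longlonglongrightarrow> (\<integral>x. partial i f x \<partial>lborel)"
  proof (rule integral_dominated_convergence[where w="\<lambda>x. indicator (cball 0 (r + 1)) x * M"])
    show "partial i f \<in> borel_measurable lborel" using ip by simp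
    show "D n \<in> borel_measurable lborel" for n unfolding D_def by simp
    show "integrable lborel (\<lambda>x::real^'n. indicator (cball 0 (r + 1)) x * M)"
      using borel_integrable_compact[of "cball 0 (r+1) :: (real^'n) set" "\<lambda>x. M"] by simp
    show "AE x in lborel. (\<lambda>n. D n x) \<longlonglongrightarrow> partial i f x"
    proof (intro AE_I2)
      fix x
      have "((\<lambda>s. f (x + s *\<^sub>R ?v)) has_real_derivative partial i f x) (at 0)"
        using has_vector_derivative_line[of f x 0 i] df by (simp add: has_real_derivative_iff_has_vector_derivative)
      then have "((\<lambda>s. (f (x + s *\<^sub>R ?v) - f x) / s) \<longlongrightarrow> partial i f x) (at 0)"
        by (simp add: DERIV_def)
      moreover have "filterlim t (at 0) sequentially"
        unfolding filterlim_at using LIMSEQ_inverse_real_of_nat t(1)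
        by (auto simp: t_def[abs_def] inverse_eq_divide)
      ultimately show "(\<lambda>n. D n x) \<longlonglongrightarrow> partial i f x"
        unfolding D_def by (rule filterlim_compose)
    qed
    show "AE x in lborel. norm (D n x) \<le> indicator (cball 0 (r + 1)) x * M" for n
    proof (intro AE_I2)
      fix x
      have "((\<lambda>s. f (x + s *\<^sub>R ?v)) has_real_derivative partial i f (x + s *\<^sub>R ?v)) (at s)" for s
        using has_vector_derivative_line[of f x s i] df by (simp add: has_real_derivative_iff_has_vector_derivative)
      \<comment> \<open>The mean value theorem equates the quotient with a value of the partial
        derivative, so the bound \<open>M\<close> dominates it uniformly in
        \<open>n\<close>.\<close>
      then obtain s where "f (x + t n *\<^sub>R ?v) - f (x + 0 *\<^sub>R ?v) = (t n - 0) * partial i f (x + s *\<^sub>R ?v)"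
        using MVT2[OF t(1)[of n], of "\<lambda>s. f (x + s *\<^sub>R ?v)" "\<lambda>s. partial i f (x + s *\<^sub>R ?v)"] by blast
      then have "D n x = partial i f (x + s *\<^sub>R ?v)" using t(1)[of n] by (simp add: D_def)
      then have le: "\<bar>D n x\<bar> \<le> M" using M(2) by simp
      have "D n x = 0" if "x \<notin> cball 0 (r + 1)"
      proof -
        have "norm x \<le> norm (x + t n *\<^sub>R ?v) + norm (t n *\<^sub>R ?v)"
          using norm_triangle_ineq4[of "x + t n *\<^sub>R ?v" "t n *\<^sub>R ?v"] by simp
        then have "norm x \<le> norm (x + t n *\<^sub>R ?v) + 1"
          using t[of n] by (simp add: norm_axis_1)
        then have "x \<notin> K" "x + t n *\<^sub>R ?v \<notin> K" using that r by (auto simp: subset_iff)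
        then show ?thesis by (simp add: D_def zero)
      qed
      with le show "norm (D n x) \<le> indicator (cball 0 (r + 1)) x * M"
        by (cases "x \<in> cball 0 (r + 1)") auto
    qed
  qed
  then show "(\<integral>x. partial i f x \<partial>lborel) = 0" by (simp add: D0 LIMSEQ_const_iff)
qed

section \<open>The Riemannian measure\<close>

locale riemannian_manifold =
  fixes T :: "'a topology" and A :: "('a, 'n::finite) chart set"
    and g :: "('a, 'n) chart \<Rightarrow> real^'n \<Rightarrow> real^'n^'n"
  assumes manifold: "smooth_manifold T A" and metric: "riemannian_metric A g"
begin

definition overlap :: "('a, 'n) chart \<Rightarrow> ('a, 'n) chart \<Rightarrow> (real^'n) set" where
  "overlap c d = snd c ` (fst c \<inter> fst d)"

lemma cover: "p \<in> topspace T \<Longrightarrow> \<exists>c\<in>A. p \<in> fst c"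
  using manifold unfolding smooth_manifold_def by blast

context
  fixes c assumes c: "c \<in> A"
begin

lemma chart: "is_chart T c"
  using manifold c by (simp add: smooth_manifold_def)

lemma openin_chart: "openin T (fst c)" and open_coord_image: "open (coord_image c)"
  and homeomorphic_chart: "homeomorphic_map (subtopology T (fst c)) (top_of_set (coord_image c)) (snd c)"
  using chart by (auto simp: is_chart_def)

lemma chart_subset: "fst c \<subseteq> topspace T"
  by (rule openin_subset[OF openin_chart])

lemma topspace_chart: "topspace (subtopology T (fst c)) = fst c"
  using chart_subset by auto

lemma inj_chart: "inj_on (snd c) (fst c)"
  using homeomorphic_imp_injective_map[OF homeomorphic_chart] by (simp only: topspace_chart)

lemma coord_inv_chart [simp]: "p \<in> fst c \<Longrightarrow> coord_inv c (snd c p) = p"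
  by (simp add: coord_inv_def inj_chart)

lemma chart_coord_inv [simp]: "x \<in> coord_image c \<Longrightarrow> snd c (coord_inv c x) = x"
  and coord_inv_in [simp]: "x \<in> coord_image c \<Longrightarrow> coord_inv c x \<in> fst c"
  by (auto simp: coord_image_def inj_chart)

lemma coord_in [simp]: "p \<in> fst c \<Longrightarrow> snd c p \<in> coord_image c"
  by (simp add: coord_image_def)

lemma open_chart_image: assumes "openin T U" shows "open (snd c ` (U \<inter> fst c))"
proof -
  have "openin (subtopology T (fst c)) (U \<inter> fst c)"
    using assms by (auto simp: openin_subtopology)
  then have "openin (top_of_set (coord_image c)) (snd c ` (U \<inter> fst c))"
    using homeomorphic_imp_open_map[OF homeomorphic_chart] by (simp only: open_map_def)
  then show ?thesis using open_coord_image openin_open_trans by blast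
qed

lemma openin_chart_preimage: assumes "open V" shows "openin T {p \<in> fst c. snd c p \<in> V}"
proof -
  have "openin (top_of_set (coord_image c)) (coord_image c \<inter> V)" using assms by auto
  from openin_continuous_map_preimage[OF homeomorphic_imp_continuous_map[OF homeomorphic_chart] this]
  have "openin (subtopology T (fst c)) {p \<in> fst c. snd c p \<in> coord_image c \<inter> V}"
    by (simp only: topspace_chart)
  moreover have "{p \<in> fst c. snd c p \<in> coord_image c \<inter> V} = {p \<in> fst c. snd c p \<in> V}" by auto
  ultimately show ?thesis by (simp add: openin_open_subtopology[OF openin_chart])
qed

lemma chart_metric: "local_metric (coord_image c) (g c)"
proof
  show "Ck_on k (g c) (coord_image c)" for k
    using metric c by (auto simp: riemannian_metric_def smooth_on_imp_Ck_on)
qed (use metric c in \<open>auto simp: riemannian_metric_def open_coord_image\<close>)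

lemma overlap_subset: "overlap c d \<subseteq> coord_image c"
  by (auto simp: overlap_def coord_image_def)

lemma overlap_iff: "x \<in> overlap c d \<longleftrightarrow> x \<in> coord_image c \<and> coord_inv c x \<in> fst d"
  by (auto simp: overlap_def coord_image_def)

lemma open_overlap: assumes "d \<in> A" shows "open (overlap c d)"
proof -
  have "openin T (fst d)" using manifold assms by (auto simp: smooth_manifold_def is_chart_def)
  from open_chart_image[OF this] show ?thesis by (simp add: overlap_def Int_commute)
qed

lemma transition_chart: "p \<in> fst c \<Longrightarrow> transition c d (snd c p) = snd d p"
  by (simp add: transition_def)

lemma transition_in: "x \<in> overlap c d \<Longrightarrow> transition c d x \<in> coord_image d"
  by (auto simp: overlap_def transition_chart coord_image_def)

lemma chart_change:
  assumes d: "d \<in> A"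
  shows "chart_change (overlap c d) (g c) (coord_image d) (g d) (transition c d)"
proof -
  interpret src: local_metric "coord_image c" "g c" by (rule chart_metric)
  have pb: "g c x = transpose (jacobian (transition c d) (at x)) ** g d (transition c d x) ** jacobian (transition c d) (at x)"
    if x: "x \<in> overlap c d" for x
  proof -
    obtain p where p: "p \<in> fst c" "p \<in> fst d" "x = snd c p" using x by (auto simp: overlap_def)
    show ?thesis unfolding p(3) transition_chart[OF p(1)]
      using metric c d p(1,2) unfolding riemannian_metric_def by blast
  qed
  have "smooth_on (transition c d) (overlap c d)"
    using manifold c d by (simp add: smooth_manifold_def overlap_def)
  moreover have "local_metric (overlap c d) (g c)"
  proof
    show "open (overlap c d)" by (rule open_overlap[OF d])
    show "Ck_on k (g c) (overlap c d)" for k by (rule Ck_on_subset[OF src.smooth overlap_subset])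
    fix x assume "x \<in> overlap c d"
    then have x: "x \<in> coord_image c" using overlap_subset by blast
    show "transpose (g c x) = g c x" by (rule src.symmetric[OF x])
    show "v \<bullet> (g c x *v v) > 0" if "v \<noteq> 0" for v by (rule src.positive[OF x that])
  qed
  moreover have "local_metric (coord_image d) (g d)"
  proof
    show "Ck_on k (g d) (coord_image d)" for k
      using metric d by (auto simp: riemannian_metric_def smooth_on_imp_Ck_on)
    show "open (coord_image d)" using manifold d by (auto simp: smooth_manifold_def is_chart_def)
  qed (use metric d in \<open>auto simp: riemannian_metric_def\<close>)
  ultimately show ?thesis
    using pb by (intro chart_change.intro chart_change_axioms.intro) (auto simp: smooth_on_imp_Ck_on transition_in)
qed

end

text \<open>Replaces the chart selected by \<open>SOME\<close> by an arbitrary one, given that all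
  charts around \<open>p\<close> agree on the expression.\<close>

lemma scalar_of_eq:
  assumes "c \<in> A" "p \<in> fst c"
    and "\<And>c d. c \<in> A \<Longrightarrow> d \<in> A \<Longrightarrow> p \<in> fst c \<Longrightarrow> p \<in> fst d \<Longrightarrow> F c (snd c p) = F d (snd d p)"
  shows "scalar_of A F p = F c (snd c p)"
proof -
  let ?c = "SOME c. c \<in> A \<and> p \<in> fst c"
  have "?c \<in> A \<and> p \<in> fst ?c" by (rule someI[of _ c]) (use assms in simp)
  then show ?thesis unfolding scalar_of_def Let_def using assms by blast
qed

lemma continuous_map_charts:
  fixes F :: "'a \<Rightarrow> real"
  assumes "\<And>c. c \<in> A \<Longrightarrow> continuous_on (coord_image c) (F \<circ> coord_inv c)"
  shows "continuous_map T euclideanreal F"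
proof -
  have "openin T {p \<in> topspace T. F p \<in> U}" if U: "open U" for U
  proof -
    let ?V = "\<lambda>c. coord_image c \<inter> (F \<circ> coord_inv c) -` U"
    have o: "open (?V c)" if "c \<in> A" for c
      using continuous_open_preimage[OF assms[OF that] open_coord_image[OF that] U] .
    have "{p \<in> topspace T. F p \<in> U} = (\<Union>c\<in>A. {p \<in> fst c. snd c p \<in> ?V c})" (is "?L = ?R")
    proof (intro equalityI subsetI)
      fix p assume p: "p \<in> ?L"
      then obtain c where c: "c \<in> A" "p \<in> fst c" using cover by blast
      then have "snd c p \<in> ?V c" using p by simp
      with c show "p \<in> ?R" by blast
    next
      fix p assume "p \<in> ?R"
      then obtain c where c: "c \<in> A" "p \<in> fst c" "snd c p \<in> ?V c" by blast
      then show "p \<in> ?L" using chart_subset[OF c(1)] by auto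
    qed
    also have "openin T \<dots>"
    proof (rule openin_Union)
      fix W assume "W \<in> (\<lambda>c. {p \<in> fst c. snd c p \<in> ?V c}) ` A"
      then obtain c where c: "c \<in> A" "W = {p \<in> fst c. snd c p \<in> ?V c}" by blast
      show "openin T W" unfolding c(2) by (rule openin_chart_preimage[OF c(1) o[OF c(1)]])
    qed
    finally show ?thesis .
  qed
  then show ?thesis by (simp add: continuous_map_def)
qed

lemma continuous_on_chart:
  fixes F :: "'a \<Rightarrow> real"
  assumes F: "continuous_map T euclideanreal F" and c: "c \<in> A"
  shows "continuous_on (coord_image c) (F \<circ> coord_inv c)"
  unfolding continuous_on_open_vimage[OF open_coord_image[OF c]]
proof (intro allI impI)
  fix U :: "real set" assume "open U"
  then have "openin T {p \<in> topspace T. F p \<in> U}" using F by (simp add: continuous_map_def)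
  from open_chart_image[OF c this] have "open (snd c ` ({p \<in> topspace T. F p \<in> U} \<inter> fst c))" .
  moreover have "snd c ` ({p \<in> topspace T. F p \<in> U} \<inter> fst c) = (F \<circ> coord_inv c) -` U \<inter> coord_image c"
    using c chart_subset[OF c] by (auto simp: coord_image_def image_iff intro!: bexI)
  ultimately show "open ((F \<circ> coord_inv c) -` U \<inter> coord_image c)" by simp
qed

section \<open>Borel sets and coordinate measures\<close>

definition \<Sigma> :: "'a set set" where "\<Sigma> = sigma_sets (topspace T) {U. openin T U}"

lemma sigma_algebra_\<Sigma>: "sigma_algebra (topspace T) \<Sigma>"
  unfolding \<Sigma>_def by (rule sigma_algebra_sigma_sets) (auto dest: openin_subset)

interpretation \<Sigma>: sigma_algebra "topspace T" \<Sigma>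
  by (rule sigma_algebra_\<Sigma>)

lemma openin_\<Sigma>: "openin T U \<Longrightarrow> U \<in> \<Sigma>"
  by (simp add: \<Sigma>_def sigma_sets.Basic)

lemma chart_\<Sigma>: "c \<in> A \<Longrightarrow> fst c \<in> \<Sigma>"
  by (intro openin_\<Sigma> openin_chart)

text \<open>Induction over the generation of the Borel sets; injectivity of the chart lets its image
  commute with complements.\<close>

lemma chart_image_borel:
  assumes c: "c \<in> A" and B: "B \<in> \<Sigma>"
  shows "snd c ` (B \<inter> fst c) \<in> sets borel"
  using B unfolding \<Sigma>_def
proof (induction rule: sigma_sets.induct)
  case (Basic U)
  then show ?case using open_chart_image[OF c] by auto
next
  case (Compl B)
  have "(topspace T - B) \<inter> fst c = fst c - (B \<inter> fst c)" using chart_subset[OF c] by auto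
  then have "snd c ` ((topspace T - B) \<inter> fst c) = coord_image c - snd c ` (B \<inter> fst c)"
    using inj_on_image_set_diff[OF inj_chart[OF c], of "fst c" "B \<inter> fst c"]
    by (simp add: coord_image_def)
  then show ?case using Compl open_coord_image[OF c] by auto
next
  case (Union B)
  have "snd c ` (\<Union> (range B) \<inter> fst c) = (\<Union>i. snd c ` (B i \<inter> fst c))" by auto
  then show ?case using Union by auto
qed simp

definition coord_measure :: "('a, 'n) chart \<Rightarrow> (real^'n) measure" where
  "coord_measure c = density lborel (\<lambda>x. ennreal (indicator (coord_image c) x * sqrt (det (g c x))))"

lemma sets_coord_measure [simp]: "sets (coord_measure c) = sets borel"
  and space_coord_measure [simp]: "space (coord_measure c) = UNIV"
  by (simp_all add: coord_measure_def)

lemma continuous_volume: "c \<in> A \<Longrightarrow> continuous_on (coord_image c) (\<lambda>x. sqrt (det (g c x)))"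
  using Ck_on_continuous[OF local_metric.Ck_volume_density[OF chart_metric]]
    local_metric.volume_density_def[OF chart_metric] by simp

lemma det_metric_positive: "c \<in> A \<Longrightarrow> x \<in> coord_image c \<Longrightarrow> det (g c x) > 0"
  by (rule local_metric.det_positive[OF chart_metric])

lemma measurable_volume:
  "c \<in> A \<Longrightarrow> (\<lambda>x. indicator (coord_image c) x * sqrt (det (g c x))) \<in> borel_measurable borel"
  using borel_measurable_continuous_on_indicator[OF _ continuous_volume, of c] open_coord_image[of c] by simp

lemma emeasure_coord_measure:
  assumes c: "c \<in> A" and X: "X \<in> sets borel" "X \<subseteq> coord_image c"
  shows "emeasure (coord_measure c) X = (\<integral>\<^sup>+x\<in>X. ennreal (sqrt (det (g c x))) \<partial>lborel)"
proof -
  have "emeasure (coord_measure c) X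
      = (\<integral>\<^sup>+x. ennreal (indicator (coord_image c) x * sqrt (det (g c x))) * indicator X x \<partial>lborel)"
    unfolding coord_measure_def using X(1) measurable_volume[OF c] by (subst emeasure_density) auto
  also have "\<dots> = (\<integral>\<^sup>+x\<in>X. ennreal (sqrt (det (g c x))) \<partial>lborel)"
    using X(2) by (intro nn_integral_cong) (auto simp: indicator_def)
  finally show ?thesis .
qed

text \<open>The factor \<open>\<bar>det J\<bar>\<close> in the change of variables is precisely the
  quotient of the two volume densities. The absolute value is why no orientation enters.\<close>

lemma coord_measure_change:
  assumes c: "c \<in> A" and d: "d \<in> A" and B: "B \<in> \<Sigma>" "B \<subseteq> fst c" "B \<subseteq> fst d"
  shows "emeasure (coord_measure c) (snd c ` B) = emeasure (coord_measure d) (snd d ` B)"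
proof -
  interpret ch: chart_change "overlap c d" "g c" "coord_image d" "g d" "transition c d"
    by (rule chart_change[OF c d])
  let ?X = "snd c ` B" and ?\<psi> = "transition c d"
  let ?f = "\<lambda>y. indicator (coord_image d) y * sqrt (det (g d y))"
  let ?\<psi>' = "\<lambda>x. frechet_derivative ?\<psi> (at x)"
  have Xb: "?X \<in> sets borel" "snd d ` B \<in> sets borel"
    using chart_image_borel[OF c B(1)] chart_image_borel[OF d B(1)] B(2,3) by (simp_all add: Int_absorb2)
  have Xo: "?X \<subseteq> overlap c d" using B by (auto simp: overlap_def)
  have im: "?\<psi> ` ?X = snd d ` B"
    using B(2) by (force simp: image_image transition_chart[OF c])
  have inj: "inj_on ?\<psi> ?X"
    using inj_chart[OF d] B by (auto simp: inj_on_def transition_chart[OF c] subset_iff)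
  have det: "\<bar>det (matrix (?\<psi>' x))\<bar> * ?f (?\<psi> x) = sqrt (det (g c x))" if "x \<in> ?X" for x
  proof -
    have x: "x \<in> overlap c d" using that Xo by blast
    then show ?thesis using ch.volume_density_change[OF x] transition_in[OF c x]
      by (simp add: ch.src.volume_density_def ch.dst.volume_density_def ch.J_def jacobian_def)
  qed
  have "(\<integral>\<^sup>+y\<in>?\<psi> ` ?X. ?f y \<partial>lborel) = (\<integral>\<^sup>+x\<in>?X. \<bar>det (matrix (?\<psi>' x))\<bar> * ?f (?\<psi> x) \<partial>lborel)"
  proof (rule nn_integral_change_of_variables[OF Xb(1) _ inj])
    show "(?\<psi> has_derivative ?\<psi>' x) (at x)" if "x \<in> ?X" for x
      using ch.differentiable_\<psi> that Xo frechet_derivative_works by blast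
    show "(\<lambda>x. indicator (?\<psi> ` ?X) x * ?f x) \<in> borel_measurable borel"
      unfolding im using Xb(2) measurable_volume[OF d] by simp
    show "0 \<le> ?f x" for x using det_metric_positive[OF d, of x] by (auto simp: indicator_def)
    have "(\<lambda>x. indicator ?X x * (\<bar>det (matrix (?\<psi>' x))\<bar> * ?f (?\<psi> x)))
        = (\<lambda>x. indicator ?X x * (indicator (coord_image c) x * sqrt (det (g c x))))"
      using Xo overlap_subset[OF c, of d] det by (auto simp: indicator_def fun_eq_iff)
    then show "(\<lambda>x. indicator ?X x * (\<bar>det (matrix (?\<psi>' x))\<bar> * ?f (?\<psi> x))) \<in> borel_measurable borel"
      using Xb(1) measurable_volume[OF c] by simp
  qed
  moreover have "(\<integral>\<^sup>+x\<in>?X. \<bar>det (matrix (?\<psi>' x))\<bar> * ?f (?\<psi> x) \<partial>lborel) = emeasure (coord_measure c) ?X"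
  proof -
    have "ennreal (\<bar>det (matrix (?\<psi>' x))\<bar> * ?f (?\<psi> x)) * indicator ?X x = ennreal (sqrt (det (g c x))) * indicator ?X x" for x
    proof (cases "x \<in> ?X")
      case True
      then show ?thesis using det[OF True] by presburger
    next
      case False
      then show ?thesis by (simp only: indicator_simps not_False_eq_True mult_zero_right)
    qed
    then show ?thesis using Xo overlap_subset[OF c, of d] by (simp add: emeasure_coord_measure[OF c Xb(1)])
  qed
  moreover have "(\<integral>\<^sup>+y\<in>?\<psi> ` ?X. ?f y \<partial>lborel) = emeasure (coord_measure d) (snd d ` B)"
    unfolding im using B(3)
    by (subst emeasure_coord_measure[OF d Xb(2)])
      (auto simp: indicator_def coord_in[OF d] subset_iff intro!: nn_integral_cong)
  ultimately show ?thesis by simp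
qed

end

locale compact_riemannian_manifold = riemannian_manifold T A g
  for T :: "'a topology" and A :: "('a, 'n::finite) chart set" and g +
  assumes compact: "compact_space T"
begin

interpretation \<Sigma>: sigma_algebra "topspace T" \<Sigma>
  by (rule sigma_algebra_\<Sigma>)

lemma finite_open_cover:
  assumes "\<And>p. p \<in> topspace T \<Longrightarrow> openin T (U p) \<and> p \<in> U p"
  obtains P where "finite P" "P \<subseteq> topspace T" "topspace T = (\<Union>p\<in>P. U p)"
proof -
  have "compactin T (topspace T)" using compact by (simp add: compact_space_def)
  moreover have "openin T W" if "W \<in> U ` topspace T" for W using that assms by blast
  moreover have "topspace T \<subseteq> \<Union>(U ` topspace T)" using assms by blast
  ultimately obtain \<F> where F: "finite \<F>" "\<F> \<subseteq> U ` topspace T" "topspace T \<subseteq> \<Union>\<F>"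
    using compactinD[of T "topspace T" "U ` topspace T"] by blast
  then obtain P where P: "P \<subseteq> topspace T" "finite P" "\<F> = U ` P"
    using finite_subset_image[OF F(1,2)] by blast
  then have "topspace T = (\<Union>p\<in>P. U p)"
    using F(3) assms[THEN conjunct1, THEN openin_subset] by blast
  then show ?thesis using that P by blast
qed

lemma finite_atlas: obtains N :: nat and c where "\<And>n. n < N \<Longrightarrow> c n \<in> A" "topspace T = (\<Union>n<N. fst (c n))"
proof -
  define ch where "ch p = (SOME c. c \<in> A \<and> p \<in> fst c)" for p
  have ch: "ch p \<in> A \<and> p \<in> fst (ch p)" if "p \<in> topspace T" for p
    unfolding ch_def by (rule someI_ex) (use cover[OF that] in blast)
  obtain P where P: "finite P" "P \<subseteq> topspace T" "topspace T = (\<Union>p\<in>P. fst (ch p))"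
    using finite_open_cover[of "\<lambda>p. fst (ch p)"] ch openin_chart by blast
  obtain f N where f: "P = f ` {i::nat. i < N}"
    using finite_imp_nat_seg_image_inj_on[OF P(1)] by blast
  show ?thesis
  proof (rule that[of N "ch \<circ> f"])
    show "(ch \<circ> f) n \<in> A" if "n < N" for n using that P(2) f ch by auto
    show "topspace T = (\<Union>n<N. fst ((ch \<circ> f) n))" unfolding P(3) f by auto
  qed
qed

abbreviation "is_volume \<mu> \<equiv> space \<mu> = topspace T \<and> sets \<mu> = \<Sigma> \<and>
     (\<forall>c\<in>A. \<forall>B\<in>sets \<mu>. B \<subseteq> fst c \<longrightarrow>
        emeasure \<mu> B = (\<integral>\<^sup>+x\<in>snd c ` B. ennreal (sqrt (det (g c x))) \<partial>lborel))"

lemma is_volume_iff: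
  "is_volume \<mu> \<longleftrightarrow> space \<mu> = topspace T \<and> sets \<mu> = \<Sigma> \<and>
     (\<forall>c\<in>A. \<forall>B\<in>\<Sigma>. B \<subseteq> fst c \<longrightarrow> emeasure \<mu> B = emeasure (coord_measure c) (snd c ` B))"
proof -
  have "emeasure (coord_measure c) (snd c ` B) = (\<integral>\<^sup>+x\<in>snd c ` B. ennreal (sqrt (det (g c x))) \<partial>lborel)"
    if "c \<in> A" "B \<in> \<Sigma>" "B \<subseteq> fst c" for c B
    using that chart_image_borel[OF that(1,2)] by (intro emeasure_coord_measure) (auto simp: Int_absorb2)
  then show ?thesis by auto
qed

text \<open>The manifold is cut into finitely many disjoint Borel pieces, each inside one chart, and
  the coordinate measures of the pieces are added. By \<open>coord_measure_change\<close> the result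
  does not depend on which chart measures a piece.\<close>

lemma ex1_volume: "\<exists>!\<mu>. is_volume \<mu>"
proof -
  obtain N :: nat and c where c: "\<And>n. n < N \<Longrightarrow> c n \<in> A" and cov: "topspace T = (\<Union>n<N. fst (c n))"
    using finite_atlas by metis
  define D where "D n = disjointed (\<lambda>n. fst (c n)) n" for n
  have Dsub: "D n \<subseteq> fst (c n)" for n unfolding D_def by (rule disjointed_subset)
  have Ddisj: "disjoint_family_on D I" for I
    using disjoint_family_disjointed[of "\<lambda>n. fst (c n)"] unfolding D_def disjoint_family_on_def by blast
  have DU: "(\<Union>n<N. D n) = topspace T"
    using finite_UN_disjointed_eq[of "\<lambda>n. fst (c n)" N] by (simp add: D_def cov lessThan_atLeast0)
  have D\<Sigma>: "D n \<in> \<Sigma>" if "n < N" for n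
    unfolding D_def disjointed_def using that c chart_\<Sigma> by (intro \<Sigma>.Diff \<Sigma>.finite_UN) auto
  have BD: "B \<inter> D n \<in> \<Sigma>" if "n < N" "B \<in> \<Sigma>" for n B using D\<Sigma> that by blast
  have img: "snd (c n) ` (B \<inter> D n) \<in> sets borel" if "n < N" "B \<in> \<Sigma>" for n B
    using chart_image_borel[OF c[OF that(1)] BD[OF that]] Dsub[of n] by (simp add: Int_absorb2 le_infI2)
  define m where "m B = (\<Sum>n<N. emeasure (coord_measure (c n)) (snd (c n) ` (B \<inter> D n)))" for B
  define \<mu>\<^sub>0 where "\<mu>\<^sub>0 = measure_of (topspace T) \<Sigma> m"
  have pow: "\<Sigma> \<subseteq> Pow (topspace T)" by (rule \<Sigma>.space_closed)
  have \<mu>\<^sub>0: "space \<mu>\<^sub>0 = topspace T" "sets \<mu>\<^sub>0 = \<Sigma>"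
    unfolding \<mu>\<^sub>0_def using pow by (simp_all add: space_measure_of_conv \<Sigma>.sets_measure_of_eq)
  have add: "countably_additive \<Sigma> m"
  proof (rule countably_additiveI)
    fix B :: "nat \<Rightarrow> 'a set" assume B: "range B \<subseteq> \<Sigma>" "disjoint_family B" "(\<Union>i. B i) \<in> \<Sigma>"
    have "(\<Sum>i. m (B i)) = (\<Sum>n<N. \<Sum>i. emeasure (coord_measure (c n)) (snd (c n) ` (B i \<inter> D n)))"
      unfolding m_def by (rule suminf_sum) simp
    also have "\<dots> = (\<Sum>n<N. emeasure (coord_measure (c n)) (\<Union>i. snd (c n) ` (B i \<inter> D n)))"
    proof (intro sum.cong refl suminf_emeasure)
      fix n assume "n \<in> {..<N}"
      then show "range (\<lambda>i. snd (c n) ` (B i \<inter> D n)) \<subseteq> sets (coord_measure (c n))"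
        using img B(1) by auto
      show "disjoint_family (\<lambda>i. snd (c n) ` (B i \<inter> D n))"
        unfolding disjoint_family_on_def
      proof (intro ballI impI)
        fix i j :: nat assume "i \<noteq> j"
        then have "(B i \<inter> D n) \<inter> (B j \<inter> D n) = {}" using B(2) by (auto simp: disjoint_family_on_def)
        moreover have "inj_on (snd (c n)) (fst (c n))" using inj_chart c \<open>n \<in> {..<N}\<close> by blast
        ultimately show "snd (c n) ` (B i \<inter> D n) \<inter> snd (c n) ` (B j \<inter> D n) = {}"
          using Dsub[of n] by (subst inj_on_image_Int[symmetric, of _ "fst (c n)"]) auto
      qed
    qed
    also have "\<dots> = m (\<Union>i. B i)"
      unfolding m_def by (intro sum.cong refl arg_cong2[where f=emeasure]) auto
    finally show "(\<Sum>i. m (B i)) = m (\<Union>i. B i)" .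
  qed
  have em: "emeasure \<mu>\<^sub>0 B = m B" if "B \<in> \<Sigma>" for B
  proof (rule emeasure_measure_of[OF \<mu>\<^sub>0_def pow])
    show "positive (sets \<mu>\<^sub>0) m" by (simp add: positive_def m_def)
  qed (use add that \<mu>\<^sub>0 in auto)
  \<comment> \<open>Each \<open>B \<inter> D n\<close> lies in the domains of both
    \<open>c n\<close> and \<open>d\<close>, so its measure may be computed in \<open>d\<close>,
    where the pieces reassemble to \<open>B\<close>.\<close>
  have loc: "emeasure \<mu>\<^sub>0 B = emeasure (coord_measure d) (snd d ` B)" if d: "d \<in> A" and B: "B \<in> \<Sigma>" "B \<subseteq> fst d" for d B
  proof -
    have "emeasure \<mu>\<^sub>0 B = (\<Sum>n<N. emeasure (coord_measure d) (snd d ` (B \<inter> D n)))"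
      unfolding em[OF B(1)] m_def
      by (intro sum.cong refl coord_measure_change) (use c d B BD in \<open>auto dest: subsetD[OF Dsub]\<close>)
    also have "\<dots> = emeasure (coord_measure d) (\<Union>n<N. snd d ` (B \<inter> D n))"
    proof (rule sum_emeasure)
      show "(\<lambda>n. snd d ` (B \<inter> D n)) ` {..<N} \<subseteq> sets (coord_measure d)"
        using chart_image_borel[OF d BD[OF _ B(1)]] B(2) by (auto simp: Int_absorb2 le_infI1)
      show "disjoint_family_on (\<lambda>n. snd d ` (B \<inter> D n)) {..<N}"
        unfolding disjoint_family_on_def
      proof (intro ballI impI)
        fix i j :: nat assume "i \<noteq> j"
        then have "(B \<inter> D i) \<inter> (B \<inter> D j) = {}" using Ddisj[of UNIV] by (auto simp: disjoint_family_on_def)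
        then show "snd d ` (B \<inter> D i) \<inter> snd d ` (B \<inter> D j) = {}"
          using B(2) inj_chart[OF d] by (subst inj_on_image_Int[symmetric, of _ "fst d"]) auto
      qed
    qed simp
    also have "(\<Union>n<N. snd d ` (B \<inter> D n)) = snd d ` (B \<inter> (\<Union>n<N. D n))" by auto
    also have "B \<inter> (\<Union>n<N. D n) = B" using DU \<Sigma>.sets_into_space[OF B(1)] by auto
    finally show ?thesis .
  qed
  show ?thesis
  proof (rule ex1I[of _ \<mu>\<^sub>0])
    show "is_volume \<mu>\<^sub>0" unfolding is_volume_iff using \<mu>\<^sub>0 loc by blast
    fix \<mu> assume "is_volume \<mu>"
    then have \<mu>: "space \<mu> = topspace T" "sets \<mu> = \<Sigma>"
      "\<And>c B. c \<in> A \<Longrightarrow> B \<in> \<Sigma> \<Longrightarrow> B \<subseteq> fst c \<Longrightarrow> emeasure \<mu> B = emeasure (coord_measure c) (snd c ` B)"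
      unfolding is_volume_iff by blast+
    show "\<mu> = \<mu>\<^sub>0"
    proof (rule measure_eqI)
      show "sets \<mu> = sets \<mu>\<^sub>0" using \<mu> \<mu>\<^sub>0 by simp
      fix B assume "B \<in> sets \<mu>"
      then have B: "B \<in> \<Sigma>" using \<mu> by simp
      \<comment> \<open>Uniqueness: on the pieces \<open>B \<inter> D n\<close> the value of any
        candidate is prescribed by the chart \<open>c n\<close>.\<close>
      have "emeasure \<mu> B = (\<Sum>n<N. emeasure \<mu> (B \<inter> D n))"
        by (rule sum_emeasure_cover) (use B D\<Sigma> \<mu> DU \<Sigma>.sets_into_space[OF B] Ddisj in auto)
      also have "\<dots> = m B"
        unfolding m_def by (intro sum.cong refl \<mu>(3)) (use c B BD in \<open>auto dest: subsetD[OF Dsub]\<close>)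
      finally show "emeasure \<mu> B = emeasure \<mu>\<^sub>0 B" by (simp add: em[OF B])
    qed
  qed
qed

section \<open>Integration of continuous functions\<close>

abbreviation "dV \<equiv> riemannian_measure T A g"

lemma space_dV [simp]: "space dV = topspace T" and sets_dV: "sets dV = \<Sigma>"
  and emeasure_dV: "c \<in> A \<Longrightarrow> B \<in> \<Sigma> \<Longrightarrow> B \<subseteq> fst c \<Longrightarrow> emeasure dV B = emeasure (coord_measure c) (snd c ` B)"
proof -
  have "is_volume dV"
    unfolding riemannian_measure_def \<Sigma>_def[symmetric] by (rule theI'[OF ex1_volume])
  then show "space dV = topspace T" "sets dV = \<Sigma>"
    "c \<in> A \<Longrightarrow> B \<in> \<Sigma> \<Longrightarrow> B \<subseteq> fst c \<Longrightarrow> emeasure dV B = emeasure (coord_measure c) (snd c ` B)"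
    unfolding is_volume_iff by blast+
qed

lemma continuous_map_measurable:
  assumes "continuous_map T euclideanreal F"
  shows "F \<in> borel_measurable dV"
proof (rule borel_measurableI)
  fix U :: "real set" assume "open U"
  then have "openin T {p \<in> topspace T. F p \<in> U}" using assms by (simp add: continuous_map_def)
  then have "{p \<in> topspace T. F p \<in> U} \<in> \<Sigma>" by (rule openin_\<Sigma>)
  moreover have "F -` U \<inter> topspace T = {p \<in> topspace T. F p \<in> U}" by auto
  ultimately show "F -` U \<inter> space dV \<in> sets dV" by (simp add: sets_dV)
qed

text \<open>On a whole chart image the density need not be bounded, so each point gets a coordinate
  ball whose closure stays in the image. There the density is bounded, and finitely many such balls
  cover.\<close>

lemma finite_dV: "finite_measure dV"
proof
  have "\<exists>U. openin T U \<and> p \<in> U \<and> emeasure dV U < \<infinity>" if p: "p \<in> topspace T" for p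
  proof -
    obtain c where c: "c \<in> A" "p \<in> fst c" using cover[OF p] by blast
    obtain r where r: "r > 0" "cball (snd c p) r \<subseteq> coord_image c"
      using open_coord_image[OF c(1)] c(2) coord_in[OF c] by (meson open_contains_cball)
    let ?K = "cball (snd c p) r"
    define U where "U = {q \<in> fst c. snd c q \<in> ball (snd c p) r}"
    have U: "openin T U" unfolding U_def by (rule openin_chart_preimage[OF c(1)]) simp
    have "continuous_on ?K (\<lambda>x. sqrt (det (g c x)))"
      by (rule continuous_on_subset[OF continuous_volume[OF c(1)] r(2)])
    then have "bounded ((\<lambda>x. sqrt (det (g c x))) ` ?K)"
      by (intro compact_imp_bounded compact_continuous_image) auto
    then obtain M where M': "\<And>x. x \<in> ?K \<Longrightarrow> \<bar>sqrt (det (g c x))\<bar> \<le> M"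
      unfolding bounded_iff by (force simp del: mem_cball)
    have M: "sqrt (det (g c x)) \<le> M" if "x \<in> ?K" for x using M'[OF that] by simp
    have sub: "snd c ` U \<subseteq> ?K" by (auto simp: U_def)
    have "emeasure dV U = emeasure (coord_measure c) (snd c ` U)"
      by (rule emeasure_dV[OF c(1) openin_\<Sigma>[OF U]]) (auto simp: U_def)
    also have "\<dots> \<le> emeasure (coord_measure c) ?K"
      by (rule emeasure_mono[OF sub]) simp
    also have "\<dots> = (\<integral>\<^sup>+x\<in>?K. ennreal (sqrt (det (g c x))) \<partial>lborel)"
      by (rule emeasure_coord_measure[OF c(1) _ r(2)]) simp
    also have "\<dots> \<le> (\<integral>\<^sup>+x. ennreal M * indicator ?K x \<partial>lborel)"
      using M by (intro nn_integral_mono) (auto simp: indicator_def intro: ennreal_leI)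
    also have "\<dots> = ennreal M * emeasure lborel ?K" by (simp add: nn_integral_cmult_indicator)
    also have "\<dots> < \<infinity>"
      using emeasure_bounded_finite[OF bounded_cball, of "snd c p" r] by (simp add: ennreal_mult_less_top)
    finally have "emeasure dV U < \<infinity>" .
    moreover have "p \<in> U" using c r by (simp add: U_def)
    ultimately show ?thesis using U by blast
  qed
  then obtain U where U: "\<And>p. p \<in> topspace T \<Longrightarrow> openin T (U p) \<and> p \<in> U p"
    "\<And>p. p \<in> topspace T \<Longrightarrow> emeasure dV (U p) < \<infinity>" by metis
  obtain P where P: "finite P" "P \<subseteq> topspace T" "topspace T = (\<Union>p\<in>P. U p)"
    using finite_open_cover[OF U(1)] by blast
  have "emeasure dV (\<Union>p\<in>P. U p) \<le> (\<Sum>p\<in>P. emeasure dV (U p))"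
    using P(1,2) U(1) openin_\<Sigma> by (intro emeasure_subadditive_finite) (auto simp only: sets_dV subset_iff)
  also have "\<dots> < \<infinity>" using P U(2) by (auto simp: ennreal_sum_less_top subset_iff less_top)
  finally show "emeasure dV (space dV) \<noteq> \<infinity>" using P(3) by simp
qed

lemma continuous_map_bounded:
  assumes F: "continuous_map T euclideanreal F"
  obtains M where "\<And>p. p \<in> topspace T \<Longrightarrow> \<bar>F p\<bar> \<le> M"
proof -
  have "compactin euclideanreal (F ` topspace T)"
    using image_compactin[OF _ F] compact by (simp add: compact_space_def)
  then have "bounded (F ` topspace T)" by (simp add: compact_imp_bounded)
  then show ?thesis using that by (auto simp: bounded_iff)
qed

lemma integrable_continuous:
  assumes F: "continuous_map T euclideanreal F"
  shows "integrable dV F"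
proof -
  obtain M where M: "\<And>p. p \<in> topspace T \<Longrightarrow> \<bar>F p\<bar> \<le> M" using continuous_map_bounded[OF F] by blast
  have "AE p in dV. norm (F p) \<le> M" by (intro AE_I2) (simp add: M)
  then show ?thesis
    by (rule finite_measure.integrable_const_bound[OF finite_dV]) (rule continuous_map_measurable[OF F])
qed

text \<open>The part \<open>W\<close> of a chart where \<open>F\<close> is nonzero is open and has
  measure zero. If it contained \<open>p\<close>, its coordinate image would be a nonempty open set,
  null for a measure with positive density and hence Lebesgue null, which is impossible.\<close>

lemma integral_zero_imp_zero:
  assumes F: "continuous_map T euclideanreal F" and nn: "\<And>p. p \<in> topspace T \<Longrightarrow> 0 \<le> F p"
    and zero: "(\<integral>p. F p \<partial>dV) = 0" and p: "p \<in> topspace T"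
  shows "F p = 0"
proof (rule ccontr)
  assume ne: "F p \<noteq> 0"
  obtain c where c: "c \<in> A" "p \<in> fst c" using cover[OF p] by blast
  define W where "W = {q \<in> topspace T. F q \<in> - {0}} \<inter> fst c"
  have oW: "openin T W" unfolding W_def
    by (intro openin_Int openin_chart[OF c(1)] openin_continuous_map_preimage[OF F]) (simp add: open_Compl)
  have W\<Sigma>: "W \<in> \<Sigma>" by (rule openin_\<Sigma>[OF oW])
  have "AE q in dV. 0 \<le> F q" by (intro AE_I2) (simp add: nn)
  then have "AE q in dV. F q = 0"
    using integral_nonneg_eq_0_iff_AE[OF integrable_continuous[OF F]] zero by simp
  then have "AE q in dV. q \<notin> W" by (rule eventually_mono) (auto simp: W_def)
  moreover have "{q \<in> space dV. \<not> q \<notin> W} = W" by (auto simp: W_def)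
  ultimately have "emeasure dV W = 0"
    using AE_iff_measurable[of W dV "\<lambda>q. q \<notin> W"] W\<Sigma> by (simp add: sets_dV)
  then have 0: "emeasure (coord_measure c) (snd c ` W) = 0"
    using emeasure_dV[OF c(1) W\<Sigma>] by (simp add: W_def)
  let ?O = "snd c ` W"
  have "W \<inter> fst c = W" by (auto simp: W_def)
  then have O: "open ?O" "?O \<subseteq> coord_image c" "?O \<noteq> {}"
    using open_chart_image[OF c(1) oW] ne c p by (auto simp: coord_image_def W_def)
  have "(\<integral>\<^sup>+x. ennreal (sqrt (det (g c x))) * indicator ?O x \<partial>lborel) = 0"
    using 0 O by (simp add: emeasure_coord_measure[OF c(1)])
  moreover have "(\<lambda>x. ennreal (sqrt (det (g c x))) * indicator ?O x) \<in> borel_measurable lborel"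
  proof -
    have "(\<lambda>x. indicator ?O x *\<^sub>R sqrt (det (g c x))) \<in> borel_measurable borel"
      using O by (intro borel_measurable_continuous_on_indicator continuous_on_subset[OF continuous_volume[OF c(1)]]) auto
    then have "(\<lambda>x. ennreal (indicator ?O x *\<^sub>R sqrt (det (g c x)))) \<in> borel_measurable lborel" by simp
    moreover have "(\<lambda>x. ennreal (indicator ?O x *\<^sub>R sqrt (det (g c x)))) = (\<lambda>x. ennreal (sqrt (det (g c x))) * indicator ?O x)"
      by (auto simp: indicator_def)
    ultimately show ?thesis by simp
  qed
  ultimately have "emeasure lborel {x. ennreal (sqrt (det (g c x))) * indicator ?O x \<noteq> 0} = 0"
    using nn_integral_0_iff by fastforce
  moreover have "{x. ennreal (sqrt (det (g c x))) * indicator ?O x \<noteq> 0} = ?O"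
  proof -
    have "sqrt (det (g c x)) > 0" if "x \<in> ?O" for x using det_metric_positive[OF c(1)] O(2) that by auto
    then show ?thesis by (force simp: indicator_def ennreal_eq_0_iff)
  qed
  ultimately have "emeasure lborel ?O = 0" by simp
  then have "?O \<in> null_sets lborel" using O(1) by (simp add: null_sets_def)
  then have "negligible ?O" using negligible_iff_null_sets null_sets_completionI by blast
  then show False using open_not_negligible O by blast
qed

text \<open>The restriction of \<open>dV\<close> to the chart domain is pushed forward by the chart
  to \<open>coord_measure c\<close>; by \<open>supp\<close> this restriction loses nothing.\<close>

lemma integral_chart:
  assumes c: "c \<in> A" and F: "continuous_map T euclideanreal F" and supp: "\<And>p. p \<in> topspace T \<Longrightarrow> p \<notin> fst c \<Longrightarrow> F p = 0"
  shows "(\<integral>p. F p \<partial>dV) = (\<integral>x. indicator (coord_image c) x * (sqrt (det (g c x)) * F (coord_inv c x)) \<partial>lborel)"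
proof -
  let ?R = "restrict_space dV (fst c)"
  let ?f = "\<lambda>x. indicator (coord_image c) x *\<^sub>R (F \<circ> coord_inv c) x"
  have cs: "fst c \<inter> space dV \<in> sets dV" "fst c \<in> sets dV" "fst c \<inter> topspace T = fst c"
    using chart_\<Sigma>[OF c] chart_subset[OF c] by (auto simp: sets_dV Int_absorb2)
  have spR: "space ?R = fst c" using cs by (simp add: space_restrict_space)
  have "snd c \<in> borel_measurable ?R"
  proof (rule borel_measurableI)
    fix V :: "(real^'n) set" assume "open V"
    from openin_\<Sigma>[OF openin_chart_preimage[OF c this]]
    have "{p \<in> fst c. snd c p \<in> V} \<in> sets ?R"
      using cs by (auto simp: sets_restrict_space_iff sets_dV)
    moreover have "snd c -` V \<inter> fst c = {p \<in> fst c. snd c p \<in> V}" by auto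
    ultimately show "snd c -` V \<inter> space ?R \<in> sets ?R" by (simp add: spR)
  qed
  note m = this
  have distr: "distr ?R borel (snd c) = coord_measure c"
  proof (rule measure_eqI)
    fix X assume "X \<in> sets (distr ?R borel (snd c))"
    then have X: "X \<in> sets borel" by simp
    let ?B = "snd c -` X \<inter> fst c"
    have B: "?B \<in> \<Sigma>"
      using measurable_sets[OF m X] cs by (auto simp: spR sets_restrict_space_iff sets_dV)
    have "emeasure (distr ?R borel (snd c)) X = emeasure ?R ?B" using m X by (simp add: emeasure_distr spR)
    also have "\<dots> = emeasure dV ?B" by (rule emeasure_restrict_space[OF cs(1)]) simp
    also have "\<dots> = emeasure (coord_measure c) (snd c ` ?B)" by (rule emeasure_dV[OF c B]) simp
    also have "snd c ` ?B = X \<inter> coord_image c" by (auto simp: coord_image_def)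
    also have "emeasure (coord_measure c) (X \<inter> coord_image c) = emeasure (coord_measure c) X"
      unfolding coord_measure_def using X measurable_volume[OF c] open_coord_image[OF c]
      by (simp add: emeasure_density, intro nn_integral_cong) (auto simp: indicator_def)
    finally show "emeasure (distr ?R borel (snd c)) X = emeasure (coord_measure c) X" .
  qed simp
  have mf: "?f \<in> borel_measurable borel"
    by (intro borel_measurable_continuous_on_indicator continuous_on_chart[OF F c])
      (use open_coord_image[OF c] in auto)
  have "(\<integral>p. F p \<partial>dV) = (\<integral>p. indicator (fst c) p *\<^sub>R F p \<partial>dV)"
    by (intro Bochner_Integration.integral_cong) (auto simp: indicator_def supp)
  also have "\<dots> = (\<integral>p. F p \<partial>?R)" by (rule integral_restrict_space[OF cs(1), symmetric])
  also have "\<dots> = (\<integral>p. ?f (snd c p) \<partial>?R)"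
    by (intro Bochner_Integration.integral_cong refl) (simp add: spR coord_in[OF c] coord_inv_chart[OF c])
  also have "\<dots> = (\<integral>x. ?f x \<partial>coord_measure c)"
    unfolding distr[symmetric] by (rule integral_distr[OF m mf, symmetric])
  also have "\<dots> = (\<integral>x. (indicator (coord_image c) x * sqrt (det (g c x))) *\<^sub>R ?f x \<partial>lborel)"
    unfolding coord_measure_def
    by (rule integral_density)
      (use mf measurable_volume[OF c] det_metric_positive[OF c] in \<open>auto simp: indicator_def intro!: AE_I2 less_imp_le\<close>)
  also have "\<dots> = (\<integral>x. indicator (coord_image c) x * (sqrt (det (g c x)) * F (coord_inv c x)) \<partial>lborel)"
    by (intro Bochner_Integration.integral_cong) (auto simp: indicator_def)
  finally show ?thesis .
qed

end

section \<open>The divergence theorem\<close>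

lemma Ck_on_ident: "Ck_on k (\<lambda>x. x) (S :: (real^'n::finite) set)"
proof (cases k)
  case (Suc j)
  have "partial i (\<lambda>x. x) = (\<lambda>x::real^'n. axis i 1)" for i
    using partial_eq[OF has_derivative_ident] by auto
  then show ?thesis by (simp add: Suc)
qed (simp add: continuous_on_id)

text \<open>A bump function of class \<open>C\<^sup>1\<close>, which is all the smoothness needed of a partition of unity here.\<close>

definition bump :: "real^'n::finite \<Rightarrow> real \<Rightarrow> real^'n \<Rightarrow> real" where
  "bump a r x = (max 0 (r\<^sup>2 - (x - a) \<bullet> (x - a)))\<^sup>2"

lemma has_derivative_max_square: "((\<lambda>t::real. (max 0 t)\<^sup>2) has_real_derivative 2 * max 0 t) (at t)"
proof -
  consider "t > 0" | "t < 0" | "t = 0" by linarith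
  then show ?thesis
  proof cases
    case 1
    have "((\<lambda>t::real. t\<^sup>2) has_real_derivative 2 * t) (at t)" by (auto intro!: derivative_eq_intros)
    then show ?thesis using 1
      by (simp, elim DERIV_cong_ev[THEN iffD1, rotated -1])
        (auto intro!: eventually_nhds_in_open[of "{0<..}" t, THEN eventually_mono])
  next
    case 2
    have "((\<lambda>t::real. 0) has_real_derivative 0) (at t)" by simp
    then show ?thesis using 2
      by (simp, elim DERIV_cong_ev[THEN iffD1, rotated -1])
        (auto intro!: eventually_nhds_in_open[of "{..<0}" t, THEN eventually_mono])
  next
    case 3
    have "((\<lambda>h::real. (max 0 h)\<^sup>2 / h) \<longlongrightarrow> 0) (at 0)"
    proof (rule Lim_null_comparison)
      show "\<forall>\<^sub>F h in at 0. norm ((max 0 h)\<^sup>2 / h) \<le> \<bar>h\<bar>"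
        by (intro always_eventually allI) (auto simp: max_def power2_eq_square)
      show "((\<lambda>h::real. \<bar>h\<bar>) \<longlongrightarrow> 0) (at 0)" by (intro tendsto_rabs_zero tendsto_ident_at)
    qed
    then show ?thesis using 3 by (simp add: DERIV_def)
  qed
qed

lemma Ck_bump:
  fixes a :: "real^'n::finite"
  shows "Ck_on 1 (bump a r) UNIV"
proof -
  let ?f = "\<lambda>x::real^'n. r\<^sup>2 - (x - a) \<bullet> (x - a)"
  have C: "Ck_on 1 ?f UNIV"
    by (intro Ck_on_diff Ck_on_inner Ck_on_ident Ck_on_const open_UNIV)
  then have d: "?f differentiable (at x)" for x by simp
  have p: "partial i (bump a r) x = 2 * max 0 (?f x) * partial i ?f x"
    and db: "bump a r differentiable (at x)" for i x
    using partial_compose_real[OF d has_derivative_max_square] by (simp_all add: bump_def[abs_def])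
  have "continuous_on UNIV (\<lambda>x. 2 * max 0 (?f x) * partial i ?f x)" for i
    using C by (intro continuous_intros) auto
  then show ?thesis using db by (simp add: p[abs_def])
qed

lemma bump_nonneg: "bump a r x \<ge> 0"
  and bump_zero: "r \<ge> 0 \<Longrightarrow> x \<notin> cball a r \<Longrightarrow> bump a r x = 0"
  and bump_center: "r > 0 \<Longrightarrow> bump a r a > 0"
proof -
  show "bump a r x \<ge> 0" "r > 0 \<Longrightarrow> bump a r a > 0" by (simp_all add: bump_def)
  assume r: "r \<ge> 0" "x \<notin> cball a r"
  then have "r\<^sup>2 \<le> (norm (x - a))\<^sup>2" by (intro power_mono) (auto simp: dist_norm norm_minus_commute)
  then show "bump a r x = 0" by (simp add: bump_def power2_norm_eq_inner)
qed

lemma covariant_derivative_zero: "covariant_derivative h (\<lambda>x. 0) x = 0"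
  by (simp add: covariant_derivative_def vec_eq_iff)

context riemannian_manifold
begin

text \<open>C^1 is the class preserved by multiplication with the bump functions, and it is enough
  for the divergence to be continuous.\<close>

definition C1_field :: "(('a, 'n) chart \<Rightarrow> real^'n \<Rightarrow> real^'n) \<Rightarrow> bool" where
  "C1_field V \<longleftrightarrow> (\<forall>c\<in>A. Ck_on 1 (V c) (coord_image c)) \<and>
     (\<forall>c\<in>A. \<forall>d\<in>A. \<forall>p\<in>fst c \<inter> fst d.
        V d (snd d p) = jacobian (transition c d) (at (snd c p)) *v V c (snd c p))"

definition C1_function :: "('a \<Rightarrow> real) \<Rightarrow> bool" where
  "C1_function f \<longleftrightarrow> (\<forall>c\<in>A. Ck_on 1 (f \<circ> coord_inv c) (coord_image c))"

definition div_field :: "(('a, 'n) chart \<Rightarrow> real^'n \<Rightarrow> real^'n) \<Rightarrow> 'a \<Rightarrow> real" where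
  "div_field V = scalar_of A (\<lambda>c. divergence (g c) (V c))"

definition scale_field :: "('a \<Rightarrow> real) \<Rightarrow> (('a, 'n) chart \<Rightarrow> real^'n \<Rightarrow> real^'n) \<Rightarrow> ('a, 'n) chart \<Rightarrow> real^'n \<Rightarrow> real^'n" where
  "scale_field f V c x = (f \<circ> coord_inv c) x *\<^sub>R V c x"

lemma C1_fieldD: "C1_field V \<Longrightarrow> c \<in> A \<Longrightarrow> Ck_on 1 (V c) (coord_image c)"
  "C1_field V \<Longrightarrow> c \<in> A \<Longrightarrow> d \<in> A \<Longrightarrow> p \<in> fst c \<Longrightarrow> p \<in> fst d \<Longrightarrow>
        V d (snd d p) = jacobian (transition c d) (at (snd c p)) *v V c (snd c p)"
  unfolding C1_field_def by blast+

lemma C1_field_differentiable: "C1_field V \<Longrightarrow> c \<in> A \<Longrightarrow> x \<in> coord_image c \<Longrightarrow> V c differentiable (at x)"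
  using C1_fieldD(1) by simp

lemma field_transition:
  assumes V: "\<And>p. p \<in> fst c \<Longrightarrow> p \<in> fst d \<Longrightarrow> V d (snd d p) = jacobian (transition c d) (at (snd c p)) *v V c (snd c p)"
    and c: "c \<in> A" and y: "y \<in> overlap c d"
  shows "V d (transition c d y) = jacobian (transition c d) (at y) *v V c y"
proof -
  obtain q where q: "q \<in> fst c" "q \<in> fst d" "y = snd c q" using y unfolding overlap_def by blast
  show ?thesis unfolding q(3) transition_chart[OF c q(1)] by (rule V[OF q(1,2)])
qed

lemma overlap_in: "p \<in> fst c \<Longrightarrow> p \<in> fst d \<Longrightarrow> snd c p \<in> overlap c d"
  by (simp add: overlap_def)

lemma div_field_eq:
  assumes V: "C1_field V" and c: "c \<in> A" and p: "p \<in> fst c"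
  shows "div_field V p = divergence (g c) (V c) (snd c p)"
  unfolding div_field_def
proof (rule scalar_of_eq[OF c p])
  fix c d assume c: "c \<in> A" and d: "d \<in> A" and p: "p \<in> fst c" "p \<in> fst d"
  interpret ch: chart_change "overlap c d" "g c" "coord_image d" "g d" "transition c d"
    by (rule chart_change[OF c d])
  have "divergence (g c) (V c) (snd c p) = divergence (g d) (V d) (transition c d (snd c p))"
  proof (rule ch.divergence_change)
    show "snd c p \<in> overlap c d" by (rule overlap_in[OF p])
    show "V c differentiable (at (snd c p))" by (rule C1_field_differentiable[OF V c coord_in[OF c p(1)]])
    show "V d differentiable (at (transition c d (snd c p)))"
      unfolding transition_chart[OF c p(1)] by (rule C1_field_differentiable[OF V d coord_in[OF d p(2)]])
    show "V d (transition c d y) = ch.J y *v V c y" if "y \<in> overlap c d" for y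
      unfolding ch.J_def by (rule field_transition[OF C1_fieldD(2)[OF V c d] c that])
  qed
  then show "divergence (g c) (V c) (snd c p) = divergence (g d) (V d) (snd d p)"
    by (simp only: transition_chart[OF c p(1)])
qed

lemma continuous_div_field:
  assumes V: "C1_field V"
  shows "continuous_map T euclideanreal (div_field V)"
proof (rule continuous_map_charts)
  fix c assume c: "c \<in> A"
  interpret local_metric "coord_image c" "g c" by (rule chart_metric[OF c])
  have "continuous_on (coord_image c) (divergence (g c) (V c))"
    using Ck_on_continuous[OF Ck_divergence[of 0]] C1_fieldD(1)[OF V c] by (simp add: One_nat_def)
  moreover have "(div_field V \<circ> coord_inv c) x = divergence (g c) (V c) x" if "x \<in> coord_image c" for x
    using div_field_eq[OF V c coord_inv_in[OF c that]] chart_coord_inv[OF c that] by simp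
  ultimately show "continuous_on (coord_image c) (div_field V \<circ> coord_inv c)"
    by (simp cong: continuous_on_cong)
qed

lemma C1_function_continuous: "C1_function f \<Longrightarrow> continuous_map T euclideanreal f"
  using continuous_map_charts Ck_on_continuous unfolding C1_function_def by blast

lemma C1_scale_field:
  assumes f: "C1_function f" and V: "C1_field V"
  shows "C1_field (scale_field f V)"
  unfolding C1_field_def
proof (intro conjI ballI)
  fix c assume c: "c \<in> A"
  show "Ck_on 1 (scale_field f V c) (coord_image c)"
  proof -
    have "Ck_on 1 (f \<circ> coord_inv c) (coord_image c)" using f c unfolding C1_function_def by blast
    from Ck_on_scaleR[OF open_coord_image[OF c] this C1_fieldD(1)[OF V c]]
    show ?thesis unfolding scale_field_def[abs_def] .
  qed
  fix d p assume d: "d \<in> A" and p: "p \<in> fst c \<inter> fst d"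
  then show "scale_field f V d (snd d p) = jacobian (transition c d) (at (snd c p)) *v scale_field f V c (snd c p)"
    using C1_fieldD(2)[OF V c d, of p] coord_inv_chart[OF c, of p] coord_inv_chart[OF d, of p]
    by (simp add: scale_field_def matrix_vector_mult_scaleR)
qed

lemma divergence_scale_field:
  assumes f: "C1_function f" and V: "C1_field V" and c: "c \<in> A" and p: "p \<in> fst c"
  shows "divergence (g c) (scale_field f V c) (snd c p)
    = f p * divergence (g c) (V c) (snd c p) + (\<Sum>i\<in>UNIV. partial i (f \<circ> coord_inv c) (snd c p) * V c (snd c p) $ i)"
proof -
  interpret local_metric "coord_image c" "g c" by (rule chart_metric[OF c])
  have x: "snd c p \<in> coord_image c" by (rule coord_in[OF c p])
  have "(f \<circ> coord_inv c) differentiable (at (snd c p))" using f c x by (simp add: C1_function_def)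
  from divergence_scaleR[OF this C1_field_differentiable[OF V c x]] show ?thesis
    unfolding scale_field_def[abs_def] by (simp add: coord_inv_chart[OF c p])
qed

lemma continuous_coord_inv: assumes c: "c \<in> A" shows "continuous_map (top_of_set (coord_image c)) T (coord_inv c)"
  unfolding continuous_map_def
proof (intro conjI allI impI)
  show "coord_inv c \<in> topspace (top_of_set (coord_image c)) \<rightarrow> topspace T"
    using coord_inv_in[OF c] chart_subset[OF c] by auto
  fix U assume "openin T U"
  from open_chart_image[OF c this] have "open (snd c ` (U \<inter> fst c))" .
  moreover have "{x \<in> topspace (top_of_set (coord_image c)). coord_inv c x \<in> U} = snd c ` (U \<inter> fst c)"
  proof (intro equalityI subsetI)
    fix x assume "x \<in> {x \<in> topspace (top_of_set (coord_image c)). coord_inv c x \<in> U}"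
    then have x: "x \<in> coord_image c" "coord_inv c x \<in> U" by auto
    then show "x \<in> snd c ` (U \<inter> fst c)"
      by (intro image_eqI[of _ _ "coord_inv c x"]) (simp_all add: chart_coord_inv[OF c] coord_inv_in[OF c])
  qed (auto simp: coord_inv_chart[OF c] coord_in[OF c])
  moreover have "snd c ` (U \<inter> fst c) \<subseteq> coord_image c" by (auto simp: coord_image_def)
  ultimately show "openin (top_of_set (coord_image c)) {x \<in> topspace (top_of_set (coord_image c)). coord_inv c x \<in> U}"
    by (simp add: openin_open_eq[OF open_coord_image[OF c]])
qed

text \<open>The preimage of \<open>K\<close> is compact, hence closed by the Hausdorff property.
  This is what makes extension by zero from a chart to the manifold legitimate.\<close>

lemma openin_off_compact:
  assumes c: "c \<in> A" and K: "compact K" "K \<subseteq> coord_image c"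
  shows "openin T (topspace T - {q \<in> fst c. snd c q \<in> K})"
proof -
  have "compactin (top_of_set (coord_image c)) K" using K by (simp add: compactin_subtopology)
  from image_compactin[OF this continuous_coord_inv[OF c]] have "compactin T (coord_inv c ` K)" .
  moreover have "Hausdorff_space T" using manifold by (simp add: smooth_manifold_def)
  ultimately have "closedin T (coord_inv c ` K)" by (rule compactin_imp_closedin[rotated])
  moreover have "coord_inv c ` K = {q \<in> fst c. snd c q \<in> K}"
  proof (intro equalityI subsetI)
    fix q assume "q \<in> {q \<in> fst c. snd c q \<in> K}"
    then show "q \<in> coord_inv c ` K"
      by (intro image_eqI[of _ _ "snd c q"]) (simp_all add: coord_inv_chart[OF c])
  qed (use K(2) in \<open>auto simp: coord_inv_in[OF c] chart_coord_inv[OF c] subset_iff\<close>)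
  ultimately show ?thesis by (simp add: openin_diff)
qed

text \<open>In any chart, the bump function is locally either expressed through the chart \<open>c\<close> or zero.\<close>

lemma ex_C1_bump:
  assumes p: "p \<in> topspace T"
  shows "\<exists>c\<in>A. \<exists>K b. compact K \<and> K \<subseteq> coord_image c \<and> C1_function b \<and> (\<forall>q. 0 \<le> b q) \<and> 0 < b p \<and>
    (\<forall>q. \<not> (q \<in> fst c \<and> snd c q \<in> K) \<longrightarrow> b q = 0)"
proof -
  obtain c where c: "c \<in> A" "p \<in> fst c" using cover[OF p] by blast
  obtain r where r: "r > 0" "cball (snd c p) r \<subseteq> coord_image c"
    using open_coord_image[OF c(1)] c(2) coord_in[OF c] by (meson open_contains_cball)
  let ?K = "cball (snd c p) r"
  define b where "b q = (if q \<in> fst c then bump (snd c p) r (snd c q) else 0)" for q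
  have b0: "b q = 0" if "\<not> (q \<in> fst c \<and> snd c q \<in> ?K)" for q
    using that bump_zero[of r "snd c q" "snd c p"] r(1) by (auto simp: b_def)
  have "C1_function b"
    unfolding C1_function_def
  proof (intro ballI Ck_on_local)
    fix d assume d: "d \<in> A"
    show "open (coord_image d)" by (rule open_coord_image[OF d])
    fix y assume y: "y \<in> coord_image d"
    interpret ch: chart_change "overlap d c" "g d" "coord_image c" "g c" "transition d c"
      by (rule chart_change[OF d c(1)])
    show "\<exists>U. open U \<and> y \<in> U \<and> Ck_on 1 (b \<circ> coord_inv d) U"
    proof (cases "coord_inv d y \<in> fst c")
      case True
      have "Ck_on 1 (\<lambda>x. bump (snd c p) r (transition d c x)) (overlap d c)"
        by (rule Ck_on_compose[OF ch.src.open_S _ ch.smooth_\<psi> Ck_bump]) simp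
      moreover have "(b \<circ> coord_inv d) x = bump (snd c p) r (transition d c x)" if "x \<in> overlap d c" for x
        using that overlap_iff[OF d] by (simp add: b_def transition_def)
      ultimately have "Ck_on 1 (b \<circ> coord_inv d) (overlap d c)"
        using Ck_on_cong[OF ch.src.open_S, of "b \<circ> coord_inv d" "\<lambda>x. bump (snd c p) r (transition d c x)"] by blast
      then show ?thesis using ch.src.open_S overlap_iff[OF d, of y c] y True by blast
    next
      case False
      \<comment> \<open>The complement of the support: open by \<open>openin_off_compact\<close>,
        and containing the point because it lies outside the domain of \<open>c\<close>.\<close>
      let ?W = "topspace T - {q \<in> fst c. snd c q \<in> ?K}"
      have oU: "open (snd d ` (?W \<inter> fst d))"
        by (rule open_chart_image[OF d openin_off_compact[OF c(1) compact_cball r(2)]])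
      have "coord_inv d y \<in> ?W \<inter> fst d" using False coord_inv_in[OF d y] chart_subset[OF d] by auto
      then have "snd d (coord_inv d y) \<in> snd d ` (?W \<inter> fst d)" by (rule imageI)
      then have yU: "y \<in> snd d ` (?W \<inter> fst d)" by (simp only: chart_coord_inv[OF d y])
      have "(b \<circ> coord_inv d) x = 0" if x: "x \<in> snd d ` (?W \<inter> fst d)" for x
      proof -
        obtain q where q: "q \<in> ?W" "q \<in> fst d" "x = snd d q" using x by blast
        then show ?thesis using b0[of q] by (simp add: coord_inv_chart[OF d q(2)])
      qed
      then have "Ck_on 1 (b \<circ> coord_inv d) (snd d ` (?W \<inter> fst d))"
        using Ck_on_cong[OF oU, of "b \<circ> coord_inv d" "\<lambda>x. 0"] Ck_on_const by blast
      then show ?thesis using oU yU by blast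
    qed
  qed
  moreover have "0 \<le> b q" for q by (simp add: b_def bump_nonneg)
  moreover have "0 < b p" using bump_center[OF r(1)] c(2) by (simp add: b_def)
  ultimately show ?thesis
    by (intro bexI[OF _ c(1)] exI[of _ ?K] exI[of _ b] conjI allI impI r(2) compact_cball b0)
qed

end

context compact_riemannian_manifold
begin

text \<open>In the chart \<open>c\<close> the integrand, including the volume density, is a sum of
  partial derivatives of compactly supported C^1 functions, each of which integrates to
  zero.\<close>

lemma integral_div_field_supported:
  assumes V: "C1_field V" and c: "c \<in> A" and K: "compact K" "K \<subseteq> coord_image c"
    and zero: "\<And>d q. d \<in> A \<Longrightarrow> q \<in> fst d \<Longrightarrow> \<not> (q \<in> fst c \<and> snd c q \<in> K) \<Longrightarrow> V d (snd d q) = 0"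
  shows "(\<integral>p. div_field V p \<partial>dV) = 0"
proof -
  interpret local_metric "coord_image c" "g c" by (rule chart_metric[OF c])
  let ?W = "topspace T - {q \<in> fst c. snd c q \<in> K}"
  \<comment> \<open>Seen in another chart \<open>d\<close>, the field vanishes on a whole
    neighbourhood of such a point, and so does its divergence.\<close>
  have "div_field V q = 0" if q: "q \<in> topspace T" "q \<notin> fst c" for q
  proof -
    obtain d where d: "d \<in> A" "q \<in> fst d" using cover[OF q(1)] by blast
    have oU: "open (snd d ` (?W \<inter> fst d))"
      by (rule open_chart_image[OF d(1) openin_off_compact[OF c K]])
    have "q \<in> ?W \<inter> fst d" using q d by auto
    then have qU: "snd d q \<in> snd d ` (?W \<inter> fst d)" by (rule imageI)
    have "V d x = 0" if x: "x \<in> snd d ` (?W \<inter> fst d)" for x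
    proof -
      obtain q' where q': "q' \<in> ?W" "q' \<in> fst d" "x = snd d q'" using x by blast
      show ?thesis unfolding q'(3) by (rule zero[OF d(1) q'(2)]) (use q'(1) in blast)
    qed
    from covariant_derivative_cong[OF oU qU this]
    show ?thesis unfolding div_field_eq[OF V d] divergence_def by (simp add: covariant_derivative_zero trace_def)
  qed
  note outside = this
  \<comment> \<open>The components of the field weighted by the volume density, extended by zero
    from the chart image to all of Euclidean space.\<close>
  define F where "F i x = indicator (coord_image c) x * (volume_density x * V c x $ i)" for i x
  have F: "F i x = volume_density x * V c x $ i" if "x \<in> coord_image c" for i x
    using that by (simp add: F_def)
  have F0: "F i y = 0" if y: "y \<notin> K" for y i
  proof (cases "y \<in> coord_image c")
    case True
    then have "V c (snd c (coord_inv c y)) = 0"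
      by (intro zero[OF c coord_inv_in[OF c True]]) (use y True chart_coord_inv[OF c True] in auto)
    then show ?thesis using chart_coord_inv[OF c True] by (simp add: F_def)
  qed (simp add: F_def)
  have off: "open (- K)" "x \<notin> coord_image c \<Longrightarrow> x \<in> - K" for x
    using K by (auto simp: open_Compl compact_imp_closed)
  have "(\<integral>p. div_field V p \<partial>dV)
    = (\<integral>x. indicator (coord_image c) x * (sqrt (det (g c x)) * div_field V (coord_inv c x)) \<partial>lborel)"
    by (rule integral_chart[OF c continuous_div_field[OF V] outside])
  also have "\<dots> = (\<integral>x. (\<Sum>i\<in>UNIV. partial i (F i) x) \<partial>lborel)"
  proof (intro Bochner_Integration.integral_cong refl)
    fix x
    show "indicator (coord_image c) x * (sqrt (det (g c x)) * div_field V (coord_inv c x)) = (\<Sum>i\<in>UNIV. partial i (F i) x)"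
    proof (cases "x \<in> coord_image c")
      case True
      have "partial i (F i) x = partial i (\<lambda>x. volume_density x * V c x $ i) x" for i
        by (rule partial_cong[OF open_S True F])
      moreover have "div_field V (coord_inv c x) = divergence (g c) (V c) x"
        using div_field_eq[OF V c coord_inv_in[OF c True]] chart_coord_inv[OF c True] by simp
      ultimately show ?thesis
        using divergence_volume_density[OF True C1_field_differentiable[OF V c True]] True
        by (simp add: volume_density_def)
    next
      case False
      have "partial i (F i) x = partial i (\<lambda>x. 0) x" for i
        by (rule partial_cong[OF off(1) off(2)[OF False]]) (simp add: F0)
      then show ?thesis using False by simp
    qed
  qed
  also have "\<dots> = 0"
  proof -
    have "integrable lborel (partial i (F i)) \<and> (\<integral>x. partial i (F i) x \<partial>lborel) = 0" for i
    proof -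
      have "Ck_on 1 (F i) UNIV"
      proof (rule Ck_on_local[OF open_UNIV])
        fix x
        show "\<exists>U. open U \<and> x \<in> U \<and> Ck_on 1 (F i) U"
        proof (cases "x \<in> coord_image c")
          case True
          have "Ck_on 1 (\<lambda>x. volume_density x * V c x $ i) (coord_image c)"
            by (intro Ck_on_mult Ck_on_nth open_S Ck_volume_density C1_fieldD(1)[OF V c])
          then have "Ck_on 1 (F i) (coord_image c)" using Ck_on_cong[OF open_S, of "F i" "\<lambda>x. volume_density x * V c x $ i"] F by blast
          then show ?thesis using open_S True by blast
        next
          case False
          have "Ck_on 1 (F i) (- K)" using Ck_on_cong[OF off(1), of "F i" "\<lambda>x. 0"] F0 by simp
          then show ?thesis using off False by blast
        qed
      qed
      from integral_partial_compact_support[OF this K(1) F0] show ?thesis by blast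
    qed
    then show ?thesis by (subst Bochner_Integration.integral_sum) auto
  qed
  finally show ?thesis .
qed

text \<open>Instead of normalising the bump functions, the field is divided once by their positive
  sum \<beta>; its products with the single bump functions add up to \<open>V\<close> and are each
  supported in one chart.\<close>

theorem divergence_theorem:
  assumes V: "C1_field V"
  shows "(\<integral>p. div_field V p \<partial>dV) = 0"
proof -
  define good where "good p c K b \<longleftrightarrow> c \<in> A \<and> compact K \<and> K \<subseteq> coord_image c \<and> C1_function b \<and> (\<forall>q. 0 \<le> b q) \<and> 0 < b p \<and>
    (\<forall>q. \<not> (q \<in> fst c \<and> snd c q \<in> K) \<longrightarrow> b q = 0)" for p c K and b :: "'a \<Rightarrow> real"
  have "\<exists>c K b. good p c K b" if "p \<in> topspace T" for p
    unfolding good_def using ex_C1_bump[OF that] by blast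
  then obtain c K b where good: "\<And>p. p \<in> topspace T \<Longrightarrow> good p (c p) (K p) (b p)" by metis
  have b: "c p \<in> A" "compact (K p)" "K p \<subseteq> coord_image (c p)" "C1_function (b p)" "0 \<le> b p q" "0 < b p p"
    "\<not> (q \<in> fst (c p) \<and> snd (c p) q \<in> K p) \<Longrightarrow> b p q = 0" if "p \<in> topspace T" for p q
    using good[OF that] unfolding good_def by blast+
  let ?U = "\<lambda>p. {q \<in> topspace T. b p q \<in> {0<..}}"
  have op: "openin T (?U p) \<and> p \<in> ?U p" if "p \<in> topspace T" for p
    using openin_continuous_map_preimage[OF C1_function_continuous[OF b(4)[OF that]], of "{0<..}"] b(6)[OF that] that
    by simp
  obtain P where P: "finite P" "P \<subseteq> topspace T" "topspace T = (\<Union>p\<in>P. ?U p)"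
    by (rule finite_open_cover[of ?U, OF op])
  define \<beta> where "\<beta> q = (\<Sum>p\<in>P. b p q)" for q
  have \<beta>: "\<beta> q > 0" if q: "q \<in> topspace T" for q
  proof -
    obtain p where p: "p \<in> P" "b p q > 0" using q P(3) by blast
    have "0 < b p q" by (rule p(2))
    also have "\<dots> \<le> \<beta> q"
      unfolding \<beta>_def by (rule member_le_sum[OF p(1)]) (use b(5) P in auto)
    finally show ?thesis .
  qed
  have C\<beta>: "C1_function (\<lambda>q. inverse (\<beta> q))"
    unfolding C1_function_def
  proof
    fix d assume d: "d \<in> A"
    have "Ck_on 1 (\<lambda>x. inverse (\<Sum>p\<in>P. (b p \<circ> coord_inv d) x)) (coord_image d)"
    proof (intro Ck_on_inverse Ck_on_sum open_coord_image[OF d])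
      show "Ck_on 1 (b p \<circ> coord_inv d) (coord_image d)" if "p \<in> P" for p
        using b(4)[of p] that P(2) d by (auto simp: C1_function_def)
      show "(\<Sum>p\<in>P. (b p \<circ> coord_inv d) x) \<noteq> 0" if "x \<in> coord_image d" for x
        using \<beta>[of "coord_inv d x"] coord_inv_in[OF d that] chart_subset[OF d] by (auto simp: \<beta>_def)
    qed
    then show "Ck_on 1 ((\<lambda>q. inverse (\<beta> q)) \<circ> coord_inv d) (coord_image d)"
      by (simp add: \<beta>_def comp_def)
  qed
  define W where "W = scale_field (\<lambda>q. inverse (\<beta> q)) V"
  have W: "C1_field W" unfolding W_def by (rule C1_scale_field[OF C\<beta> V])
  have bW: "C1_field (scale_field (b p) W)" if "p \<in> P" for p
    using C1_scale_field[OF b(4) W] that P(2) by blast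
  have "div_field V q = (\<Sum>p\<in>P. div_field (scale_field (b p) W) q)" if q: "q \<in> topspace T" for q
  proof -
    obtain d where d: "d \<in> A" "q \<in> fst d" using cover[OF q] by blast
    interpret local_metric "coord_image d" "g d" by (rule chart_metric[OF d(1)])
    have x: "snd d q \<in> coord_image d" by (rule coord_in[OF d])
    have "V d y = (\<Sum>p\<in>P. scale_field (b p) W d y)" if y: "y \<in> coord_image d" for y
    proof -
      have "\<beta> (coord_inv d y) \<noteq> 0" using \<beta>[of "coord_inv d y"] coord_inv_in[OF d(1) y] chart_subset[OF d(1)] by auto
      moreover have "(\<Sum>p\<in>P. scale_field (b p) W d y) = (\<beta> (coord_inv d y) * inverse (\<beta> (coord_inv d y))) *\<^sub>R V d y"
        by (simp add: scale_field_def W_def \<beta>_def scaleR_sum_left[symmetric] sum_distrib_right[symmetric])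
      ultimately show ?thesis by simp
    qed
    then have "divergence (g d) (V d) (snd d q) = divergence (g d) (\<lambda>y. \<Sum>p\<in>P. scale_field (b p) W d y) (snd d q)"
      unfolding divergence_def by (intro arg_cong[where f=trace] covariant_derivative_cong[OF open_S x])
    also have "\<dots> = (\<Sum>p\<in>P. divergence (g d) (scale_field (b p) W d) (snd d q))"
      by (rule divergence_sum) (rule C1_field_differentiable[OF bW d(1) x])
    finally show ?thesis unfolding div_field_eq[OF V d]
      by (simp add: div_field_eq[OF bW d])
  qed
  then have "(\<integral>p. div_field V p \<partial>dV) = (\<integral>q. (\<Sum>p\<in>P. div_field (scale_field (b p) W) q) \<partial>dV)"
    by (intro Bochner_Integration.integral_cong) auto
  also have "\<dots> = (\<Sum>p\<in>P. \<integral>q. div_field (scale_field (b p) W) q \<partial>dV)"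
    by (rule Bochner_Integration.integral_sum) (rule integrable_continuous[OF continuous_div_field[OF bW]])
  also have "\<dots> = 0"
  proof (intro sum.neutral ballI)
    fix p assume p: "p \<in> P"
    then have pT: "p \<in> topspace T" using P(2) by blast
    show "(\<integral>q. div_field (scale_field (b p) W) q \<partial>dV) = 0"
    proof (rule integral_div_field_supported[OF bW[OF p] b(1,2,3)[OF pT]])
      fix d q assume "d \<in> A" "q \<in> fst d" "\<not> (q \<in> fst (c p) \<and> snd (c p) q \<in> K p)"
      then show "scale_field (b p) W d (snd d q) = 0"
        using b(7)[OF pT, of q] by (simp add: scale_field_def coord_inv_chart)
    qed
  qed
  finally show ?thesis .
qed

end

section \<open>Almost Yamabe solitons\<close>

text \<open>\<open>n\<close> is the dimension as a real number, so that coefficients such as 2 - n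
  and n (n - 1) can be negative or multiplied without conversions.\<close>

locale compact_almost_yamabe_soliton = compact_riemannian_manifold T A g
  for T :: "'a topology" and A :: "('a, 'n::finite) chart set" and g +
  fixes X :: "('a, 'n) chart \<Rightarrow> real^'n \<Rightarrow> real^'n" and \<rho> :: "'a \<Rightarrow> real" and n :: real
  assumes soliton: "almost_yamabe_soliton T A g X \<rho>" and n_eq: "n = real CARD('n)"
begin

abbreviation R where "R \<equiv> scalar_curvature A g"

definition \<phi> where "\<phi> p = R p - \<rho> p"

lemma smooth_X: "c \<in> A \<Longrightarrow> Ck_on k (X c) (coord_image c)"
  using soliton by (simp add: almost_yamabe_soliton_def smooth_vector_field_def smooth_on_imp_Ck_on)

lemma differentiable_X: "c \<in> A \<Longrightarrow> x \<in> coord_image c \<Longrightarrow> X c differentiable (at x)"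
  by (rule Ck_on_differentiable[OF smooth_X])

lemma C1_X: "C1_field X"
  using soliton smooth_X unfolding almost_yamabe_soliton_def smooth_vector_field_def C1_field_def by blast

lemma C1_\<rho>: "C1_function \<rho>"
  using soliton unfolding almost_yamabe_soliton_def smooth_function_def C1_function_def
  by (blast intro: smooth_on_imp_Ck_on)

lemma R_chart: assumes c: "c \<in> A" and p: "p \<in> fst c" shows "R p = scal (g c) (snd c p)"
  unfolding scalar_curvature_def
proof (rule scalar_of_eq[OF c p])
  fix c d assume c: "c \<in> A" and d: "d \<in> A" and p: "p \<in> fst c" "p \<in> fst d"
  interpret ch: chart_change "overlap c d" "g c" "coord_image d" "g d" "transition c d"
    by (rule chart_change[OF c d])
  show "scal (g c) (snd c p) = scal (g d) (snd d p)"
    using ch.scal_change[OF overlap_in[OF p]] by (simp only: transition_chart[OF c p(1)])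
qed

lemma R_coord: "c \<in> A \<Longrightarrow> x \<in> coord_image c \<Longrightarrow> (R \<circ> coord_inv c) x = scal (g c) x"
  by (simp add: R_chart[OF _ coord_inv_in] chart_coord_inv)

lemma C1_R: "C1_function R"
  unfolding C1_function_def
proof
  fix c assume c: "c \<in> A"
  interpret local_metric "coord_image c" "g c" by (rule chart_metric[OF c])
  show "Ck_on 1 (R \<circ> coord_inv c) (coord_image c)"
    using Ck_on_cong[OF open_S, of "R \<circ> coord_inv c" "scal (g c)"] R_coord[OF c] Ck_scal by simp
qed

lemma C1_n\<phi>: "C1_function (\<lambda>p. n * \<phi> p)"
  unfolding C1_function_def
proof
  fix c assume c: "c \<in> A"
  have C: "Ck_on 1 (R \<circ> coord_inv c) (coord_image c)" "Ck_on 1 (\<rho> \<circ> coord_inv c) (coord_image c)"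
    using C1_R C1_\<rho> c unfolding C1_function_def by blast+
  have "Ck_on 1 (\<lambda>x. n * ((R \<circ> coord_inv c) x - (\<rho> \<circ> coord_inv c) x)) (coord_image c)"
    by (intro Ck_on_mult Ck_on_diff Ck_on_const open_coord_image[OF c] C)
  then show "Ck_on 1 ((\<lambda>p. n * \<phi> p) \<circ> coord_inv c) (coord_image c)"
    by (simp only: \<phi>_def comp_def)
qed

lemma continuous_R: "continuous_map T euclideanreal R"
  and continuous_\<rho>: "continuous_map T euclideanreal \<rho>"
  by (rule C1_function_continuous[OF C1_R], rule C1_function_continuous[OF C1_\<rho>])

lemma continuous_\<phi>: "continuous_map T euclideanreal \<phi>"
  unfolding \<phi>_def[abs_def] by (intro continuous_map_diff continuous_R continuous_\<rho>)

text \<open>This is the skew endomorphism \<open>N\<close> of the overview: subtracting \<phi> times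
  the identity removes the entire symmetric part of the covariant derivative.\<close>

definition deformation :: "('a, 'n) chart \<Rightarrow> 'a \<Rightarrow> real^'n^'n" where
  "deformation c p = covariant_derivative (g c) (X c) (snd c p) - \<phi> p *\<^sub>R mat 1"

lemma lie_derivative_X:
  assumes c: "c \<in> A" and p: "p \<in> fst c"
  shows "lie_derivative (X c) (g c) (snd c p) = (2 * \<phi> p) *\<^sub>R g c (snd c p)"
proof -
  have "(1/2) *\<^sub>R lie_derivative (X c) (g c) (snd c p) = \<phi> p *\<^sub>R g c (snd c p)"
    using soliton c p unfolding almost_yamabe_soliton_def \<phi>_def by blast
  from arg_cong[OF this, of "\<lambda>M. 2 *\<^sub>R M"] show ?thesis by simp
qed

lemma deformation_skew:
  assumes c: "c \<in> A" and p: "p \<in> fst c"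
  shows "transpose (g c (snd c p) ** deformation c p) = - (g c (snd c p) ** deformation c p)"
proof -
  interpret local_metric "coord_image c" "g c" by (rule chart_metric[OF c])
  have x: "snd c p \<in> coord_image c" by (rule coord_in[OF c p])
  let ?h = "g c (snd c p)" and ?C = "covariant_derivative (g c) (X c) (snd c p)"
  have "?h ** ?C + transpose (?h ** ?C) = (2 * \<phi> p) *\<^sub>R ?h"
    using lie_derivative_eq[OF x differentiable_X[OF c x]] lie_derivative_X[OF c p] by simp
  moreover have "(2 * \<phi> p) *\<^sub>R ?h = \<phi> p *\<^sub>R ?h + \<phi> p *\<^sub>R ?h"
    by (simp add: scaleR_left_distrib[symmetric])
  ultimately have "transpose (?h ** ?C) - \<phi> p *\<^sub>R ?h = - (?h ** ?C - \<phi> p *\<^sub>R ?h)"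
    by (simp add: algebra_simps)
  moreover have "?h ** deformation c p = ?h ** ?C - \<phi> p *\<^sub>R ?h"
    by (simp add: deformation_def matrix_mult.diff_right)
  ultimately show ?thesis by (simp add: transpose_diff transpose_scalar symmetric[OF x])
qed

text \<open>For a self-adjoint \<open>M\<close> the product is a symmetric matrix, obtained by
  raising both indices of the lowered \<open>M\<close>, times the skew lowered \<open>N\<close>. It
  is used for the identity and for the Ricci operator.\<close>

lemma trace_mult_deformation:
  assumes c: "c \<in> A" and p: "p \<in> fst c" and M: "transpose (g c (snd c p) ** M) = g c (snd c p) ** M"
  shows "trace (M ** deformation c p) = 0"
proof -
  interpret local_metric "coord_image c" "g c" by (rule chart_metric[OF c])
  have x: "snd c p \<in> coord_image c" by (rule coord_in[OF c p])
  let ?h = "g c (snd c p)" and ?G = "matrix_inv (g c (snd c p))" and ?N = "deformation c p"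
  have "transpose (?G ** (?h ** M) ** ?G) = ?G ** (?h ** M) ** ?G"
    by (simp add: matrix_transpose_mul G_symmetric[OF x] M[unfolded matrix_transpose_mul] matrix_mul_assoc)
  then have "trace ((?G ** (?h ** M) ** ?G) ** (?h ** ?N)) = 0"
    by (rule trace_symmetric_mult_skew[OF _ deformation_skew[OF c p]])
  moreover have "(?G ** (?h ** M) ** ?G) ** (?h ** ?N) = (?G ** ?h) ** M ** (?G ** ?h) ** ?N"
    by (simp only: matrix_mul_assoc)
  ultimately show ?thesis by (simp add: x)
qed

lemma trace_deformation: assumes c: "c \<in> A" and p: "p \<in> fst c" shows "trace (deformation c p) = 0"
proof -
  interpret local_metric "coord_image c" "g c" by (rule chart_metric[OF c])
  show ?thesis
    using trace_mult_deformation[OF c p, of "mat 1"] symmetric[OF coord_in[OF c p]] by simp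
qed

lemma covariant_derivative_X: "covariant_derivative (g c) (X c) (snd c p) = \<phi> p *\<^sub>R mat 1 + deformation c p"
  by (simp add: deformation_def)

lemma divergence_X: "c \<in> A \<Longrightarrow> p \<in> fst c \<Longrightarrow> divergence (g c) (X c) (snd c p) = n * \<phi> p"
  unfolding divergence_def covariant_derivative_X trace_add trace_deformation
  by (simp add: trace_def mat_def n_eq)

lemma div_X: "p \<in> topspace T \<Longrightarrow> div_field X p = n * \<phi> p"
  using cover[of p] div_field_eq[OF C1_X] divergence_X by metis

lemma integral_\<phi>: "(\<integral>p. \<phi> p \<partial>dV) = 0"
proof -
  have "(\<integral>p. div_field X p \<partial>dV) = (\<integral>p. n * \<phi> p \<partial>dV)"
    by (intro Bochner_Integration.integral_cong) (auto simp: div_X)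
  then show ?thesis using divergence_theorem[OF C1_X] by (simp add: n_eq)
qed

section \<open>The Ricci field and the integral of \<phi> R\<close>

definition ricci_field :: "('a, 'n) chart \<Rightarrow> real^'n \<Rightarrow> real^'n" where
  "ricci_field c x = local_metric.ricci_op (g c) x *v X c x"

lemma C1_ricci_field: "C1_field ricci_field"
  unfolding C1_field_def
proof (intro conjI ballI)
  fix c assume c: "c \<in> A"
  interpret local_metric "coord_image c" "g c" by (rule chart_metric[OF c])
  show "Ck_on 1 (ricci_field c) (coord_image c)"
    unfolding ricci_field_def[abs_def]
    by (rule Ck_on_matrix_vector_mult[OF open_S Ck_ricci_op smooth_X[OF c]])
  fix d p assume d: "d \<in> A" and p: "p \<in> fst c \<inter> fst d"
  then have p: "p \<in> fst c" "p \<in> fst d" by auto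
  interpret ch: chart_change "overlap c d" "g c" "coord_image d" "g d" "transition c d"
    by (rule chart_change[OF c d])
  have "ch.J (snd c p) ** ricci_op (snd c p) = ch.dst.ricci_op (snd d p) ** ch.J (snd c p)"
    using ch.ricci_op_change[OF overlap_in[OF p]] by (simp only: transition_chart[OF c p(1)])
  then show "ricci_field d (snd d p) = jacobian (transition c d) (at (snd c p)) *v ricci_field c (snd c p)"
    unfolding ricci_field_def C1_fieldD(2)[OF C1_X c d p] ch.J_def[symmetric]
    by (simp add: matrix_vector_mul_assoc)
qed

text \<open>The derivatives of R along X cancel: the Ricci field carries half of them and is
  doubled, the field R X carries them once. The remaining zeroth order terms are 2 \<phi> R and - n
  \<phi> R, as the skew part drops out of the trace with the Ricci operator.\<close>

lemma divergence_ricci_field: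
  assumes p: "p \<in> topspace T"
  shows "2 * div_field ricci_field p - div_field (scale_field R X) p = (2 - n) * (\<phi> p * R p)"
proof -
  obtain c where c: "c \<in> A" "p \<in> fst c" using cover[OF p] by blast
  interpret local_metric "coord_image c" "g c" by (rule chart_metric[OF c(1)])
  let ?x = "snd c p"
  have x: "?x \<in> coord_image c" by (rule coord_in[OF c])
  let ?S = "\<Sum>m\<in>UNIV. partial m (scal (g c)) ?x * X c ?x $ m"
  have "g c ?x ** ricci_op ?x = ricci (g c) ?x" by (simp add: ricci_op_def matrix_mul_assoc x)
  moreover have "transpose (ricci (g c) ?x) = ricci (g c) ?x"
    using ricci_symmetric[OF x] by (simp add: vec_eq_iff transpose_def)
  ultimately have "trace (ricci_op ?x ** deformation c p) = 0"
    by (intro trace_mult_deformation[OF c]) simp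
  then have "trace (ricci_op ?x ** covariant_derivative (g c) (X c) ?x) = \<phi> p * R p"
    unfolding covariant_derivative_X R_chart[OF c] scal_eq_trace[OF x] matrix_mult.add_right trace_add
    by (simp add: trace_def sum_distrib_left)
  then have "div_field ricci_field p = ?S / 2 + \<phi> p * R p"
    unfolding div_field_eq[OF C1_ricci_field c]
    using divergence_ricci_op[OF x differentiable_X[OF c(1) x]] by (simp add: ricci_field_def[abs_def])
  moreover have dR: "partial i (R \<circ> coord_inv c) ?x = partial i (scal (g c)) ?x" for i
    by (rule partial_cong[OF open_S x R_coord[OF c(1)]])
  moreover have "div_field (scale_field R X) p = R p * (n * \<phi> p) + ?S"
    unfolding div_field_eq[OF C1_scale_field[OF C1_R C1_X] c] divergence_scale_field[OF C1_R C1_X c]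
      divergence_X[OF c] dR by simp
  ultimately show ?thesis by (simp add: algebra_simps)
qed

text \<open>Both divergences integrate to zero, and 2 - n is nonzero in dimension at least
  three.\<close>

lemma integral_\<phi>_R:
  assumes "CARD('n) \<ge> 3"
  shows "(\<integral>p. \<phi> p * R p \<partial>dV) = 0"
proof -
  have C: "C1_field (scale_field R X)" by (rule C1_scale_field[OF C1_R C1_X])
  have "(2 - n) * (\<integral>p. \<phi> p * R p \<partial>dV) = (\<integral>p. (2 - n) * (\<phi> p * R p) \<partial>dV)" by simp
  also have "\<dots> = (\<integral>p. 2 * div_field ricci_field p - div_field (scale_field R X) p \<partial>dV)"
    by (intro Bochner_Integration.integral_cong) (auto simp: divergence_ricci_field)
  also have "\<dots> = 2 * (\<integral>p. div_field ricci_field p \<partial>dV) - (\<integral>p. div_field (scale_field R X) p \<partial>dV)"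
    using integrable_continuous[OF continuous_div_field[OF C1_ricci_field]]
      integrable_continuous[OF continuous_div_field[OF C]] by simp
  also have "\<dots> = 0" using divergence_theorem[OF C1_ricci_field] divergence_theorem[OF C] by simp
  finally show ?thesis using assms by (simp add: n_eq)
qed

lemma killing: assumes "\<And>p. p \<in> topspace T \<Longrightarrow> \<phi> p = 0" shows "killing_field A g X"
  unfolding killing_field_def
proof (intro ballI)
  fix c x assume c: "c \<in> A" and x: "x \<in> coord_image c"
  have "\<phi> (coord_inv c x) = 0" using assms coord_inv_in[OF c x] chart_subset[OF c] by blast
  then show "lie_derivative (X c) (g c) x = 0"
    using lie_derivative_X[OF c coord_inv_in[OF c x]] chart_coord_inv[OF c x] by simp
qed

lemma \<phi>_zero_if_square:
  assumes "(\<integral>p. (\<phi> p)\<^sup>2 \<partial>dV) \<le> 0" and "p \<in> topspace T"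
  shows "\<phi> p = 0"
proof -
  have c: "continuous_map T euclideanreal (\<lambda>p. (\<phi> p)\<^sup>2)" by (intro continuous_map_real_pow continuous_\<phi>)
  have "(\<integral>p. (\<phi> p)\<^sup>2 \<partial>dV) = 0" using assms(1) by (simp add: antisym)
  from integral_zero_imp_zero[OF c _ this assms(2)] show ?thesis by simp
qed

lemma integrable_products:
  "integrable dV (\<lambda>p. (R p)\<^sup>2)" "integrable dV (\<lambda>p. (\<rho> p)\<^sup>2)" "integrable dV (\<lambda>p. (\<phi> p)\<^sup>2)"
  "integrable dV (\<lambda>p. \<phi> p * R p)" "integrable dV (\<lambda>p. \<rho> p * \<phi> p)"
  by (intro integrable_continuous continuous_map_real_pow continuous_map_real_mult
      continuous_R continuous_\<rho> continuous_\<phi>)+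

text \<open>Here \<phi> is continuous and nonnegative with integral zero.\<close>

lemma \<phi>_zero_of_le:
  assumes "\<And>p. p \<in> topspace T \<Longrightarrow> \<rho> p \<le> R p" and "p \<in> topspace T"
  shows "\<phi> p = 0"
  using integral_zero_imp_zero[OF continuous_\<phi> _ integral_\<phi> assms(2)] assms(1) by (simp add: \<phi>_def)

lemma metric_inner_grad:
  assumes p: "p \<in> topspace T"
  shows "metric_inner A g X (grad g \<rho>) p = div_field (scale_field \<rho> X) p - n * (\<rho> p * \<phi> p)"
proof -
  \<comment> \<open>The very chart chosen by \<open>scalar_of\<close>, so that
    \<open>metric_inner\<close> unfolds in it directly. There the metric cancels the inverse metric
    in the gradient, and the differential of \<rho> applied to X remains.\<close>
  define c where "c = (SOME c. c \<in> A \<and> p \<in> fst c)"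
  have "c \<in> A \<and> p \<in> fst c" unfolding c_def by (rule someI_ex) (use cover[OF p] in blast)
  then have c: "c \<in> A" "p \<in> fst c" by auto
  interpret local_metric "coord_image c" "g c" by (rule chart_metric[OF c(1)])
  have x: "snd c p \<in> coord_image c" by (rule coord_in[OF c])
  have "metric_inner A g X (grad g \<rho>) p = X c (snd c p) \<bullet> (g c (snd c p) *v grad g \<rho> c (snd c p))"
    by (simp add: metric_inner_def scalar_of_def c_def[symmetric])
  also have "\<dots> = (\<Sum>i\<in>UNIV. partial i (\<rho> \<circ> coord_inv c) (snd c p) * X c (snd c p) $ i)"
    by (simp add: grad_def gradient_def matrix_vector_mul_assoc x inner_vec_def mult.commute)
  finally show ?thesis
    unfolding div_field_eq[OF C1_scale_field[OF C1_\<rho> C1_X] c] divergence_scale_field[OF C1_\<rho> C1_X c] divergence_X[OF c]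
    by (simp add: algebra_simps)
qed

text \<open>The divergence of \<rho> X integrates to zero, so the sign of the gradient term forces a
  nonnegative integral of \<rho> \<phi>. As \<phi> R integrates to zero, \<phi>^2 = \<phi> R -
  \<rho> \<phi> has a nonpositive integral.\<close>

lemma \<phi>_zero_of_gradient:
  assumes n: "CARD('n) \<ge> 3" and le: "\<And>p. p \<in> topspace T \<Longrightarrow> metric_inner A g X (grad g \<rho>) p \<le> 0" and p: "p \<in> topspace T"
  shows "\<phi> p = 0"
proof (rule \<phi>_zero_if_square[OF _ p])
  have C: "C1_field (scale_field \<rho> X)" by (rule C1_scale_field[OF C1_\<rho> C1_X])
  let ?d = "div_field (scale_field \<rho> X)"
  have d: "integrable dV ?d" by (rule integrable_continuous[OF continuous_div_field[OF C]])
  have "(\<integral>p. ?d p - n * (\<rho> p * \<phi> p) \<partial>dV) \<le> (\<integral>p. 0 \<partial>dV)"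
    using d integrable_products(5) metric_inner_grad le by (intro integral_mono) auto
  then have "n * (\<integral>p. \<rho> p * \<phi> p \<partial>dV) \<ge> 0"
    using d integrable_products(5) divergence_theorem[OF C] by simp
  then have ge: "(\<integral>p. \<rho> p * \<phi> p \<partial>dV) \<ge> 0" using n by (simp add: zero_le_mult_iff n_eq)
  have "(\<integral>p. (\<phi> p)\<^sup>2 \<partial>dV) = (\<integral>p. \<phi> p * R p - \<rho> p * \<phi> p \<partial>dV)"
    by (intro Bochner_Integration.integral_cong) (auto simp: \<phi>_def power2_eq_square algebra_simps)
  also have "\<dots> = - (\<integral>p. \<rho> p * \<phi> p \<partial>dV)"
    using integrable_products(4,5) integral_\<phi>_R[OF n] by simp
  finally show "(\<integral>p. (\<phi> p)\<^sup>2 \<partial>dV) \<le> 0" using ge by simp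
qed

section \<open>The Bochner formula and parallel fields\<close>

definition transport_field :: "('a, 'n) chart \<Rightarrow> real^'n \<Rightarrow> real^'n" where
  "transport_field c x = covariant_derivative (g c) (X c) x *v X c x"

lemma covariant_derivative_X_change:
  assumes c: "c \<in> A" and d: "d \<in> A" and p: "p \<in> fst c" "p \<in> fst d"
  shows "jacobian (transition c d) (at (snd c p)) ** covariant_derivative (g c) (X c) (snd c p)
    = covariant_derivative (g d) (X d) (snd d p) ** jacobian (transition c d) (at (snd c p))"
proof -
  interpret ch: chart_change "overlap c d" "g c" "coord_image d" "g d" "transition c d"
    by (rule chart_change[OF c d])
  have "ch.J (snd c p) ** covariant_derivative (g c) (X c) (snd c p)
    = covariant_derivative (g d) (X d) (transition c d (snd c p)) ** ch.J (snd c p)"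
  proof (rule ch.covariant_derivative_change[OF overlap_in[OF p]])
    show "X c differentiable (at (snd c p))" by (rule differentiable_X[OF c coord_in[OF c p(1)]])
    show "X d differentiable (at (transition c d (snd c p)))"
      unfolding transition_chart[OF c p(1)] by (rule differentiable_X[OF d coord_in[OF d p(2)]])
    show "X d (transition c d y) = ch.J y *v X c y" if "y \<in> overlap c d" for y
      unfolding ch.J_def by (rule field_transition[OF C1_fieldD(2)[OF C1_X c d] c that])
  qed
  then show ?thesis by (simp only: transition_chart[OF c p(1)] ch.J_def)
qed

lemma C1_transport_field: "C1_field transport_field"
  unfolding C1_field_def
proof (intro conjI ballI)
  fix c assume c: "c \<in> A"
  interpret local_metric "coord_image c" "g c" by (rule chart_metric[OF c])
  show "Ck_on 1 (transport_field c) (coord_image c)"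
    unfolding transport_field_def[abs_def]
    by (rule Ck_on_matrix_vector_mult[OF open_S Ck_covariant_derivative[OF smooth_X[OF c]] smooth_X[OF c]])
  fix d p assume d: "d \<in> A" and p: "p \<in> fst c \<inter> fst d"
  then have p: "p \<in> fst c" "p \<in> fst d" by auto
  show "transport_field d (snd d p) = jacobian (transition c d) (at (snd c p)) *v transport_field c (snd c p)"
    unfolding transport_field_def C1_fieldD(2)[OF C1_X c d p]
    by (simp add: matrix_vector_mul_assoc covariant_derivative_X_change[OF c d p])
qed

text \<open>The derivatives of div X along X occur in both divergences and cancel. Squaring \<phi> I
  + N gives the trace n \<phi>^2 + tr N^2, the mixed term being traceless; subtracting (n \<phi>)^2
  leaves the coefficient - n (n - 1).\<close>

lemma bochner:
  assumes c: "c \<in> A" and p: "p \<in> fst c"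
  shows "div_field transport_field p - div_field (scale_field (\<lambda>p. n * \<phi> p) X) p
    = X c (snd c p) \<bullet> (ricci (g c) (snd c p) *v X c (snd c p)) - n * (n - 1) * (\<phi> p)\<^sup>2
      + trace (deformation c p ** deformation c p)"
proof -
  interpret local_metric "coord_image c" "g c" by (rule chart_metric[OF c])
  let ?x = "snd c p" and ?N = "deformation c p"
  have x: "?x \<in> coord_image c" by (rule coord_in[OF c p])
  let ?S = "\<Sum>j\<in>UNIV. partial j (divergence (g c) (X c)) ?x * X c ?x $ j"
  have "((\<lambda>p. n * \<phi> p) \<circ> coord_inv c) y = divergence (g c) (X c) y" if "y \<in> coord_image c" for y
    using divergence_X[OF c coord_inv_in[OF c that]] chart_coord_inv[OF c that] by simp
  then have dphi: "partial i ((\<lambda>p. n * \<phi> p) \<circ> coord_inv c) ?x = partial i (divergence (g c) (X c)) ?x" for i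
    by (rule partial_cong[OF open_S x])
  have "div_field (scale_field (\<lambda>p. n * \<phi> p) X) p = n * \<phi> p * (n * \<phi> p) + ?S"
    unfolding div_field_eq[OF C1_scale_field[OF C1_n\<phi> C1_X] c p] divergence_scale_field[OF C1_n\<phi> C1_X c p]
      divergence_X[OF c p] dphi by simp
  moreover have "div_field transport_field p
    = trace (covariant_derivative (g c) (X c) ?x ** covariant_derivative (g c) (X c) ?x)
      + X c ?x \<bullet> (ricci (g c) ?x *v X c ?x) + ?S"
    unfolding div_field_eq[OF C1_transport_field c p]
    unfolding transport_field_def[abs_def]
    by (rule divergence_covariant_derivative[OF x smooth_X[OF c]])
  moreover have "trace (covariant_derivative (g c) (X c) ?x ** covariant_derivative (g c) (X c) ?x)
     = n * (\<phi> p)\<^sup>2 + trace (?N ** ?N)"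
  proof -
    have e: "(2 * \<phi> p) *\<^sub>R ?N = \<phi> p *\<^sub>R ?N + \<phi> p *\<^sub>R ?N"
      by (simp only: mult_2 scaleR_left_distrib)
    have "covariant_derivative (g c) (X c) ?x ** covariant_derivative (g c) (X c) ?x
      = (\<phi> p)\<^sup>2 *\<^sub>R mat 1 + (2 * \<phi> p) *\<^sub>R ?N + ?N ** ?N"
      unfolding covariant_derivative_X matrix_ring e by (simp add: power2_eq_square)
    moreover have "trace ((2 * \<phi> p) *\<^sub>R ?N) = 2 * \<phi> p * trace ?N"
      by (simp add: trace_def sum_distrib_left)
    moreover have "trace ((\<phi> p)\<^sup>2 *\<^sub>R mat 1 :: real^'n^'n) = n * (\<phi> p)\<^sup>2"
      by (simp add: trace_def mat_def n_eq)
    ultimately show ?thesis by (simp add: trace_add trace_deformation[OF c p])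
  qed
  ultimately show ?thesis by (simp add: algebra_simps power2_eq_square)
qed

text \<open>\<open>F\<close> is minus the left side of \<open>bochner\<close>. Under the sign
  condition it is bounded below by n (n - 1) \<phi>^2 - tr N^2, a sum of two nonnegative terms, yet
  it integrates to zero. Hence \<phi> and tr N^2 vanish, and \<open>trace_square_skew\<close> gives
  N = 0.\<close>

lemma parallel_of_Ric:
  assumes n: "CARD('n) \<ge> 3" and le: "\<And>p. p \<in> topspace T \<Longrightarrow> Ric A g X X p \<le> 0"
  shows "parallel_field A g X" and "p \<in> topspace T \<Longrightarrow> \<phi> p = 0"
proof -
  define F where "F p = div_field (scale_field (\<lambda>p. n * \<phi> p) X) p - div_field transport_field p" for p
  have C: "C1_field (scale_field (\<lambda>p. n * \<phi> p) X)" by (rule C1_scale_field[OF C1_n\<phi> C1_X])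
  have contF: "continuous_map T euclideanreal F"
    unfolding F_def[abs_def] by (intro continuous_map_diff continuous_div_field C C1_transport_field)
  have intF: "(\<integral>p. F p \<partial>dV) = 0"
    unfolding F_def using divergence_theorem[OF C] divergence_theorem[OF C1_transport_field]
      integrable_continuous[OF continuous_div_field[OF C]]
      integrable_continuous[OF continuous_div_field[OF C1_transport_field]] by simp
  have "\<exists>c\<in>A. p \<in> fst c \<and> F p \<ge> n * (n - 1) * (\<phi> p)\<^sup>2 - trace (deformation c p ** deformation c p)
      \<and> trace (deformation c p ** deformation c p) \<le> 0
      \<and> (trace (deformation c p ** deformation c p) = 0 \<longrightarrow> deformation c p = 0)" if p: "p \<in> topspace T" for p
  proof -
    \<comment> \<open>Again the chart in which \<open>Ric\<close> is evaluated by
      definition.\<close>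
    define c where "c = (SOME c. c \<in> A \<and> p \<in> fst c)"
    have "c \<in> A \<and> p \<in> fst c" unfolding c_def by (rule someI_ex) (use cover[OF p] in blast)
    then have c: "c \<in> A" "p \<in> fst c" by auto
    interpret local_metric "coord_image c" "g c" by (rule chart_metric[OF c(1)])
    have x: "snd c p \<in> coord_image c" by (rule coord_in[OF c])
    have "Ric A g X X p = X c (snd c p) \<bullet> (ricci (g c) (snd c p) *v X c (snd c p))"
      by (simp add: Ric_def scalar_of_def c_def[symmetric])
    then have "F p \<ge> n * (n - 1) * (\<phi> p)\<^sup>2 - trace (deformation c p ** deformation c p)"
      using bochner[OF c] le[OF p] by (simp add: F_def)
    then show ?thesis
      using c trace_square_skew[OF symmetric[OF x] positive[OF x] deformation_skew[OF c]] by blast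
  qed
  then obtain c where c: "\<And>p. p \<in> topspace T \<Longrightarrow> c p \<in> A" "\<And>p. p \<in> topspace T \<Longrightarrow> p \<in> fst (c p)"
    and ge: "\<And>p. p \<in> topspace T \<Longrightarrow> F p \<ge> n * (n - 1) * (\<phi> p)\<^sup>2 - trace (deformation (c p) p ** deformation (c p) p)"
    and tr: "\<And>p. p \<in> topspace T \<Longrightarrow> trace (deformation (c p) p ** deformation (c p) p) \<le> 0"
     "\<And>p. p \<in> topspace T \<Longrightarrow> trace (deformation (c p) p ** deformation (c p) p) = 0 \<Longrightarrow> deformation (c p) p = 0"
    by metis
  have nn: "n * (n - 1) > 0" using n by (simp add: n_eq)
  have sq: "n * (n - 1) * (\<phi> p)\<^sup>2 \<ge> 0" for p by (intro mult_nonneg_nonneg less_imp_le[OF nn]) simp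
  have "F p \<ge> 0" if "p \<in> topspace T" for p using ge[OF that] tr(1)[OF that] sq[of p] by linarith
  then have F0: "F p = 0" if "p \<in> topspace T" for p by (rule integral_zero_imp_zero[OF contF _ intF that])
  have zero: "n * (n - 1) * (\<phi> p)\<^sup>2 = 0" "trace (deformation (c p) p ** deformation (c p) p) = 0" if "p \<in> topspace T" for p
    using ge[OF that] tr(1)[OF that] sq[of p] F0[OF that] by linarith+
  show phi: "\<phi> p = 0" if "p \<in> topspace T" for p
    using zero(1)[OF that] nn by auto
  show "parallel_field A g X"
    unfolding parallel_field_def
  proof (intro ballI)
    fix d x assume d: "d \<in> A" and x: "x \<in> coord_image d"
    define p where "p = coord_inv d x"
    have p: "p \<in> fst d" "p \<in> topspace T" "x = snd d p"
      using coord_inv_in[OF d x] chart_subset[OF d] chart_coord_inv[OF d x] by (auto simp: p_def)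
    interpret ch: chart_change "overlap d (c p)" "g d" "coord_image (c p)" "g (c p)" "transition d (c p)"
      by (rule chart_change[OF d c(1)[OF p(2)]])
    \<comment> \<open>So far the vanishing is known in the selected chart \<open>c p\<close> only;
      the transformation law and an invertible Jacobian carry it to the arbitrary chart
      \<open>d\<close>.\<close>
    have "covariant_derivative (g (c p)) (X (c p)) (snd (c p) p) = 0"
      unfolding covariant_derivative_X using tr(2)[OF p(2) zero(2)[OF p(2)]] phi[OF p(2)] by simp
    then have "ch.J (snd d p) ** covariant_derivative (g d) (X d) (snd d p) = 0"
      using covariant_derivative_X_change[OF d c(1)[OF p(2)] p(1) c(2)[OF p(2)]]
      by (simp add: ch.J_def matrix_mult.zero_left)
    then have "matrix_inv (ch.J (snd d p)) ** (ch.J (snd d p) ** covariant_derivative (g d) (X d) (snd d p)) = 0"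
      by (simp add: matrix_mult.zero_right)
    then show "covariant_derivative (g d) (X d) x = 0"
      using ch.J_inverse(2)[OF overlap_in[OF p(1) c(2)[OF p(2)]]] by (simp add: matrix_mul_assoc p(3))
  qed
qed

lemma flat_of_integrals:
  assumes n: "CARD('n) \<ge> 3" and eq: "(\<integral>p. (R p)\<^sup>2 \<partial>dV) = 2 * (\<integral>p. (\<rho> p)\<^sup>2 \<partial>dV)" and p: "p \<in> topspace T"
  shows "R p = 0" "\<rho> p = 0"
proof -
  \<comment> \<open>The square is arranged so that the mixed term is \<phi> R, whose integral is
    zero; the hypothesis then turns the rest into minus the integral of \<rho>^2.\<close>
  have "(\<integral>p. (\<phi> p)\<^sup>2 \<partial>dV) = (\<integral>p. 2 * (\<phi> p * R p) - (R p)\<^sup>2 + (\<rho> p)\<^sup>2 \<partial>dV)"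
    by (intro Bochner_Integration.integral_cong) (auto simp: \<phi>_def power2_eq_square algebra_simps)
  also have "\<dots> = - (\<integral>p. (\<rho> p)\<^sup>2 \<partial>dV)"
    using integrable_products integral_\<phi>_R[OF n] eq by simp
  finally have "(\<integral>p. (\<phi> p)\<^sup>2 \<partial>dV) = - (\<integral>p. (\<rho> p)\<^sup>2 \<partial>dV)" .
  moreover have "(\<integral>p. (\<phi> p)\<^sup>2 \<partial>dV) \<ge> 0" "(\<integral>p. (\<rho> p)\<^sup>2 \<partial>dV) \<ge> 0" by simp_all
  ultimately have z: "(\<integral>p. (\<rho> p)\<^sup>2 \<partial>dV) = 0" "(\<integral>p. (R p)\<^sup>2 \<partial>dV) = 0" using eq by linarith+
  have c: "continuous_map T euclideanreal (\<lambda>p. (R p)\<^sup>2)" "continuous_map T euclideanreal (\<lambda>p. (\<rho> p)\<^sup>2)"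
    by (intro continuous_map_real_pow continuous_R continuous_\<rho>)+
  show "R p = 0" using integral_zero_imp_zero[OF c(1) _ z(2) p] by simp
  show "\<rho> p = 0" using integral_zero_imp_zero[OF c(2) _ z(1) p] by simp
qed

lemma yamabe_of_zero:
  assumes R: "\<And>p. p \<in> topspace T \<Longrightarrow> R p = 0" and \<rho>: "\<And>p. p \<in> topspace T \<Longrightarrow> \<rho> p = 0"
  shows "yamabe_soliton T A g X"
  unfolding yamabe_soliton_def almost_yamabe_soliton_def
proof (intro exI[of _ 0] conjI ballI)
  show "smooth_vector_field A X" using soliton by (simp add: almost_yamabe_soliton_def)
  show "smooth_function A (\<lambda>_. 0)" by (simp add: smooth_function_def smooth_on_def comp_def)
  fix c p assume c: "c \<in> A" and p: "p \<in> fst c"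
  then have "p \<in> topspace T" using chart_subset by blast
  then have "R p = 0" "\<phi> p = 0" using R \<rho> by (simp_all add: \<phi>_def)
  then show "(1 / 2) *\<^sub>R lie_derivative (X c) (g c) (snd c p) = (R p - 0) *\<^sub>R g c (snd c p)"
    using lie_derivative_X[OF c p] by simp
qed (rule manifold, rule metric)

end

theorem theorem1p1:
  fixes T :: "'a topology"
    and A :: "('a, 'n::finite) chart set"
    and g :: "('a, 'n) chart \<Rightarrow> real^'n \<Rightarrow> real^'n^'n"
    and X :: "('a, 'n) chart \<Rightarrow> real^'n \<Rightarrow> real^'n"
    and \<rho> R :: "'a \<Rightarrow> real"
  assumes "almost_yamabe_soliton T A g X \<rho>"
    and "compact_space T"
    and "CARD('n) \<ge> 3"
    and "R = scalar_curvature A g"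
  shows "((\<forall>p\<in>topspace T. 0 \<le> \<rho> p \<and> \<rho> p \<le> R p) \<or>
          (\<forall>p\<in>topspace T. metric_inner A g X (grad g \<rho>) p \<le> 0)
            \<longrightarrow> killing_field A g X)
       \<and> ((\<forall>p\<in>topspace T. Ric A g X X p \<le> 0)
            \<longrightarrow> parallel_field A g X \<and> killing_field A g X)
       \<and> ((\<integral>p. (R p)\<^sup>2 \<partial>riemannian_measure T A g) = 2 * (\<integral>p. (\<rho> p)\<^sup>2 \<partial>riemannian_measure T A g)
            \<longrightarrow> killing_field A g X \<and> yamabe_soliton T A g X \<and>
                (\<forall>p\<in>topspace T. R p = 0 \<and> \<rho> p = 0))"
proof -
  interpret S: compact_almost_yamabe_soliton T A g X \<rho> "real CARD('n)"
    using assms(1,2) by unfold_locales (auto simp: almost_yamabe_soliton_def)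
  note n = assms(3) and R = assms(4)
  show ?thesis
  proof (intro conjI impI ballI)
    assume "(\<forall>p\<in>topspace T. 0 \<le> \<rho> p \<and> \<rho> p \<le> R p) \<or> (\<forall>p\<in>topspace T. metric_inner A g X (grad g \<rho>) p \<le> 0)"
    then show "killing_field A g X"
    proof
      assume "\<forall>p\<in>topspace T. 0 \<le> \<rho> p \<and> \<rho> p \<le> R p"
      then show ?thesis using S.\<phi>_zero_of_le R by (intro S.killing) blast
    next
      assume "\<forall>p\<in>topspace T. metric_inner A g X (grad g \<rho>) p \<le> 0"
      then show ?thesis using S.\<phi>_zero_of_gradient[OF n] by (intro S.killing) blast
    qed
  next
    assume "\<forall>p\<in>topspace T. Ric A g X X p \<le> 0"
    then have le: "\<And>p. p \<in> topspace T \<Longrightarrow> Ric A g X X p \<le> 0" by blast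
    show "parallel_field A g X" by (rule S.parallel_of_Ric(1)[OF n le])
    show "killing_field A g X" by (rule S.killing) (rule S.parallel_of_Ric(2)[OF n le])
  next
    assume "(\<integral>p. (R p)\<^sup>2 \<partial>riemannian_measure T A g) = 2 * (\<integral>p. (\<rho> p)\<^sup>2 \<partial>riemannian_measure T A g)"
    from S.flat_of_integrals[OF n this[unfolded R]]
    have z: "R p = 0" "\<rho> p = 0" if "p \<in> topspace T" for p using that R by simp_all
    show "killing_field A g X" using z R by (intro S.killing) (simp add: S.\<phi>_def)
    show "yamabe_soliton T A g X" using z R by (intro S.yamabe_of_zero) simp_all
    show "R p = 0" "\<rho> p = 0" if "p \<in> topspace T" for p using z that by simp_all
  qed
qed

end
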